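(* Let $1<p,r<\infty$. There is a constant $C$, depending only on $n,p,r$, such that for every $\kappa\in\mathbb{N}$, every vector-valued Haar-shift operator $\mathcal{S}_r$ of complexity $\kappa$ on $\mathbb{R}^n$, and every weight $w\in A_p$, $$\|\mathcal{S}_r\|_{L^p_{\ell^r}(w)\to L^{p,\infty}(w)}\le C\,2^{\kappa}\,[w]_{A_p}$$ and $$\|\mathcal{S}_r\|_{L^p_{\ell^r}(w)\to L^p(w)}\le C\,\kappa^4\,[w]_{A_p}^{\max\{1,\frac1{p-1}\}}.$$
   Context: $\mathbb{N}=\{1,2,\dots\}$. $\mathcal{D}=\{2^{-k}([0,1)^n+m):k\in\mathbb{Z},m\in\mathbb{Z}^n\}$ is the standard dyadic grid; $\ell(I)$ is the side length and $|I|$ the volume of a cube $I$. A generalized Haar shift operator of complexity $\kappa$ is an operator of the form $Sf=\sum_{I\in\mathcal{D}}S_If$, $S_If=\langle f,k_I\rangle h_I$, where $\langle f,g\rangle=\int fg\,dx$, the functions $h_I,k_I$ are supported on $I$ and constant on the dyadic subcubes of $I$ of side length $2^{-\kappa}\ell(I)$, $\|h_I\|_\infty\|k_I\|_\infty\le|I|^{-1}$, and $S$ is bounded on $L^2(\mathbb{R}^n)$ with norm at most $1$. The series is understood as the limit, as $N\to\infty$, of $\sum_{2^{-N}\le\ell(I)\le2^N}S_If$: for $f\in L^2$ the limit is assumed to exist in $L^2$, and for general $f\in L^1_{\rm loc}(\mathbb{R}^n)$, $Sf$ is said to be defined if the limit exists in measure on bounded sets. Given a sequence $\{S^j\}_{j\ge1}$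 of generalized Haar shift operators of complexity $\kappa$, the associated vector-valued Haar-shift operator of complexity $\kappa$ is $$\mathcal{S}_r\mathbf{f}(x)=\Big(\sum_{j=1}^\infty|S^jf_j(x)|^r\Big)^{1/r},\qquad \mathbf{f}=\{f_j\},\ f_j\in L^1_{\rm loc}(\mathbb{R}^n),$$ for those $\mathbf{f}$ for which all $S^jf_j$ are defined. A weight is an a.e. positive locally integrable function $w$; $w\in A_p$ means $[w]_{A_p}=\sup_Q\big(\frac1{|Q|}\int_Qw\big)\big(\frac1{|Q|}\int_Qw^{-1/(p-1)}\big)^{p-1}<\infty$, the supremum over all cubes $Q\subset\mathbb{R}^n$. $L^p_{\ell^r}(w)$ consists of sequences $\mathbf{f}=\{f_j\}$ of measurable functions with $\|\mathbf{f}\|_{L^p_{\ell^r}(w)}=\big(\int\|\mathbf{f}(x)\|_{\ell^r}^pw(x)\,dx\big)^{1/p}<\infty$, where $\|\mathbf{f}(x)\|_{\ell^r}=(\sum_j|f_j(x)|^r)^{1/r}$; $\|g\|_{L^{p,\infty}(w)}=\sup_{\alpha>0}\alpha\,w(\{x:|g(x)|>\alpha\})^{1/p}$ with $w(E)=\int_Ew\,dx$. For $X=L^p(w)$ or $X=L^{p,\infty}(w)$, $\|\mathcal{S}_r\|_{L^p_{\ell^r}(w)\to X}$ is the least $A$ with $\|\mathcal{S}_r\mathbf{f}\|_X\le A\|\mathbf{f}\|_{L^p_{\ell^r}(w)}$ for all $\mathbf{f}\in L^p_{\ell^r}(w)$ for which $\mathcal{S}_r\mathbf{f}$ is defined. 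*)

theory Defs
  imports "HOL-Analysis.Analysis"
begin

section \<open>Powers of extended nonnegative reals\<close>

text \<open>Only used with a positive exponent, where infinity is sent to infinity.\<close>

definition epowr :: "ennreal \<Rightarrow> real \<Rightarrow> ennreal" (infixr "epowr" 80) where
  "x epowr a = (if x = \<infinity> then \<infinity> else ennreal (enn2real x powr a))"


section \<open>Function spaces\<close>

definition locally_integrable :: "(real^'n \<Rightarrow> real) \<Rightarrow> bool" where
  "locally_integrable f \<longleftrightarrow> (\<forall>K. compact K \<longrightarrow> set_integrable lebesgue K f)"

definition Lp_norm :: "real \<Rightarrow> (real^'n \<Rightarrow> real) \<Rightarrow> (real^'n \<Rightarrow> ennreal) \<Rightarrow> ennreal" where
  "Lp_norm p w F = (\<integral>\<^sup>+x. F x epowr p * ennreal (w x) \<partial>lebesgue) epowr (1 / p)"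

definition weighted_measure :: "(real^'n \<Rightarrow> real) \<Rightarrow> (real^'n) set \<Rightarrow> ennreal" where
  "weighted_measure w E = (\<integral>\<^sup>+x\<in>E. ennreal (w x) \<partial>lebesgue)"

definition weak_Lp_norm :: "real \<Rightarrow> (real^'n \<Rightarrow> real) \<Rightarrow> (real^'n \<Rightarrow> ennreal) \<Rightarrow> ennreal" where
  "weak_Lp_norm p w F =
     (SUP \<alpha>\<in>{0::real<..}. ennreal \<alpha> * weighted_measure w {x. F x > ennreal \<alpha>} epowr (1 / p))"

definition lr_norm :: "real \<Rightarrow> (nat \<Rightarrow> real) \<Rightarrow> ennreal" where
  "lr_norm r a = (\<Sum>j. ennreal (\<bar>a j\<bar> powr r)) epowr (1 / r)"

definition Lp_lr_norm ::
  "real \<Rightarrow> real \<Rightarrow> (real^'n \<Rightarrow> real) \<Rightarrow> (nat \<Rightarrow> real^'n \<Rightarrow> real) \<Rightarrow> ennreal" where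
  "Lp_lr_norm p r w f = Lp_norm p w (\<lambda>x. lr_norm r (\<lambda>j. f j x))"

definition Lp_lr_space ::
  "real \<Rightarrow> real \<Rightarrow> (real^'n \<Rightarrow> real) \<Rightarrow> (nat \<Rightarrow> real^'n \<Rightarrow> real) set" where
  "Lp_lr_space p r w =
     {f. (\<forall>j. f j \<in> borel_measurable lebesgue) \<and> Lp_lr_norm p r w f < \<infinity>}"

abbreviation L2_norm :: "(real^'n \<Rightarrow> real) \<Rightarrow> ennreal" where
  "L2_norm f \<equiv> Lp_norm 2 (\<lambda>_. 1) (\<lambda>x. ennreal \<bar>f x\<bar>)"


section \<open>Muckenhoupt weights\<close>

definition weight :: "(real^'n \<Rightarrow> real) \<Rightarrow> bool" where
  "weight w \<longleftrightarrow> locally_integrable w \<and> (AE x in lebesgue. w x > 0)"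

definition cubes :: "(real^'n) set set" where
  "cubes = {cbox a (\<chi> i. a $ i + l) | a l. l > 0}"

definition average :: "(real^'n) set \<Rightarrow> (real^'n \<Rightarrow> real) \<Rightarrow> ennreal" where
  "average Q u = (\<integral>\<^sup>+x\<in>Q. ennreal (u x) \<partial>lebesgue) / emeasure lebesgue Q"

definition Ap_const :: "real \<Rightarrow> (real^'n \<Rightarrow> real) \<Rightarrow> ennreal" where
  "Ap_const p w =
     (SUP Q\<in>cubes. average Q w * average Q (\<lambda>x. w x powr (- 1 / (p - 1))) epowr (p - 1))"

definition Ap :: "real \<Rightarrow> (real^'n \<Rightarrow> real) set" where
  "Ap p = {w. weight w \<and> Ap_const p w < \<infinity>}"


section \<open>Generalized Haar shift operators\<close>

definition dyadic_cube :: "int \<Rightarrow> int^'n \<Rightarrow> (real^'n) set" where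
  "dyadic_cube i m =
     (\<lambda>y. 2 powi (- i) *\<^sub>R y) ` {y. \<forall>s. of_int (m $ s) \<le> y $ s \<and> y $ s < of_int (m $ s) + 1}"

text \<open>The cubes of the standard dyadic grid with side length \<open>2 powi (- i)\<close>.\<close>

definition dyadic_generation :: "int \<Rightarrow> (real^'n) set set" where
  "dyadic_generation i = range (dyadic_cube i)"

text \<open>
  A shift is given by two families \<open>h\<close>, \<open>k\<close> of functions indexed by the dyadic cubes.
  The partial sum ranges over the cubes with side length between \<open>2 powi (- N)\<close> and \<open>2 ^ N\<close>.
  When each \<open>h I\<close> vanishes off \<open>I\<close>, at most one cube per generation contributes at a given
  point, so that the infinite sum has only finitely many nonzero terms.
\<close>

type_synonym 'n cube_family = "(real^'n) set \<Rightarrow> real^'n \<Rightarrow> real"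

definition shift_partial_sum ::
  "'n::finite cube_family \<Rightarrow> 'n cube_family \<Rightarrow> nat \<Rightarrow> (real^'n \<Rightarrow> real) \<Rightarrow> real^'n \<Rightarrow> real" where
  "shift_partial_sum h k N f x =
     (\<Sum>\<^sub>\<infinity>I\<in>(\<Union>i\<in>{- int N..int N}. dyadic_generation i). (\<integral>y. f y * k I y \<partial>lebesgue) * h I x)"

text \<open>
  Because of the first two conditions, \<open>h I\<close> and \<open>k I\<close> take finitely many values, each nonzero
  one on a set of positive measure; hence the suprema are finite and equal the essential suprema.
\<close>

definition generalized_haar_shift ::
  "nat \<Rightarrow> 'n::finite cube_family \<Rightarrow> 'n cube_family \<Rightarrow> bool" where
  "generalized_haar_shift \<kappa> h k \<longleftrightarrow>
     (\<forall>i. \<forall>I\<in>dyadic_generation i.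
        (\<forall>x. x \<notin> I \<longrightarrow> h I x = 0 \<and> k I x = 0) \<and>
        (\<forall>J\<in>dyadic_generation (i + int \<kappa>). J \<subseteq> I \<longrightarrow> h I constant_on J \<and> k I constant_on J) \<and>
        (SUP x. \<bar>h I x\<bar>) * (SUP x. \<bar>k I x\<bar>) \<le> 1 / measure lebesgue I) \<and>
     (\<forall>f\<in>borel_measurable lebesgue. L2_norm f < \<infinity> \<longrightarrow>
        (\<exists>g\<in>borel_measurable lebesgue.
           (\<lambda>N. L2_norm (\<lambda>x. shift_partial_sum h k N f x - g x)) \<longlonglongrightarrow> 0 \<and>
           L2_norm g \<le> L2_norm f))"

text \<open>\<open>g\<close> is the limit of the partial sums in measure on bounded sets; it is unique a.e.\<close>

definition has_haar_shift ::
  "'n::finite cube_family \<Rightarrow> 'n cube_family \<Rightarrow> (real^'n \<Rightarrow> real) \<Rightarrow> (real^'n \<Rightarrow> real) \<Rightarrow> bool" where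
  "has_haar_shift h k f g \<longleftrightarrow>
     locally_integrable f \<and> g \<in> borel_measurable lebesgue \<and>
     (\<forall>B\<in>sets lebesgue. bounded B \<longrightarrow> (\<forall>\<epsilon>>0.
        (\<lambda>N. emeasure lebesgue {x\<in>B. \<bar>shift_partial_sum h k N f x - g x\<bar> > \<epsilon>}) \<longlonglongrightarrow> 0))"

definition haar_shift_defined ::
  "'n::finite cube_family \<Rightarrow> 'n cube_family \<Rightarrow> (real^'n \<Rightarrow> real) \<Rightarrow> bool" where
  "haar_shift_defined h k f \<longleftrightarrow> (\<exists>g. has_haar_shift h k f g)"

definition haar_shift ::
  "'n::finite cube_family \<Rightarrow> 'n cube_family \<Rightarrow> (real^'n \<Rightarrow> real) \<Rightarrow> real^'n \<Rightarrow> real" where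
  "haar_shift h k f = (SOME g. has_haar_shift h k f g)"


section \<open>Vector-valued Haar shift operators\<close>

definition vector_haar_shift ::
  "real \<Rightarrow> (nat \<Rightarrow> 'n::finite cube_family) \<Rightarrow> (nat \<Rightarrow> 'n cube_family) \<Rightarrow>
   (nat \<Rightarrow> real^'n \<Rightarrow> real) \<Rightarrow> real^'n \<Rightarrow> ennreal" where
  "vector_haar_shift r h k f x = lr_norm r (\<lambda>j. haar_shift (h j) (k j) (f j) x)"

definition vector_haar_shift_domain ::
  "(nat \<Rightarrow> 'n::finite cube_family) \<Rightarrow> (nat \<Rightarrow> 'n cube_family) \<Rightarrow>
   (nat \<Rightarrow> real^'n \<Rightarrow> real) set" where
  "vector_haar_shift_domain h k = {f. \<forall>j. haar_shift_defined (h j) (k j) (f j)}"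

text \<open>\<open>normX\<close> is the norm of the target space.\<close>

definition vector_haar_shift_norm ::
  "real \<Rightarrow> real \<Rightarrow> (real^'n \<Rightarrow> real) \<Rightarrow> ((real^'n \<Rightarrow> ennreal) \<Rightarrow> ennreal) \<Rightarrow>
   (nat \<Rightarrow> 'n::finite cube_family) \<Rightarrow> (nat \<Rightarrow> 'n cube_family) \<Rightarrow> ennreal" where
  "vector_haar_shift_norm p r w normX h k =
     Inf {A. \<forall>f\<in>Lp_lr_space p r w \<inter> vector_haar_shift_domain h k.
               normX (vector_haar_shift r h k f) \<le> A * Lp_lr_norm p r w f}"

end

theory Submission
  imports Defs
begin

text \<open>
  The vector-valued Haar shift is dominated pointwise by a positive operator that does not see the
  cancellation of the shift any more, and the weighted bounds are proved for that operator.
  For a sparse family \<open>S\<close> of dyadic cubes, one in which the members strictly below any member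
  \<open>Q\<close> fill at most half of \<open>Q\<close>, put \<open>A F x = (\<Sum>Q\<in>S, x \<in> Q. average of F over Q)\<close>. Both
  estimates follow from the domination of the \<open>l^r\<close> norm of the shift of \<open>f\<close> by
  \<open>C * \<kappa> * A \<bar>f\<bar>\<close>, called (D) below, where \<open>\<bar>f\<bar>\<close> is the pointwise \<open>l^r\<close> norm, with \<open>S\<close> depending on \<open>f\<close>
  and \<open>C\<close> only on the dimension and on \<open>r\<close>. The growth in \<open>\<kappa>\<close> is therefore linear, which is below
  both \<open>\<kappa>^4\<close> and \<open>2^\<kappa>\<close>.

  Domination. Inside a cube \<open>Q\<close>, stop at the maximal subcubes \<open>R\<close> on which either the average
  of \<open>\<bar>f\<bar>\<close> or the part of the shift that is already constant on \<open>R\<close> is much larger than the average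
  of \<open>\<bar>f\<bar>\<close> over \<open>Q\<close> (lemma \<open>stopping_step\<close>). Off the stopped cubes the shift is small, on each of them
  only the shift localised to \<open>R\<close> is left, and one iterates; what has to be shown is that the
  stopped cubes fill at most half of \<open>Q\<close>. This is a Calderon-Zygmund argument for the shift
  restricted to the cubes above the stopped ones: the good part is controlled by an \<open>L^q\<close> bound, and a
  bad piece with integral zero on \<open>R\<close> is only seen by the fewer than \<open>\<kappa>\<close> generations directly above \<open>R\<close>.
  The argument is run twice. For a single shift, with \<open>q = 2\<close>, it gives sparse domination and hence, by
  the unweighted case of the sparse bound, boundedness on \<open>L^r\<close> with constant \<open>C * \<kappa>\<close>. Summed
  over the components, this is an \<open>L^r\<close> bound for \<open>l^r\<close>-valued functions, and the second
  run, with \<open>q = r\<close>, gives (D) (lemma \<open>vector_sparse_domination\<close>).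

  Strong type. For \<open>p \<ge> 2\<close> the bilinear form of \<open>A\<close> is estimated cube by cube: the \<open>A_p\<close> condition
  and the disjoint cores of the sparse cubes turn it into a pairing of two martingale maximal
  functions, which costs one power of \<open>[w]\<close> (lemma \<open>bilinear_large\<close>). The form is symmetric, so
  duality gives the power \<open>1/(p-1)\<close> for \<open>p < 2\<close>.

  Weak type. For \<open>p \<ge> 2\<close> it follows from the strong bound. For \<open>p < 2\<close> the strong bound
  is too large, but a good-\<open>\<lambda>\<close> inequality reduces the claim to a testing condition for the integral
  of \<open>A f\<close> against \<open>w\<close> over one cube (lemma \<open>testing\<close>), and there a single power of \<open>[w]\<close> suffices.

  Discretisation. A partial sum over finitely many generations acts separately on the cubes of
  the coarsest generation and only sees the averages of \<open>f\<close> over cubes that are \<open>\<kappa>\<close> generations finer than the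
  finest one. Everything above therefore takes place on a finite tree. Partial sums inherit the \<open>L^2\<close> bound,
  up to a constant, because the cubes larger than a given cube \<open>Q\<close> act on functions that live on \<open>Q\<close> with
  geometrically decaying norms (lemma \<open>gen_sum_L2\<close>). A diagonal sequence of partial sums converges almost
  everywhere, and Fatou's lemma carries the bounds over to the shift.
\<close>

section \<open>Hoelder and Minkowski inequalities for finite sums\<close>

lemma Holder_sum_theta:
  fixes x y :: "'a \<Rightarrow> real"
  assumes "finite A" and x: "\<And>i. i \<in> A \<Longrightarrow> 0 \<le> x i" and y: "\<And>i. i \<in> A \<Longrightarrow> 0 \<le> y i"
    and \<theta>: "0 < \<theta>" "\<theta> < 1"
  shows "(\<Sum>i\<in>A. x i powr \<theta> * y i powr (1 - \<theta>)) \<le> sum x A powr \<theta> * sum y A powr (1 - \<theta>)"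
proof (cases "sum x A = 0 \<or> sum y A = 0")
  case True
  then have "(\<forall>i\<in>A. x i = 0) \<or> (\<forall>i\<in>A. y i = 0)"
    using sum_nonneg_eq_0_iff[OF assms(1), of x] sum_nonneg_eq_0_iff[OF assms(1), of y] x y by auto
  then have "(\<Sum>i\<in>A. x i powr \<theta> * y i powr (1 - \<theta>)) = 0" by (auto intro!: sum.neutral)
  then show ?thesis by simp
next
  case False
  define U V where "U = sum x A" and "V = sum y A"
  have U: "U > 0" and V: "V > 0"
    using False x y sum_nonneg[of A x] sum_nonneg[of A y] by (auto simp: U_def V_def less_le)
  have 1: "x i powr \<theta> * y i powr (1 - \<theta>) \<le>
      (U powr \<theta> * V powr (1 - \<theta>)) * (\<theta> * (x i / U) + (1 - \<theta>) * (y i / V))" if "i \<in> A" for i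
  proof (cases "x i = 0 \<or> y i = 0")
    case True
    then show ?thesis using x[OF that] y[OF that] U V \<theta> by auto
  next
    case False
    then have "(x i / U) powr \<theta> * (y i / V) powr (1 - \<theta>) \<le> \<theta> * (x i / U) + (1 - \<theta>) * (y i / V)"
      using x[OF that] y[OF that] U V \<theta> by (intro Youngs_inequality_0) (auto simp: less_le)
    then have "(U powr \<theta> * V powr (1 - \<theta>)) * ((x i / U) powr \<theta> * (y i / V) powr (1 - \<theta>))
      \<le> (U powr \<theta> * V powr (1 - \<theta>)) * (\<theta> * (x i / U) + (1 - \<theta>) * (y i / V))"
      by (intro mult_left_mono) auto
    then show ?thesis using U V x[OF that] y[OF that] by (simp add: powr_divide)
  qed
  have "(\<Sum>i\<in>A. x i powr \<theta> * y i powr (1 - \<theta>)) \<le>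
    (\<Sum>i\<in>A. (U powr \<theta> * V powr (1 - \<theta>)) * (\<theta> * (x i / U) + (1 - \<theta>) * (y i / V)))"
    by (intro sum_mono 1)
  also have "\<dots> = (U powr \<theta> * V powr (1 - \<theta>)) * (\<theta> * (U / U) + (1 - \<theta>) * (V / V))"
    by (simp add: sum_distrib_left[symmetric] sum.distrib sum_divide_distrib[symmetric] U_def V_def)
  also have "\<dots> = U powr \<theta> * V powr (1 - \<theta>)" using U V by simp
  finally show ?thesis by (simp add: U_def V_def)
qed

lemma Holder_sum:
  fixes a b :: "'a \<Rightarrow> real"
  assumes "finite A" and a: "\<And>i. i \<in> A \<Longrightarrow> 0 \<le> a i" and b: "\<And>i. i \<in> A \<Longrightarrow> 0 \<le> b i"
    and p: "1 < p"
  shows "(\<Sum>i\<in>A. a i * b i) \<le>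
    (\<Sum>i\<in>A. a i powr p) powr (1 / p) * (\<Sum>i\<in>A. b i powr (p / (p - 1))) powr (1 - 1 / p)"
proof -
  have "(\<Sum>i\<in>A. a i * b i) =
      (\<Sum>i\<in>A. (a i powr p) powr (1 / p) * (b i powr (p / (p - 1))) powr (1 - 1 / p))"
  proof (intro sum.cong refl)
    fix i assume i: "i \<in> A"
    have "p / (p - 1) * (1 - 1 / p) = 1" using p by (simp add: field_simps)
    then show "a i * b i = (a i powr p) powr (1 / p) * (b i powr (p / (p - 1))) powr (1 - 1 / p)"
      using a[OF i] b[OF i] p by (simp add: powr_powr)
  qed
  also have "\<dots> \<le> (\<Sum>i\<in>A. a i powr p) powr (1 / p) * (\<Sum>i\<in>A. b i powr (p / (p - 1))) powr (1 - 1 / p)"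
    using p by (intro Holder_sum_theta assms) auto
  finally show ?thesis .
qed

text \<open>
  Hoelder estimates below typically bound a quantity by a power of itself; this divides that power
  out.
\<close>

lemma absorb_powr:
  fixes S K T :: real
  assumes S: "0 \<le> S" and T: "0 \<le> T" and K: "0 \<le> K" and p: "1 < p"
    and le: "S \<le> K * T powr (1 / p) * S powr (1 - 1 / p)"
  shows "S \<le> K powr p * T"
proof (cases "S = 0")
  case True
  then show ?thesis using T by simp
next
  case False
  then have S0: "S > 0" using S by simp
  have "S powr (1 / p) * S powr (1 - 1 / p) = S" using S0 by (simp flip: powr_add)
  then have "S powr (1 / p) * S powr (1 - 1 / p) \<le> (K * T powr (1 / p)) * S powr (1 - 1 / p)"
    using le by simp
  then have "S powr (1 / p) \<le> K * T powr (1 / p)" using S0 by simp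
  then have "(S powr (1 / p)) powr p \<le> (K * T powr (1 / p)) powr p"
    using p by (intro powr_mono2) auto
  then show ?thesis using p S0 T K by (simp add: powr_powr powr_mult)
qed

text \<open>
  The \<open>l^r\<close> norm of the first \<open>J\<close> coordinates. Infinite sequences only enter in the final limit, so
  that all estimates before it are between real numbers. For \<open>J = 1\<close> this is the absolute value of
  the coordinate \<open>0\<close>, which makes the scalar theory a special case.
\<close>

definition lr :: "nat \<Rightarrow> real \<Rightarrow> (nat \<Rightarrow> real) \<Rightarrow> real" where
  "lr J r a = (\<Sum>j<J. \<bar>a j\<bar> powr r) powr (1 / r)"

lemma lr_nonneg [simp]: "0 \<le> lr J r a"
  by (simp add: lr_def)

lemma lr_powr: "1 < r \<Longrightarrow> lr J r a powr r = (\<Sum>j<J. \<bar>a j\<bar> powr r)"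
  by (simp add: lr_def powr_powr sum_nonneg)

lemma lr_mono:
  assumes "1 < r" "\<And>j. j < J \<Longrightarrow> \<bar>a j\<bar> \<le> \<bar>b j\<bar>"
  shows "lr J r a \<le> lr J r b"
  unfolding lr_def using assms by (intro powr_mono2 sum_mono sum_nonneg) auto

lemma lr_zero: "(\<And>j. j < J \<Longrightarrow> a j = 0) \<Longrightarrow> lr J r a = 0"
  by (simp add: lr_def)

lemma lr_scale:
  assumes "1 < r" shows "lr J r (\<lambda>j. t * a j) = \<bar>t\<bar> * lr J r a"
  using assms unfolding lr_def
  by (simp add: abs_mult powr_mult sum_distrib_left[symmetric] powr_powr sum_nonneg)

lemma lr_minus: "lr J r (\<lambda>j. - a j) = lr J r a"
  by (simp add: lr_def)

lemma lr_one: "1 < r \<Longrightarrow> lr 1 r a = \<bar>a 0\<bar>"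
  by (simp add: lr_def powr_powr)

lemma lr_Holder:
  assumes "1 < r"
  shows "(\<Sum>j<J. \<bar>a j\<bar> * \<bar>b j\<bar> powr (r - 1)) \<le> lr J r a * lr J r b powr (r - 1)"
proof -
  have e: "(r - 1) * (r / (r - 1)) = r" using assms by simp
  have "(\<Sum>j<J. \<bar>a j\<bar> * \<bar>b j\<bar> powr (r - 1)) \<le> (\<Sum>j<J. \<bar>a j\<bar> powr r) powr (1 / r) *
      (\<Sum>j<J. (\<bar>b j\<bar> powr (r - 1)) powr (r / (r - 1))) powr (1 - 1 / r)"
    using assms by (intro Holder_sum) auto
  also have "\<dots> = lr J r a * lr J r b powr (r - 1)"
  proof -
    have "(1 / r) * (r - 1) = 1 - 1 / r" using assms by (simp add: field_simps)
    then show ?thesis unfolding lr_def powr_powr e by simp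
  qed
  finally show ?thesis .
qed

text \<open>
  The classical derivation from Hoelder's inequality: one factor \<open>\<bar>a j + b j\<bar>\<close> of the \<open>r\<close>-th power
  is split.
\<close>

lemma lr_triangle:
  assumes r: "1 < r"
  shows "lr J r (\<lambda>j. a j + b j) \<le> lr J r a + lr J r b"
proof -
  let ?s = "lr J r (\<lambda>j. a j + b j)"
  have "?s powr r = (\<Sum>j<J. \<bar>a j + b j\<bar> * \<bar>a j + b j\<bar> powr (r - 1))"
    using r by (simp add: lr_powr powr_mult_base)
  also have "\<dots> \<le> (\<Sum>j<J. \<bar>a j\<bar> * \<bar>a j + b j\<bar> powr (r - 1) + \<bar>b j\<bar> * \<bar>a j + b j\<bar> powr (r - 1))"
    by (intro sum_mono) (simp add: distrib_right[symmetric] mult_right_mono)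
  also have "\<dots> \<le> lr J r a * ?s powr (r - 1) + lr J r b * ?s powr (r - 1)"
    unfolding sum.distrib using r by (intro add_mono lr_Holder)
  finally have le: "?s powr r \<le> (lr J r a + lr J r b) * ?s powr (r - 1)" by (simp add: distrib_right)
  show ?thesis
  proof (cases "?s = 0")
    case False
    then have "?s > 0" by (simp add: less_le)
    moreover have "?s powr r = ?s * ?s powr (r - 1)" by (simp add: powr_mult_base)
    ultimately show ?thesis using le by simp
  qed simp
qed

lemma lr_sum:
  assumes r: "1 < r" and "finite A"
  shows "lr J r (\<lambda>j. \<Sum>i\<in>A. a i j) \<le> (\<Sum>i\<in>A. lr J r (a i))"
  using assms(2)
proof (induction A rule: finite_induct)
  case empty
  show ?case by (simp add: lr_zero)
next
  case (insert i A)
  have "lr J r (\<lambda>j. \<Sum>i\<in>insert i A. a i j) = lr J r (\<lambda>j. a i j + (\<Sum>i\<in>A. a i j))"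
    using insert by simp
  also have "\<dots> \<le> lr J r (a i) + lr J r (\<lambda>j. \<Sum>i\<in>A. a i j)" by (rule lr_triangle[OF r])
  finally show ?case using insert by simp
qed

section \<open>Finite trees and the maximal function\<close>

definition avg :: "('x \<Rightarrow> real) \<Rightarrow> ('x \<Rightarrow> real) \<Rightarrow> 'x set \<Rightarrow> real" where
  "avg \<nu> f Q = (\<Sum>y\<in>Q. f y * \<nu> y) / sum \<nu> Q"

text \<open>
  Averaging over the cells of a partition is the conditional expectation; integrated against a
  function \<open>u\<close> that is constant on the cells, it may be replaced by the function itself. The
  partition is given by the map \<open>C\<close> from points to their cells.
\<close>

lemma sum_avg_cells:
  fixes u f \<nu> :: "'x \<Rightarrow> real"
  assumes fin: "finite A" and pos: "\<And>x. x \<in> A \<Longrightarrow> 0 < \<nu> x"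
    and self: "\<And>x. x \<in> A \<Longrightarrow> x \<in> C x" and sub: "\<And>x. x \<in> A \<Longrightarrow> C x \<subseteq> A"
    and eq: "\<And>x y. x \<in> A \<Longrightarrow> y \<in> C x \<Longrightarrow> C y = C x"
    and u: "\<And>x y. x \<in> A \<Longrightarrow> y \<in> C x \<Longrightarrow> u y = u x"
  shows "(\<Sum>x\<in>A. u x * avg \<nu> f (C x) * \<nu> x) = (\<Sum>x\<in>A. u x * f x * \<nu> x)"
proof -
  have C: "C x = {y \<in> A. C y = C x}" if "x \<in> A" for x
    using that self sub eq by blast
  have "(\<Sum>x\<in>A. u x * avg \<nu> f (C x) * \<nu> x)
      = (\<Sum>x\<in>A. \<Sum>y | y \<in> A \<and> C y = C x. u x * f y * \<nu> y * \<nu> x / sum \<nu> (C x))"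
  proof (intro sum.cong refl)
    fix x assume x: "x \<in> A"
    have "u x * avg \<nu> f (C x) * \<nu> x = (\<Sum>y\<in>C x. u x * f y * \<nu> y * \<nu> x / sum \<nu> (C x))"
      unfolding avg_def sum_divide_distrib sum_distrib_left sum_distrib_right
      by (intro sum.cong refl) simp
    then show "u x * avg \<nu> f (C x) * \<nu> x =
       (\<Sum>y | y \<in> A \<and> C y = C x. u x * f y * \<nu> y * \<nu> x / sum \<nu> (C x))"
      using C[OF x] by simp
  qed
  also have "\<dots> = (\<Sum>y\<in>A. \<Sum>x | x \<in> A \<and> C y = C x. u x * f y * \<nu> y * \<nu> x / sum \<nu> (C x))"
    by (rule sum.swap_restrict) (use fin in auto)
  also have "\<dots> = (\<Sum>y\<in>A. u y * f y * \<nu> y)"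
  proof (intro sum.cong refl)
    fix y assume y: "y \<in> A"
    have "sum \<nu> (C y) > 0"
      using self[OF y] sub[OF y] pos fin by (intro sum_pos) (auto dest: finite_subset)
    moreover have "(\<Sum>x | x \<in> A \<and> C y = C x. u x * f y * \<nu> y * \<nu> x / sum \<nu> (C x))
       = (\<Sum>x\<in>C y. u y * f y * \<nu> y * \<nu> x / sum \<nu> (C y))"
    proof (rule sum.cong)
      show "{x \<in> A. C y = C x} = C y" using C[OF y] by auto
      show "u x * f y * \<nu> y * \<nu> x / sum \<nu> (C x) = u y * f y * \<nu> y * \<nu> x / sum \<nu> (C y)" if "x \<in> C y" for x
        using u[OF y that] eq[OF y that] by simp
    qed
    ultimately show "(\<Sum>x | x \<in> A \<and> C y = C x. u x * f y * \<nu> y * \<nu> x / sum \<nu> (C x)) = u y * f y * \<nu> y"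
      by (simp add: sum_distrib_left[symmetric] sum_divide_distrib[symmetric])
  qed
  finally show ?thesis .
qed

text \<open>
  A finite model of the dyadic subcubes of one cube: \<open>X\<close> is the set of atoms and \<open>c l x\<close> the cell of
  generation \<open>l\<close> around \<open>x\<close>. From generation \<open>L\<close> on all cells are single atoms. No measure is fixed,
  because the same tree carries Lebesgue measure, the weight and the dual weight.
\<close>

locale tree =
  fixes X :: "'x set" and c :: "nat \<Rightarrow> 'x \<Rightarrow> 'x set" and L :: nat
  assumes fin: "finite X"
    and c_sub: "x \<in> X \<Longrightarrow> c l x \<subseteq> X"
    and c_self: "x \<in> X \<Longrightarrow> x \<in> c l x"
    and c_eq: "x \<in> X \<Longrightarrow> y \<in> c l x \<Longrightarrow> c l y = c l x"
    and c_Suc: "x \<in> X \<Longrightarrow> c (Suc l) x \<subseteq> c l x"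
    and c_leaf: "x \<in> X \<Longrightarrow> c L x = {x}"
begin

definition cells :: "'x set set" where "cells = {c l x |l x. x \<in> X}"

lemma c_cells [intro, simp]: "x \<in> X \<Longrightarrow> c l x \<in> cells"
  by (auto simp: cells_def)

lemma c_antimono: assumes "x \<in> X" "l \<le> l'" shows "c l' x \<subseteq> c l x"
  using assms(2) by (induction rule: dec_induct) (use c_Suc[OF assms(1)] in auto)

lemma c_X: "x \<in> X \<Longrightarrow> y \<in> c l x \<Longrightarrow> y \<in> X"
  using c_sub by blast

lemma c_sym: "x \<in> X \<Longrightarrow> y \<in> c l x \<Longrightarrow> x \<in> c l y"
  using c_self[of x l] c_eq[of x y l] by simp

lemma c_beyond: "x \<in> X \<Longrightarrow> L \<le> l \<Longrightarrow> c l x = {x}"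
  using c_antimono[of x L l] c_leaf[of x] c_self[of x l] by auto

lemma cells_sub: "Q \<in> cells \<Longrightarrow> Q \<subseteq> X"
  using c_sub by (auto simp: cells_def)

lemma cells_fin: "Q \<in> cells \<Longrightarrow> finite Q"
  using cells_sub fin finite_subset by blast

lemma cells_nonempty: "Q \<in> cells \<Longrightarrow> Q \<noteq> {}"
  using c_self by (auto simp: cells_def)

lemma finite_cells: "finite cells"
  using cells_sub fin by (intro finite_subset[of cells "Pow X"]) auto

lemma cells_cases:
  assumes "Q \<in> cells" "x \<in> Q" obtains l where "l \<le> L" "Q = c l x"
proof -
  obtain l z where Q: "Q = c l z" "z \<in> X" using assms by (auto simp: cells_def)
  then have "Q = c l x" and x: "x \<in> X" using assms(2) c_eq[of z x l] c_X[of z x l] by blast+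
  show ?thesis
  proof (cases "l \<le> L")
    case True
    then show ?thesis using that \<open>Q = c l x\<close> by blast
  next
    case False
    then have "Q = c L x" using \<open>Q = c l x\<close> c_beyond[OF x, of l] c_leaf[OF x] by simp
    then show ?thesis using that by blast
  qed
qed

lemma cells_laminar:
  assumes "Q \<in> cells" "R \<in> cells" "x \<in> Q" "x \<in> R" shows "Q \<subseteq> R \<or> R \<subseteq> Q"
proof -
  have "x \<in> X" using assms cells_sub by blast
  moreover obtain l l' where "Q = c l x" "R = c l' x"
    using cells_cases[OF assms(1,3)] cells_cases[OF assms(2,4)] by metis
  ultimately show ?thesis using c_antimono[of x l l'] c_antimono[of x l' l] by (cases "l \<le> l'") auto
qed

lemma sum_cell_pos:
  fixes \<nu> :: "'x \<Rightarrow> real"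
  assumes "\<forall>x\<in>X. 0 < \<nu> x" "Q \<in> cells" shows "0 < sum \<nu> Q"
  using assms cells_sub[OF assms(2)] cells_nonempty cells_fin by (intro sum_pos) auto

lemma sum_avg_level:
  fixes u f \<nu> :: "'x \<Rightarrow> real"
  assumes \<nu>: "\<forall>x\<in>X. 0 < \<nu> x" and u: "\<And>x y. x \<in> X \<Longrightarrow> y \<in> c l x \<Longrightarrow> u y = u x"
  shows "(\<Sum>x\<in>X. u x * avg \<nu> f (c l x) * \<nu> x) = (\<Sum>x\<in>X. u x * f x * \<nu> x)"
  by (rule sum_avg_cells[OF fin \<nu>[rule_format] c_self c_sub c_eq u])

primrec running_max :: "('x \<Rightarrow> real) \<Rightarrow> ('x \<Rightarrow> real) \<Rightarrow> nat \<Rightarrow> 'x \<Rightarrow> real" where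
  "running_max \<nu> f 0 x = avg \<nu> f (c 0 x)"
| "running_max \<nu> f (Suc l) x = max (running_max \<nu> f l x) (avg \<nu> f (c (Suc l) x))"

lemma running_max_ge: "i \<le> l \<Longrightarrow> avg \<nu> f (c i x) \<le> running_max \<nu> f l x"
  by (induction l) (auto simp: le_Suc_eq le_max_iff_disj)

lemma running_max_const:
  assumes "x \<in> X" "y \<in> c l x" shows "running_max \<nu> f l y = running_max \<nu> f l x"
  using assms
proof (induction l)
  case (Suc l)
  then have "y \<in> c l x" using c_Suc by blast
  then show ?case using Suc c_eq[OF Suc.prems] by simp
qed (simp add: c_eq)

lemma avg_nonneg:
  assumes "\<forall>x\<in>X. 0 < \<nu> x" "\<forall>x\<in>X. 0 \<le> f x" "Q \<subseteq> X"
  shows "0 \<le> avg \<nu> f Q"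
  unfolding avg_def using assms
  by (intro divide_nonneg_nonneg sum_nonneg mult_nonneg_nonneg) (auto simp: subset_iff intro: less_imp_le)

text \<open>
  A pathwise form of Doob's maximal inequality. When the running maximum increases from \<open>t\<close> to \<open>s\<close>,
  Young's inequality bounds \<open>s^p - t^p\<close> by \<open>p/(p-1)\<close> times \<open>(s^(p-1) - t^(p-1)) * s\<close>, and \<open>s\<close> is the
  new average. Since the increment is constant on the cells of the new generation, the average may
  be replaced by \<open>f\<close> after summation, and the increments telescope.
\<close>

lemma Doob_running_max:
  fixes \<nu> f :: "'x \<Rightarrow> real"
  assumes \<nu>: "\<forall>x\<in>X. 0 < \<nu> x" and f: "\<forall>x\<in>X. 0 \<le> f x" and p: "1 < p"
  shows "(\<Sum>x\<in>X. running_max \<nu> f l x powr p * \<nu> x) \<le>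
    p / (p - 1) * (\<Sum>x\<in>X. running_max \<nu> f l x powr (p - 1) * f x * \<nu> x)"
proof (induction l)
  case 0
  have nn: "0 \<le> avg \<nu> f (c 0 x)" if "x \<in> X" for x using avg_nonneg[OF \<nu> f] c_sub[OF that] by blast
  have "(\<Sum>x\<in>X. running_max \<nu> f 0 x powr p * \<nu> x) =
      (\<Sum>x\<in>X. avg \<nu> f (c 0 x) powr (p - 1) * avg \<nu> f (c 0 x) * \<nu> x)"
    using nn by (intro sum.cong refl) (simp add: powr_mult_base mult.commute)
  also have "\<dots> = (\<Sum>x\<in>X. avg \<nu> f (c 0 x) powr (p - 1) * f x * \<nu> x)"
    by (rule sum_avg_level[OF \<nu>]) (metis c_eq)
  also have "\<dots> \<le> p / (p - 1) * (\<Sum>x\<in>X. avg \<nu> f (c 0 x) powr (p - 1) * f x * \<nu> x)"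
  proof -
    have "1 \<le> p / (p - 1)" using p by simp
    moreover have "0 \<le> (\<Sum>x\<in>X. avg \<nu> f (c 0 x) powr (p - 1) * f x * \<nu> x)"
      using \<nu> f by (intro sum_nonneg mult_nonneg_nonneg) (auto simp: less_imp_le)
    ultimately show ?thesis using mult_right_mono[of 1 "p / (p - 1)"] by simp
  qed
  finally show ?case by simp
next
  case (Suc l)
  let ?M = "running_max \<nu> f l" and ?N = "running_max \<nu> f (Suc l)"
  let ?u = "\<lambda>x. ?N x powr (p - 1) - ?M x powr (p - 1)"
  have nn: "0 \<le> ?M x" if "x \<in> X" for x
    using running_max_ge[of l l \<nu> f x] avg_nonneg[OF \<nu> f c_sub[OF that, of l]] by linarith
  \<comment> \<open>Where the maximum increases, its new value is the new average; elsewhere the increment vanishes.\<close>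
  have step: "?N x powr p - ?M x powr p \<le> p / (p - 1) * (?u x * avg \<nu> f (c (Suc l) x))"
    if x: "x \<in> X" for x
  proof (cases "avg \<nu> f (c (Suc l) x) \<le> ?M x")
    case True
    then show ?thesis by simp
  next
    case False
    define s t where "s = avg \<nu> f (c (Suc l) x)" and "t = ?M x"
    have st: "0 \<le> t" "t < s" "?N x = s" using False nn[OF x] by (auto simp: s_def t_def)
    have "s * t powr (p - 1) \<le> s powr p / p + (t powr (p - 1)) powr (p / (p - 1)) / (p / (p - 1))"
      using st p by (intro Youngs_inequality) (auto simp: field_simps)
    then have "s * t powr (p - 1) \<le> s powr p / p + t powr p * (p - 1) / p"
      using p by (simp add: powr_powr)
    then have "p * (s * t powr (p - 1)) \<le> s powr p + t powr p * (p - 1)"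
      using p by (simp add: field_simps)
    moreover have "s powr p = s powr (p - 1) * s" using st by (simp add: powr_mult_base mult.commute)
    ultimately have "(p - 1) * (s powr p - t powr p) \<le> p * ((s powr (p - 1) - t powr (p - 1)) * s)"
      by (simp add: algebra_simps)
    then have "s powr p - t powr p \<le> p / (p - 1) * ((s powr (p - 1) - t powr (p - 1)) * s)"
      using p by (simp add: field_simps)
    then show ?thesis unfolding st(3) by (simp add: s_def t_def)
  qed
  have "(\<Sum>x\<in>X. ?N x powr p * \<nu> x) - (\<Sum>x\<in>X. ?M x powr p * \<nu> x)
      = (\<Sum>x\<in>X. (?N x powr p - ?M x powr p) * \<nu> x)"
    by (simp only: sum_subtractf left_diff_distrib)
  also have "\<dots> \<le> (\<Sum>x\<in>X. p / (p - 1) * (?u x * avg \<nu> f (c (Suc l) x)) * \<nu> x)"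
    using \<nu> by (intro sum_mono mult_right_mono step) (auto simp: less_imp_le)
  also have "\<dots> = p / (p - 1) * (\<Sum>x\<in>X. ?u x * avg \<nu> f (c (Suc l) x) * \<nu> x)"
    by (simp only: sum_distrib_left mult.assoc)
  also have "(\<Sum>x\<in>X. ?u x * avg \<nu> f (c (Suc l) x) * \<nu> x) = (\<Sum>x\<in>X. ?u x * f x * \<nu> x)"
  proof (rule sum_avg_level[OF \<nu>])
    fix x y assume "x \<in> X" "y \<in> c (Suc l) x"
    then have "?N y = ?N x" "?M y = ?M x"
      using running_max_const[of x y "Suc l"] running_max_const[of x y l] c_Suc[of x l] by blast+
    then show "?u y = ?u x" by simp
  qed
  also have "\<dots> = (\<Sum>x\<in>X. ?N x powr (p - 1) * f x * \<nu> x) - (\<Sum>x\<in>X. ?M x powr (p - 1) * f x * \<nu> x)"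
    by (simp only: sum_subtractf left_diff_distrib)
  finally show ?case using Suc.IH by (simp only: right_diff_distrib)
qed

text \<open>
  The \<open>L^p\<close> bound of the maximal function of the tree for an arbitrary measure \<open>\<nu>\<close>, with a constant
  that does not depend on \<open>\<nu>\<close>: this independence is what allows averages with respect to the weight
  and to its dual to be used side by side.
\<close>

lemma Doob:
  fixes \<nu> f :: "'x \<Rightarrow> real"
  assumes \<nu>: "\<forall>x\<in>X. 0 < \<nu> x" and f: "\<forall>x\<in>X. 0 \<le> f x" and p: "1 < p"
  shows "\<exists>M. (\<forall>x\<in>X. 0 \<le> M x \<and> (\<forall>Q\<in>cells. x \<in> Q \<longrightarrow> avg \<nu> f Q \<le> M x)) \<and>
     (\<Sum>x\<in>X. M x powr p * \<nu> x) \<le> (p / (p - 1)) powr p * (\<Sum>x\<in>X. f x powr p * \<nu> x)"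
proof (intro exI conjI ballI impI)
  let ?M = "running_max \<nu> f L"
  show nn: "0 \<le> ?M x" if "x \<in> X" for x
    using running_max_ge[of L L \<nu> f x] avg_nonneg[OF \<nu> f c_sub[OF that, of L]] by linarith
  show "avg \<nu> f Q \<le> ?M x" if "x \<in> X" "Q \<in> cells" "x \<in> Q" for x Q
  proof -
    obtain l where "l \<le> L" "Q = c l x" by (rule cells_cases[OF \<open>Q \<in> cells\<close> \<open>x \<in> Q\<close>])
    then show ?thesis using running_max_ge[of l L \<nu> f x] by simp
  qed
  show "(\<Sum>x\<in>X. ?M x powr p * \<nu> x) \<le> (p / (p - 1)) powr p * (\<Sum>x\<in>X. f x powr p * \<nu> x)"
  proof (rule absorb_powr)
    have e: "?M x powr (p - 1) * f x * \<nu> x =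
        (f x * \<nu> x powr (1 / p)) * (?M x powr (p - 1) * \<nu> x powr (1 - 1 / p))" if "x \<in> X" for x
      using \<nu>[rule_format, OF that] by (simp flip: powr_add)
    have "(\<Sum>x\<in>X. ?M x powr (p - 1) * f x * \<nu> x) =
      (\<Sum>x\<in>X. (f x * \<nu> x powr (1 / p)) * (?M x powr (p - 1) * \<nu> x powr (1 - 1 / p)))"
      by (intro sum.cong refl e)
    also have "\<dots> \<le>
      (\<Sum>x\<in>X. (f x * \<nu> x powr (1 / p)) powr p) powr (1 / p) *
      (\<Sum>x\<in>X. (?M x powr (p - 1) * \<nu> x powr (1 - 1 / p)) powr (p / (p - 1))) powr (1 - 1 / p)"
      using f by (intro Holder_sum fin p) auto
    also have "(\<Sum>x\<in>X. (f x * \<nu> x powr (1 / p)) powr p) = (\<Sum>x\<in>X. f x powr p * \<nu> x)"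
      using p f \<nu> by (intro sum.cong refl) (auto simp: powr_mult powr_powr less_imp_le)
    also have "(\<Sum>x\<in>X. (?M x powr (p - 1) * \<nu> x powr (1 - 1 / p)) powr (p / (p - 1))) =
       (\<Sum>x\<in>X. ?M x powr p * \<nu> x)"
    proof (intro sum.cong refl)
      fix x assume x: "x \<in> X"
      have "(1 - 1 / p) * (p / (p - 1)) = 1" using p by (simp add: field_simps)
      then show "(?M x powr (p - 1) * \<nu> x powr (1 - 1 / p)) powr (p / (p - 1)) = ?M x powr p * \<nu> x"
        using p \<nu>[rule_format, OF x] by (simp add: powr_mult powr_powr)
    qed
    finally have "p / (p - 1) * (\<Sum>x\<in>X. ?M x powr (p - 1) * f x * \<nu> x) \<le>
      p / (p - 1) * ((\<Sum>x\<in>X. f x powr p * \<nu> x) powr (1 / p) * (\<Sum>x\<in>X. ?M x powr p * \<nu> x) powr (1 - 1 / p))"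
      using p by (intro mult_left_mono) auto
    then show "(\<Sum>x\<in>X. ?M x powr p * \<nu> x) \<le> p / (p - 1) * (\<Sum>x\<in>X. f x powr p * \<nu> x) powr (1 / p) *
        (\<Sum>x\<in>X. ?M x powr p * \<nu> x) powr (1 - 1 / p)"
      using Doob_running_max[OF \<nu> f p, of L] by simp
  qed (use p \<nu> f in \<open>auto intro!: sum_nonneg mult_nonneg_nonneg simp: less_imp_le\<close>)
qed

section \<open>Sparse families\<close>

text \<open>
  The cores of distinct members of a family of cells are disjoint. For a sparse family the core of
  \<open>Q\<close> carries at least half of the mass of \<open>Q\<close>, so that sums over the family become sums over
  disjoint sets.
\<close>

definition core :: "'x set set \<Rightarrow> 'x set \<Rightarrow> 'x set" where
  "core S Q = Q - \<Union>{R \<in> S. R \<subset> Q}"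

definition sparse :: "('x \<Rightarrow> real) \<Rightarrow> 'x set set \<Rightarrow> bool" where
  "sparse \<mu> S \<longleftrightarrow> S \<subseteq> cells \<and> (\<forall>Q\<in>S. sum \<mu> (\<Union>{R \<in> S. R \<subset> Q}) \<le> sum \<mu> Q / 2)"

lemma sparse_finite: "sparse \<mu> S \<Longrightarrow> finite S"
  using finite_cells finite_subset by (auto simp: sparse_def)

lemma sparse_cells: "sparse \<mu> S \<Longrightarrow> Q \<in> S \<Longrightarrow> Q \<in> cells"
  by (auto simp: sparse_def)

lemma sparse_subset:
  assumes \<mu>: "\<forall>x\<in>X. 0 < \<mu> x" and S: "sparse \<mu> S" and "T \<subseteq> S" shows "sparse \<mu> T"
  unfolding sparse_def
proof (intro conjI ballI)
  fix Q assume Q: "Q \<in> T"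
  have "sum \<mu> (\<Union>{R \<in> T. R \<subset> Q}) \<le> sum \<mu> (\<Union>{R \<in> S. R \<subset> Q})"
  proof (rule sum_mono2)
    show "finite (\<Union>{R \<in> S. R \<subset> Q})"
      by (rule finite_subset[OF _ cells_fin[OF sparse_cells[OF S subsetD[OF assms(3) Q]]]]) auto
    show "\<Union>{R \<in> T. R \<subset> Q} \<subseteq> \<Union>{R \<in> S. R \<subset> Q}" using assms(3) by auto
    show "0 \<le> \<mu> b" if "b \<in> \<Union>{R \<in> S. R \<subset> Q} - \<Union>{R \<in> T. R \<subset> Q}" for b
    proof -
      have "b \<in> X" using that Q cells_sub sparse_cells[OF S] assms(3) by blast
      then show ?thesis using \<mu> less_imp_le by blast
    qed
  qed
  then show "sum \<mu> (\<Union>{R \<in> T. R \<subset> Q}) \<le> sum \<mu> Q / 2"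
    using S Q assms(3) unfolding sparse_def by fastforce
qed (use S assms(3) in \<open>auto simp: sparse_def\<close>)

lemma core_sub: "core S Q \<subseteq> Q"
  by (auto simp: core_def)

lemma core_mass:
  assumes S: "sparse \<mu> S" and Q: "Q \<in> S" shows "sum \<mu> Q \<le> 2 * sum \<mu> (core S Q)"
proof -
  have "sum \<mu> (core S Q) = sum \<mu> Q - sum \<mu> (\<Union>{R \<in> S. R \<subset> Q})"
    unfolding core_def using cells_fin[OF sparse_cells[OF S Q]] by (intro sum_diff) auto
  then show ?thesis using S Q by (auto simp: sparse_def)
qed

lemma core_disjoint:
  assumes S: "S \<subseteq> cells" and "Q \<in> S" "R \<in> S" "Q \<noteq> R" shows "core S Q \<inter> core S R = {}"
proof -
  have "Q \<subset> R \<or> R \<subset> Q" if "x \<in> Q" "x \<in> R" for x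
    using cells_laminar[OF _ _ that] assms by blast
  then show ?thesis using assms unfolding core_def by blast
qed

lemma sum_core_le:
  assumes S: "S \<subseteq> cells" and g: "\<forall>x\<in>X. 0 \<le> g x"
  shows "(\<Sum>Q\<in>S. sum g (core S Q)) \<le> sum (g :: _ \<Rightarrow> real) X"
proof -
  have "finite S" using S finite_cells finite_subset by blast
  have *: "core S Q \<subseteq> X" "finite (core S Q)" if "Q \<in> S" for Q
    using that S core_sub[of S Q] cells_sub cells_fin finite_subset by blast+
  have "(\<Sum>Q\<in>S. sum g (core S Q)) = sum g (\<Union>Q\<in>S. core S Q)"
    using \<open>finite S\<close> * core_disjoint[OF S] by (intro sum.UNION_disjoint[symmetric]) auto
  also have "\<dots> \<le> sum g X" using * fin g by (intro sum_mono2) auto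
  finally show ?thesis .
qed

text \<open>
  On the core of \<open>Q\<close> the average over \<open>Q\<close> is at most the maximal function, and the cores are
  disjoint.
\<close>

lemma Carleson_embedding:
  assumes \<nu>: "\<forall>x\<in>X. 0 < \<nu> x" and f: "\<forall>x\<in>X. 0 \<le> f x" and p: "1 < p"
    and S: "S \<subseteq> cells"
  shows "(\<Sum>Q\<in>S. avg \<nu> f Q powr p * sum \<nu> (core S Q)) \<le>
    (p / (p - 1)) powr p * (\<Sum>x\<in>X. f x powr p * \<nu> x)"
proof -
  obtain M where M: "\<forall>x\<in>X. 0 \<le> M x \<and> (\<forall>Q\<in>cells. x \<in> Q \<longrightarrow> avg \<nu> f Q \<le> M x)"
    and le: "(\<Sum>x\<in>X. M x powr p * \<nu> x) \<le> (p / (p - 1)) powr p * (\<Sum>x\<in>X. f x powr p * \<nu> x)"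
    using Doob[OF \<nu> f p] by (elim exE conjE) (rule that)
  have "(\<Sum>Q\<in>S. avg \<nu> f Q powr p * sum \<nu> (core S Q)) \<le> (\<Sum>Q\<in>S. sum (\<lambda>x. M x powr p * \<nu> x) (core S Q))"
  proof (intro sum_mono)
    fix Q assume Q: "Q \<in> S"
    then have Qc: "Q \<in> cells" using S by auto
    show "avg \<nu> f Q powr p * sum \<nu> (core S Q) \<le> sum (\<lambda>x. M x powr p * \<nu> x) (core S Q)"
      unfolding sum_distrib_left
    proof (intro sum_mono mult_right_mono powr_mono2)
      fix x assume "x \<in> core S Q"
      then have x: "x \<in> Q" "x \<in> X" using core_sub cells_sub[OF Qc] by auto
      then show "avg \<nu> f Q \<le> M x" "0 \<le> \<nu> x" using M Qc \<nu>[rule_format, OF x(2)] by auto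
      show "0 \<le> avg \<nu> f Q" by (rule avg_nonneg[OF \<nu> f cells_sub[OF Qc]])
    qed (use p in auto)
  qed
  also have "\<dots> \<le> (\<Sum>x\<in>X. M x powr p * \<nu> x)"
    using \<nu> by (intro sum_core_le S) (simp add: less_imp_le)
  finally show ?thesis using le by simp
qed

end

section \<open>Weighted bounds for sparse operators\<close>

text \<open>
  On atoms, \<open>\<mu>\<close>, \<open>w\<close> and \<open>\<sigma>\<close> are the masses of Lebesgue measure, of the weight and of the dual
  weight \<open>w^(-1/(p-1))\<close>. The pointwise relation between \<open>w\<close> and \<open>\<sigma>\<close> is lost by passing to masses;
  the assumption \<open>atom\<close>, which is Hoelder's inequality on an atom, is what remains of it. \<open>K\<close> plays
  the role of the \<open>A_p\<close> constant.
\<close>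

locale weighted_tree = tree X c L for X :: "'x set" and c L +
  fixes \<mu> w \<sigma> :: "'x \<Rightarrow> real" and p K :: real
  assumes p: "1 < p"
    and \<mu>_pos: "\<forall>x\<in>X. 0 < \<mu> x"
    and w_pos: "\<forall>x\<in>X. 0 < w x"
    and \<sigma>_pos: "\<forall>x\<in>X. 0 < \<sigma> x"
    and atom: "x \<in> X \<Longrightarrow> \<mu> x powr p \<le> w x * \<sigma> x powr (p - 1)"
    and Ap_cell: "Q \<in> cells \<Longrightarrow> sum w Q * sum \<sigma> Q powr (p - 1) \<le> K * sum \<mu> Q powr p"
begin

lemma K_pos: "Q \<in> cells \<Longrightarrow> 0 < K"
proof -
  assume Q: "Q \<in> cells"
  have "0 < sum w Q * sum \<sigma> Q powr (p - 1)"
    using sum_cell_pos[OF w_pos Q] sum_cell_pos[OF \<sigma>_pos Q] by simp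
  then have "0 < K * sum \<mu> Q powr p" using Ap_cell[OF Q] by linarith
  then show "0 < K" by (simp add: zero_less_mult_iff)
qed

lemma mass_le:
  assumes A: "A \<subseteq> X"
  shows "sum \<mu> A \<le> sum w A powr (1 / p) * sum \<sigma> A powr (1 - 1 / p)"
proof -
  have "\<mu> x \<le> w x powr (1 / p) * \<sigma> x powr (1 - 1 / p)" if "x \<in> A" for x
  proof -
    have x: "x \<in> X" using that A by auto
    have e: "(p - 1) * (1 / p) = 1 - 1 / p" using p by (simp add: field_simps)
    have "(\<mu> x powr p) powr (1 / p) \<le> (w x * \<sigma> x powr (p - 1)) powr (1 / p)"
      using p atom[OF x] by (intro powr_mono2) auto
    then show ?thesis
      using p \<mu>_pos[rule_format, OF x] w_pos[rule_format, OF x] \<sigma>_pos[rule_format, OF x] e by (simp add: powr_powr powr_mult)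
  qed
  then have "sum \<mu> A \<le> (\<Sum>x\<in>A. w x powr (1 / p) * \<sigma> x powr (1 - 1 / p))" by (rule sum_mono)
  also have "\<dots> \<le> sum w A powr (1 / p) * sum \<sigma> A powr (1 - 1 / p)"
    using A fin p w_pos \<sigma>_pos
    by (intro Holder_sum_theta) (auto intro: finite_subset less_imp_le simp: subset_iff)
  finally show ?thesis .
qed

lemma core_pos:
  assumes S: "sparse \<mu> S" and Q: "Q \<in> S"
  shows "0 < sum \<sigma> (core S Q)" "0 < sum w (core S Q)" "sum \<sigma> (core S Q) \<le> sum \<sigma> Q"
proof -
  have Qc: "Q \<in> cells" using sparse_cells[OF S Q] .
  have sub: "core S Q \<subseteq> X" using core_sub cells_sub[OF Qc] by blast
  have "0 < sum \<mu> Q" using sum_cell_pos[OF \<mu>_pos Qc] by simp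
  then have "core S Q \<noteq> {}" using core_mass[OF S Q] by auto
  then show "0 < sum \<sigma> (core S Q)" "0 < sum w (core S Q)"
    using sub \<sigma>_pos w_pos fin by (auto intro!: sum_pos intro: finite_subset)
  show "sum \<sigma> (core S Q) \<le> sum \<sigma> Q"
    using cells_fin[OF Qc] core_sub cells_sub[OF Qc] \<sigma>_pos
    by (intro sum_mono2) (auto intro: less_imp_le simp: subset_iff)
qed

text \<open>
  The core of \<open>Q\<close> carries at least half of the Lebesgue mass of \<open>Q\<close>, and its Lebesgue mass is
  controlled by its two weighted masses. This moves the estimate from \<open>Q\<close> to the disjoint cores.
\<close>

lemma core_mass_powr:
  assumes S: "sparse \<mu> S" and Q: "Q \<in> S"
  shows "sum \<mu> Q powr (p - 1) \<le>
    2 powr (p - 1) * (sum w (core S Q) powr (1 - 1 / p) * sum \<sigma> (core S Q) powr ((p - 1)\<^sup>2 / p))"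
proof -
  have sub: "core S Q \<subseteq> X" using core_sub cells_sub[OF sparse_cells[OF S Q]] by blast
  have "sum \<mu> Q \<le> 2 * (sum w (core S Q) powr (1 / p) * sum \<sigma> (core S Q) powr (1 - 1 / p))"
    using core_mass[OF S Q] mass_le[OF sub] by simp
  then have "sum \<mu> Q powr (p - 1) \<le>
      (2 * (sum w (core S Q) powr (1 / p) * sum \<sigma> (core S Q) powr (1 - 1 / p))) powr (p - 1)"
    using p sum_cell_pos[OF \<mu>_pos sparse_cells[OF S Q]] by (intro powr_mono2) auto
  also have "\<dots> = 2 powr (p - 1) *
      (sum w (core S Q) powr (1 / p * (p - 1)) * sum \<sigma> (core S Q) powr ((1 - 1 / p) * (p - 1)))"
    by (simp add: powr_mult powr_powr)
  also have "1 / p * (p - 1) = 1 - 1 / p" using p by (simp add: field_simps)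
  also have "(1 - 1 / p) * (p - 1) = (p - 1)\<^sup>2 / p" using p by (simp add: field_simps power2_eq_square)
  finally show ?thesis .
qed

lemma Ap_cell': "Q \<in> cells \<Longrightarrow>
  sum \<sigma> Q * sum w Q / sum \<mu> Q \<le> K * (sum \<sigma> Q powr (2 - p) * sum \<mu> Q powr (p - 1))"
proof -
  assume Q: "Q \<in> cells"
  define s m v where "s = sum \<sigma> Q" and "m = sum \<mu> Q" and "v = sum w Q"
  have pos: "s > 0" "m > 0" "v > 0"
    using sum_cell_pos[OF \<sigma>_pos Q] sum_cell_pos[OF \<mu>_pos Q] sum_cell_pos[OF w_pos Q]
    by (auto simp: s_def m_def v_def)
  have A: "v * s powr (p - 1) \<le> K * m powr p" using Ap_cell[OF Q] by (simp add: s_def m_def v_def)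
  have "s * v / m = (v * s powr (p - 1)) * (s powr (2 - p) * m powr (-1))"
    using pos by (simp add: powr_add[symmetric] powr_minus divide_inverse powr_mult_base ac_simps)
  also have "\<dots> \<le> (K * m powr p) * (s powr (2 - p) * m powr (-1))"
    by (intro mult_right_mono A) simp
  also have "\<dots> = K * (s powr (2 - p) * (m powr p * m powr (-1)))" by (simp add: ac_simps)
  also have "m powr p * m powr (-1) = m powr (p - 1)" by (simp only: powr_add[symmetric]) simp
  finally show ?thesis by (simp add: s_def m_def v_def)
qed

definition strong_const :: real where
  "strong_const = 2 powr (p - 1) * (p / (p - 1)) * p"

text \<open>
  For one cell the \<open>A_p\<close> condition bounds \<open>\<sigma>(Q) w(Q) / \<mu>(Q)\<close> by \<open>K\<close> times \<open>\<sigma>(Q)^(2-p) \<mu>(Q)^(p-1)\<close>.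
  Because \<open>2 - p \<le> 0\<close>, both factors may be passed to the core \<open>E\<close> of \<open>Q\<close>, and the exponents add up
  to \<open>\<sigma>(E)^(1/p) w(E)^(1-1/p)\<close>. Hoelder's inequality and the Carleson embedding for \<open>\<sigma>\<close> and for \<open>w\<close>
  finish the proof.
\<close>

lemma bilinear_large:
  assumes p2: "2 \<le> p" and S: "sparse \<mu> S"
    and f: "\<forall>x\<in>X. 0 \<le> f x" and g: "\<forall>x\<in>X. 0 \<le> g x"
  shows "(\<Sum>Q\<in>S. (\<Sum>x\<in>Q. f x * \<sigma> x) * (\<Sum>x\<in>Q. g x * w x) / sum \<mu> Q) \<le>
    strong_const * K * (\<Sum>x\<in>X. f x powr p * \<sigma> x) powr (1 / p) *
    (\<Sum>x\<in>X. g x powr (p / (p - 1)) * w x) powr (1 - 1 / p)"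
proof -
  let ?E = "core S"
  let ?a = "\<lambda>Q. avg \<sigma> f Q" and ?b = "\<lambda>Q. avg w g Q"
  let ?q = "p / (p - 1)"
  have q: "1 < ?q" "?q / (?q - 1) = p" using p by (auto simp: field_simps)
  have per_cell: "(\<Sum>x\<in>Q. f x * \<sigma> x) * (\<Sum>x\<in>Q. g x * w x) / sum \<mu> Q \<le> 2 powr (p - 1) * K *
     ((?a Q powr p * sum \<sigma> (?E Q)) powr (1 / p) * (?b Q powr ?q * sum w (?E Q)) powr (1 - 1 / p))"
    if Q: "Q \<in> S" for Q
  proof -
    have Qc: "Q \<in> cells" using sparse_cells[OF S Q] .
    have K: "0 < K" by (rule K_pos[OF Qc])
    note pos = sum_cell_pos[OF \<sigma>_pos Qc, simplified] sum_cell_pos[OF w_pos Qc, simplified]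
    have ab: "0 \<le> ?a Q" "0 \<le> ?b Q"
      using avg_nonneg[OF \<sigma>_pos f cells_sub[OF Qc]] avg_nonneg[OF w_pos g cells_sub[OF Qc]] by auto
    have cp: "0 < sum \<sigma> (?E Q)" "0 < sum w (?E Q)" "sum \<sigma> (?E Q) \<le> sum \<sigma> Q"
      using core_pos[OF S Q] by auto
    have "sum \<sigma> Q * sum w Q / sum \<mu> Q \<le> K * (sum \<sigma> Q powr (2 - p) * sum \<mu> Q powr (p - 1))"
      by (rule Ap_cell'[OF Qc])
    also have "\<dots> \<le> K * (sum \<sigma> (?E Q) powr (2 - p) * (2 powr (p - 1) *
       (sum w (?E Q) powr (1 - 1 / p) * sum \<sigma> (?E Q) powr ((p - 1)\<^sup>2 / p))))"
      using K p2 cp by (intro mult_left_mono mult_mono core_mass_powr[OF S Q] powr_mono2') auto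
    also have "\<dots> = 2 powr (p - 1) * K * ((sum \<sigma> (?E Q) powr (2 - p) * sum \<sigma> (?E Q) powr ((p - 1)\<^sup>2 / p))
        * sum w (?E Q) powr (1 - 1 / p))" by (simp add: ac_simps)
    also have "sum \<sigma> (?E Q) powr (2 - p) * sum \<sigma> (?E Q) powr ((p - 1)\<^sup>2 / p) = sum \<sigma> (?E Q) powr (1 / p)"
    proof -
      have "2 - p + (p - 1)\<^sup>2 / p = 1 / p" using p by (simp add: field_simps power2_eq_square)
      then show ?thesis by (simp flip: powr_add)
    qed
    finally have *: "sum \<sigma> Q * sum w Q / sum \<mu> Q \<le>
      2 powr (p - 1) * K * (sum \<sigma> (?E Q) powr (1 / p) * sum w (?E Q) powr (1 - 1 / p))" .
    have "(\<Sum>x\<in>Q. f x * \<sigma> x) * (\<Sum>x\<in>Q. g x * w x) / sum \<mu> Q =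
        (?a Q * ?b Q) * (sum \<sigma> Q * sum w Q / sum \<mu> Q)"
      using pos by (simp add: avg_def)
    also have "\<dots> \<le> (?a Q * ?b Q) *
        (2 powr (p - 1) * K * (sum \<sigma> (?E Q) powr (1 / p) * sum w (?E Q) powr (1 - 1 / p)))"
      using ab by (intro mult_left_mono *) auto
    also have "\<dots> = 2 powr (p - 1) * K * ((?a Q * sum \<sigma> (?E Q) powr (1 / p)) *
        (?b Q * sum w (?E Q) powr (1 - 1 / p)))" by (simp add: ac_simps)
    also have "?a Q * sum \<sigma> (?E Q) powr (1 / p) = (?a Q powr p * sum \<sigma> (?E Q)) powr (1 / p)"
      using ab p cp by (simp add: powr_mult powr_powr)
    also have "?b Q * sum w (?E Q) powr (1 - 1 / p) = (?b Q powr ?q * sum w (?E Q)) powr (1 - 1 / p)"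
    proof -
      have "?q * (1 - 1 / p) = 1" using p by (simp add: field_simps)
      then show ?thesis using ab p cp by (simp add: powr_mult powr_powr)
    qed
    finally show ?thesis .
  qed
  show ?thesis
  proof (cases "S = {}")
    case True
    show ?thesis
    proof (cases "X = {}")
      case False
      then obtain x where "x \<in> X" by auto
      then have "0 < K" using K_pos by blast
      then show ?thesis using True p by (simp add: strong_const_def)
    qed (use True in simp)
  next
    case False
    then obtain Q0 where Q0: "Q0 \<in> S" by auto
    then have K: "0 < K" using K_pos sparse_cells[OF S] by blast
    have "(\<Sum>Q\<in>S. (\<Sum>x\<in>Q. f x * \<sigma> x) * (\<Sum>x\<in>Q. g x * w x) / sum \<mu> Q) \<le> (\<Sum>Q\<in>S. 2 powr (p - 1) * K *
     ((?a Q powr p * sum \<sigma> (?E Q)) powr (1 / p) * (?b Q powr ?q * sum w (?E Q)) powr (1 - 1 / p)))"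
      by (intro sum_mono per_cell)
    also have "\<dots> = 2 powr (p - 1) * K * (\<Sum>Q\<in>S.
       (?a Q powr p * sum \<sigma> (?E Q)) powr (1 / p) * (?b Q powr ?q * sum w (?E Q)) powr (1 - 1 / p))"
      by (simp only: sum_distrib_left)
    also have "\<dots> \<le> 2 powr (p - 1) * K * ((\<Sum>Q\<in>S. ?a Q powr p * sum \<sigma> (?E Q)) powr (1 / p) *
       (\<Sum>Q\<in>S. ?b Q powr ?q * sum w (?E Q)) powr (1 - 1 / p))"
      using K p core_pos[OF S] by (intro mult_left_mono Holder_sum_theta sparse_finite[OF S])
        (auto simp: less_imp_le)
    also have "\<dots> \<le> 2 powr (p - 1) * K * (((p / (p - 1)) powr p * (\<Sum>x\<in>X. f x powr p * \<sigma> x)) powr (1 / p) *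
       (p powr ?q * (\<Sum>x\<in>X. g x powr ?q * w x)) powr (1 - 1 / p))"
    proof -
      have "(\<Sum>Q\<in>S. ?a Q powr p * sum \<sigma> (?E Q)) \<le> (p / (p - 1)) powr p * (\<Sum>x\<in>X. f x powr p * \<sigma> x)"
        using S by (intro Carleson_embedding \<sigma>_pos f p) (auto simp: sparse_def)
      moreover have "(\<Sum>Q\<in>S. ?b Q powr ?q * sum w (?E Q)) \<le> p powr ?q * (\<Sum>x\<in>X. g x powr ?q * w x)"
        using S Carleson_embedding[OF w_pos g q(1), of S] unfolding q(2) by (auto simp: sparse_def)
      moreover have "0 \<le> (\<Sum>Q\<in>S. ?a Q powr p * sum \<sigma> (?E Q))" "0 \<le> (\<Sum>Q\<in>S. ?b Q powr ?q * sum w (?E Q))"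
        using core_pos[OF S] by (auto intro!: sum_nonneg simp: less_imp_le)
      ultimately show ?thesis
        using K p by (intro mult_left_mono mult_mono powr_mono2) auto
    qed
    also have "\<dots> = strong_const * K * (\<Sum>x\<in>X. f x powr p * \<sigma> x) powr (1 / p) *
    (\<Sum>x\<in>X. g x powr ?q * w x) powr (1 - 1 / p)"
    proof -
      have "?q * (1 - 1 / p) = 1" using p by (simp add: field_simps)
      moreover have "0 \<le> (\<Sum>x\<in>X. f x powr p * \<sigma> x)" "0 \<le> (\<Sum>x\<in>X. g x powr ?q * w x)"
        using \<sigma>_pos w_pos by (auto intro!: sum_nonneg simp: less_imp_le)
      ultimately show ?thesis
        using p by (simp add: powr_mult powr_powr powr_divide strong_const_def)
    qed
    finally show ?thesis .
  qed
qed

end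

text \<open>
  The two powers of two belong to the exponents \<open>p\<close> and \<open>p/(p-1)\<close>; their sum serves both ranges of
  \<open>p\<close>.
\<close>

definition sparse_const :: "real \<Rightarrow> real" where
  "sparse_const p = (2 powr (p - 1) + 2 powr (1 / (p - 1))) * (p / (p - 1)) * p"

lemma sparse_const_pos: "1 < p \<Longrightarrow> 0 < sparse_const p"
  by (simp add: sparse_const_def add_pos_pos)

context weighted_tree
begin

text \<open>
  The \<open>A_p\<close> condition for \<open>w\<close> is the condition for \<open>\<sigma>\<close> with the dual exponent, and the constant
  changes to \<open>K^(1/(p-1))\<close>. This is where the exponent of the theorem for \<open>p < 2\<close> comes from.
\<close>

lemma dual_tree: "weighted_tree X c L \<mu> \<sigma> w (p / (p - 1)) (K powr (1 / (p - 1)))"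
proof
  have e: "p / (p - 1) - 1 = 1 / (p - 1)" using p by (simp add: field_simps)
  show "1 < p / (p - 1)" using p by simp
  show "\<mu> x powr (p / (p - 1)) \<le> \<sigma> x * w x powr (p / (p - 1) - 1)" if x: "x \<in> X" for x
  proof -
    have "(\<mu> x powr p) powr (1 / (p - 1)) \<le> (w x * \<sigma> x powr (p - 1)) powr (1 / (p - 1))"
      using p atom[OF x] by (intro powr_mono2) auto
    then show ?thesis
      using p w_pos[rule_format, OF x] \<sigma>_pos[rule_format, OF x] by (simp add: e powr_mult powr_powr mult.commute)
  qed
  show "sum \<sigma> Q * sum w Q powr (p / (p - 1) - 1) \<le> K powr (1 / (p - 1)) * sum \<mu> Q powr (p / (p - 1))"
    if Q: "Q \<in> cells" for Q
  proof -
    note pos = sum_cell_pos[OF \<sigma>_pos Q, simplified] sum_cell_pos[OF w_pos Q, simplified]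
      sum_cell_pos[OF \<mu>_pos Q, simplified]
    have "(sum w Q * sum \<sigma> Q powr (p - 1)) powr (1 / (p - 1)) \<le> (K * sum \<mu> Q powr p) powr (1 / (p - 1))"
      using p pos Ap_cell[OF Q] by (intro powr_mono2) auto
    then show ?thesis
      using p pos K_pos[OF Q] by (simp add: e powr_mult powr_powr mult.commute)
  qed
qed (use \<mu>_pos w_pos \<sigma>_pos in auto)

lemma bilinear:
  assumes S: "sparse \<mu> S" and "S \<noteq> {}"
    and f: "\<forall>x\<in>X. 0 \<le> f x" and g: "\<forall>x\<in>X. 0 \<le> g x"
  shows "(\<Sum>Q\<in>S. (\<Sum>x\<in>Q. f x * \<sigma> x) * (\<Sum>x\<in>Q. g x * w x) / sum \<mu> Q) \<le>
    sparse_const p * K powr max 1 (1 / (p - 1)) * (\<Sum>x\<in>X. f x powr p * \<sigma> x) powr (1 / p) *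
    (\<Sum>x\<in>X. g x powr (p / (p - 1)) * w x) powr (1 - 1 / p)"
proof -
  let ?F = "(\<Sum>x\<in>X. f x powr p * \<sigma> x) powr (1 / p)"
  let ?G = "(\<Sum>x\<in>X. g x powr (p / (p - 1)) * w x) powr (1 - 1 / p)"
  have K: "0 < K" using assms(2) sparse_cells[OF S] K_pos by blast
  show ?thesis
  proof (cases "2 \<le> p")
    case True
    then have m: "max 1 (1 / (p - 1)) = 1" by simp
    have "(\<Sum>Q\<in>S. (\<Sum>x\<in>Q. f x * \<sigma> x) * (\<Sum>x\<in>Q. g x * w x) / sum \<mu> Q) \<le> strong_const * K * ?F * ?G"
      by (rule bilinear_large[OF True S f g])
    also have "\<dots> \<le> sparse_const p * K powr max 1 (1 / (p - 1)) * ?F * ?G"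
    proof -
      have "strong_const \<le> sparse_const p"
        unfolding sparse_const_def strong_const_def using p by (intro mult_right_mono) auto
      then show ?thesis unfolding m using K by (auto intro!: mult_right_mono)
    qed
    finally show ?thesis .
  next
    case False
    then have m: "max 1 (1 / (p - 1)) = 1 / (p - 1)" using p by (simp add: max_def field_simps)
    interpret D: weighted_tree X c L \<mu> \<sigma> w "p / (p - 1)" "K powr (1 / (p - 1))" by (rule dual_tree)
    have q: "p / (p - 1) / (p / (p - 1) - 1) = p" "1 / (p / (p - 1)) = 1 - 1 / p" "1 - (1 - 1 / p) = 1 / p"
      using p by (auto simp: field_simps)
    have q': "p / (p - 1) - 1 = 1 / (p - 1)" using p by (simp add: field_simps)
    have "2 \<le> p / (p - 1)" using False p by (simp add: field_simps)
    from D.bilinear_large[OF this S g f]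
    have "(\<Sum>Q\<in>S. (\<Sum>x\<in>Q. g x * w x) * (\<Sum>x\<in>Q. f x * \<sigma> x) / sum \<mu> Q) \<le>
       D.strong_const * K powr (1 / (p - 1)) * ?G * ?F"
      unfolding q by simp
    also have "\<dots> \<le> sparse_const p * K powr max 1 (1 / (p - 1)) * ?G * ?F"
    proof -
      have "D.strong_const = 2 powr (1 / (p - 1)) * (p / (p - 1)) * p"
        by (simp add: D.strong_const_def q q' ac_simps)
      also have "\<dots> \<le> sparse_const p"
        unfolding sparse_const_def using p by (intro mult_right_mono) auto
      finally show ?thesis unfolding m using K by (auto intro!: mult_right_mono)
    qed
    finally show ?thesis by (simp add: ac_simps)
  qed
qed

end

context tree
begin

definition sparse_op :: "('x \<Rightarrow> real) \<Rightarrow> 'x set set \<Rightarrow> ('x \<Rightarrow> real) \<Rightarrow> 'x \<Rightarrow> real" where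
  "sparse_op \<mu> S F x = (\<Sum>Q | Q \<in> S \<and> x \<in> Q. avg \<mu> F Q)"

lemma sum_sparse_op:
  assumes S: "S \<subseteq> cells" and A: "A \<subseteq> X"
  shows "(\<Sum>x\<in>A. sparse_op \<mu> S F x * g x) = (\<Sum>Q\<in>S. avg \<mu> F Q * sum g (Q \<inter> A))"
proof -
  have "finite S" using S finite_cells finite_subset by blast
  have "(\<Sum>x\<in>A. sparse_op \<mu> S F x * g x) = (\<Sum>x\<in>A. \<Sum>Q | Q \<in> S \<and> x \<in> Q. avg \<mu> F Q * g x)"
    by (simp add: sparse_op_def sum_distrib_right)
  also have "\<dots> = (\<Sum>Q\<in>S. \<Sum>x | x \<in> A \<and> x \<in> Q. avg \<mu> F Q * g x)"
    using \<open>finite S\<close> fin A finite_subset by (intro sum.swap_restrict) auto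
  also have "\<dots> = (\<Sum>Q\<in>S. avg \<mu> F Q * sum g (Q \<inter> A))"
    by (simp add: sum_distrib_left Collect_conj_eq Int_commute)
  finally show ?thesis .
qed

lemma sparse_op_nonneg:
  assumes "\<forall>x\<in>X. 0 < \<mu> x" "\<forall>x\<in>X. 0 \<le> F x" "S \<subseteq> cells"
  shows "0 \<le> sparse_op \<mu> S F x"
  unfolding sparse_op_def
proof (intro sum_nonneg avg_nonneg assms(1,2))
  fix Q assume "Q \<in> {Q \<in> S. x \<in> Q}"
  then show "Q \<subseteq> X" using assms(3) cells_sub by blast
qed

end

context weighted_tree
begin

text \<open>
  Duality: the bilinear bound is applied to \<open>F \<mu> / \<sigma>\<close> and to the power \<open>p - 1\<close> of the operator
  itself. The right side is the discrete form of the weighted norm of \<open>F\<close>: if \<open>F \<mu>\<close> is the integral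
  of a function over an atom, then \<open>(F \<mu>)^p \<sigma>^(1-p)\<close> is at most the integral of its \<open>p\<close>-th power
  against \<open>w\<close>.
\<close>

theorem sparse_strong:
  assumes S: "sparse \<mu> S" and F: "\<forall>x\<in>X. 0 \<le> F x"
  shows "(\<Sum>x\<in>X. sparse_op \<mu> S F x powr p * w x) \<le>
    (sparse_const p * K powr max 1 (1 / (p - 1))) powr p *
    (\<Sum>x\<in>X. (F x * \<mu> x) powr p * \<sigma> x powr (1 - p))"
proof (cases "S = {}")
  case True
  have "0 \<le> (\<Sum>x\<in>X. (F x * \<mu> x) powr p * \<sigma> x powr (1 - p))" by (intro sum_nonneg) auto
  then show ?thesis using True p by (simp add: sparse_op_def)
next
  case False
  have Sc: "S \<subseteq> cells" using S by (simp add: sparse_def)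
  have K: "0 < K" using False sparse_cells[OF S] K_pos by blast
  let ?A = "sparse_op \<mu> S F"
  let ?f = "\<lambda>x. F x * \<mu> x / \<sigma> x"
  let ?g = "\<lambda>x. ?A x powr (p - 1)"
  have A: "0 \<le> ?A x" for x by (rule sparse_op_nonneg[OF \<mu>_pos F Sc])
  have "(\<Sum>x\<in>X. ?A x powr p * w x) = (\<Sum>x\<in>X. ?A x * (?g x * w x))"
    using A by (intro sum.cong refl) (simp add: powr_mult_base mult.assoc[symmetric])
  also have "\<dots> = (\<Sum>Q\<in>S. avg \<mu> F Q * (\<Sum>x\<in>Q \<inter> X. ?g x * w x))"
    by (rule sum_sparse_op[OF Sc subset_refl])
  also have "\<dots> = (\<Sum>Q\<in>S. (\<Sum>x\<in>Q. ?f x * \<sigma> x) * (\<Sum>x\<in>Q. ?g x * w x) / sum \<mu> Q)"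
  proof (intro sum.cong refl)
    fix Q assume "Q \<in> S"
    then have Q: "Q \<subseteq> X" using Sc cells_sub by auto
    have "(\<Sum>x\<in>Q. ?f x * \<sigma> x) = (\<Sum>x\<in>Q. F x * \<mu> x)"
      using Q \<sigma>_pos by (intro sum.cong refl) (auto simp: subset_iff, metis less_irrefl)
    then show "avg \<mu> F Q * (\<Sum>x\<in>Q \<inter> X. ?g x * w x) =
       (\<Sum>x\<in>Q. ?f x * \<sigma> x) * (\<Sum>x\<in>Q. ?g x * w x) / sum \<mu> Q"
      using Q by (simp add: avg_def Int_absorb2)
  qed
  also have "\<dots> \<le> sparse_const p * K powr max 1 (1 / (p - 1)) * (\<Sum>x\<in>X. ?f x powr p * \<sigma> x) powr (1 / p) *
    (\<Sum>x\<in>X. ?g x powr (p / (p - 1)) * w x) powr (1 - 1 / p)"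
    using F \<mu>_pos \<sigma>_pos by (intro bilinear[OF S False]) (auto simp: less_imp_le)
  also have "(\<Sum>x\<in>X. ?g x powr (p / (p - 1)) * w x) = (\<Sum>x\<in>X. ?A x powr p * w x)"
    using p by (simp add: powr_powr)
  finally have "(\<Sum>x\<in>X. ?A x powr p * w x) \<le>
    (sparse_const p * K powr max 1 (1 / (p - 1))) powr p * (\<Sum>x\<in>X. ?f x powr p * \<sigma> x)"
    using p K sparse_const_pos[OF p] w_pos \<sigma>_pos
    by (intro absorb_powr) (auto intro!: sum_nonneg mult_nonneg_nonneg simp: less_imp_le)
  also have "(\<Sum>x\<in>X. ?f x powr p * \<sigma> x) = (\<Sum>x\<in>X. (F x * \<mu> x) powr p * \<sigma> x powr (1 - p))"
  proof (intro sum.cong refl)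
    fix x assume x: "x \<in> X"
    have "?f x powr p * \<sigma> x = (F x * \<mu> x) powr p * (\<sigma> x / \<sigma> x powr p)"
      using F[rule_format, OF x] \<mu>_pos[rule_format, OF x] \<sigma>_pos[rule_format, OF x] by (simp add: powr_divide)
    also have "\<sigma> x / \<sigma> x powr p = \<sigma> x powr (1 - p)" using \<sigma>_pos[rule_format, OF x] by (simp add: powr_diff)
    finally show "?f x powr p * \<sigma> x = (F x * \<mu> x) powr p * \<sigma> x powr (1 - p)" .
  qed
  finally show ?thesis .
qed

end

section \<open>The weak-type bound\<close>

lemma sum_powers_le:
  fixes N :: "int set" and p :: real
  assumes "finite N" and le: "\<And>n. n \<in> N \<Longrightarrow> n \<le> m" and p: "1 \<le> p"
  shows "(\<Sum>n\<in>N. 2 powr (of_int n * p)) \<le> 2 * 2 powr (of_int m * p)"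
proof -
  let ?k = "\<lambda>n. nat (m - n)"
  have inj: "inj_on ?k N"
  proof (rule inj_onI)
    fix x y assume "x \<in> N" "y \<in> N" "?k x = ?k y"
    then show "x = y" using le[of x] le[of y] by simp
  qed
  have "(\<Sum>n\<in>N. 2 powr (of_int n * p)) \<le> (\<Sum>n\<in>N. 2 powr (of_int m * p) * (1/2) ^ ?k n)"
  proof (intro sum_mono)
    fix n assume n: "n \<in> N"
    have "of_int (m - n) \<le> of_int (m - n) * p"
      using le[OF n] p by (simp add: mult_le_cancel_left1)
    then have "of_int n * p \<le> of_int m * p - of_int (m - n)"
      by (simp add: algebra_simps)
    then have "2 powr (of_int n * p) \<le> 2 powr (of_int m * p - of_int (m - n))" by simp
    also have "\<dots> = 2 powr (of_int m * p) / 2 powr (of_int (m - n))" by (simp add: powr_diff)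
    also have "(of_int (m - n) :: real) = real (?k n)" using le[OF n] by simp
    finally show "2 powr (of_int n * p) \<le> 2 powr (of_int m * p) * (1/2) ^ ?k n"
      by (simp add: powr_realpow power_divide)
  qed
  also have "\<dots> = 2 powr (of_int m * p) * (\<Sum>k\<in>?k ` N. (1/2) ^ k)"
    by (simp add: sum_distrib_left[symmetric] sum.reindex[OF inj])
  also have "(\<Sum>k\<in>?k ` N. (1/2::real) ^ k) \<le> (\<Sum>k. (1/2) ^ k)"
    using assms(1) by (intro sum_le_suminf summable_geometric) auto
  also have "(\<Sum>k. (1/2::real) ^ k) = 2" by (subst suminf_geometric) auto
  finally show ?thesis by (simp add: mult.commute)
qed

context tree
begin

text \<open>
  The maximal members of a family of cells. They are disjoint and every member lies below exactly
  one of them.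
\<close>

definition tops :: "'x set set \<Rightarrow> 'x set set" where
  "tops S = {Q \<in> S. \<forall>R\<in>S. Q \<subseteq> R \<longrightarrow> R = Q}"

lemma tops_cover:
  assumes S: "S \<subseteq> cells" and Q: "Q \<in> S" shows "\<exists>M\<in>tops S. Q \<subseteq> M"
proof -
  have "finite S" using S finite_cells finite_subset by blast
  then obtain M where "M \<in> S" "Q \<subseteq> M" "\<forall>R\<in>S. M \<subseteq> R \<longrightarrow> R = M"
    using finite_has_maximal2[OF _ Q] by metis
  then show ?thesis by (auto simp: tops_def)
qed

lemma tops_disjoint:
  assumes S: "S \<subseteq> cells" and "M \<in> tops S" "M' \<in> tops S" "x \<in> M" "x \<in> M'" shows "M = M'"
  using assms cells_laminar[of M M' x] unfolding tops_def by blast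

lemma tops_Union: "S \<subseteq> cells \<Longrightarrow> \<Union>(tops S) = \<Union>S"
  using tops_cover unfolding tops_def by blast

lemma sum_by_tops:
  assumes S: "S \<subseteq> cells"
  shows "(\<Sum>Q\<in>S. g Q) = (\<Sum>M\<in>tops S. \<Sum>Q | Q \<in> S \<and> Q \<subseteq> M. g Q)"
proof -
  have fS: "finite S" using S finite_cells finite_subset by blast
  have "(\<Sum>Q\<in>(\<Union>M\<in>tops S. {Q \<in> S. Q \<subseteq> M}). g Q) = (\<Sum>M\<in>tops S. \<Sum>Q | Q \<in> S \<and> Q \<subseteq> M. g Q)"
  proof (rule sum.UNION_disjoint)
    show "finite (tops S)" using fS by (auto simp: tops_def)
    show "\<forall>M\<in>tops S. finite {Q \<in> S. Q \<subseteq> M}" using fS by auto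
    show "\<forall>M\<in>tops S. \<forall>M'\<in>tops S. M \<noteq> M' \<longrightarrow> {Q \<in> S. Q \<subseteq> M} \<inter> {Q \<in> S. Q \<subseteq> M'} = {}"
    proof (intro ballI impI)
      fix M M' assume M: "M \<in> tops S" "M' \<in> tops S" "M \<noteq> M'"
      have False if Q: "Q \<in> S" "Q \<subseteq> M" "Q \<subseteq> M'" for Q
      proof -
        obtain x where "x \<in> Q" using Q S cells_nonempty by blast
        then show False using tops_disjoint[OF S M(1,2), of x] M(3) Q by blast
      qed
      then show "{Q \<in> S. Q \<subseteq> M} \<inter> {Q \<in> S. Q \<subseteq> M'} = {}" by auto
    qed
  qed
  moreover have "(\<Union>M\<in>tops S. {Q \<in> S. Q \<subseteq> M}) = S" using tops_cover[OF S] by auto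
  ultimately show ?thesis by simp
qed

lemma sum_tops_masses:
  assumes S: "S \<subseteq> cells"
  shows "(\<Sum>M\<in>tops S. sum \<nu> (M \<inter> A)) = sum \<nu> (\<Union>S \<inter> A)"
proof -
  have fS: "finite S" using S finite_cells finite_subset by blast
  have "sum \<nu> (\<Union>M\<in>tops S. M \<inter> A) = (\<Sum>M\<in>tops S. sum \<nu> (M \<inter> A))"
  proof (rule sum.UNION_disjoint)
    show "finite (tops S)" using fS by (auto simp: tops_def)
    show "\<forall>M\<in>tops S. finite (M \<inter> A)" using S cells_fin by (auto simp: tops_def)
    show "\<forall>M\<in>tops S. \<forall>M'\<in>tops S. M \<noteq> M' \<longrightarrow> M \<inter> A \<inter> (M' \<inter> A) = {}"
      using tops_disjoint[OF S] by blast
  qed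
  moreover have "(\<Union>M\<in>tops S. M \<inter> A) = \<Union>S \<inter> A" using tops_Union[OF S] by auto
  ultimately show ?thesis by simp
qed

lemma sum_tops_masses':
  assumes S: "S \<subseteq> cells" shows "(\<Sum>M\<in>tops S. sum \<nu> M) = sum \<nu> (\<Union>S)"
  using sum_tops_masses[OF S, of \<nu> UNIV] by simp

text \<open>
  By induction over the sparse family. The maximal members \<open>M\<close> strictly below \<open>Q\<close> fill at most half
  of \<open>Q\<close>, so Hoelder's inequality gains the factor \<open>(1/2)^(1-\<theta>)\<close> in each step, and the geometric
  series converges because \<open>\<theta> < 1\<close>.
\<close>

lemma Kolmogorov:
  fixes \<mu> \<sigma> :: "'x \<Rightarrow> real"
  assumes \<mu>: "\<forall>x\<in>X. 0 < \<mu> x" and \<sigma>: "\<forall>x\<in>X. 0 < \<sigma> x"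
    and S: "sparse \<mu> S" and \<theta>: "0 < \<theta>" "\<theta> < 1" and Q: "Q \<in> S"
  shows "(\<Sum>R | R \<in> S \<and> R \<subseteq> Q. sum \<sigma> R powr \<theta> * sum \<mu> R powr (1 - \<theta>)) \<le>
    1 / (1 - (1/2) powr (1 - \<theta>)) * (sum \<sigma> Q powr \<theta> * sum \<mu> Q powr (1 - \<theta>))"
  using Q
proof (induction "card Q" arbitrary: Q rule: less_induct)
  case less
  define C :: real where "C = 1 / (1 - (1/2) powr (1 - \<theta>))"
  let ?h = "\<lambda>R. sum \<sigma> R powr \<theta> * sum \<mu> R powr (1 - \<theta>)"
  have half: "(1/2::real) powr (1 - \<theta>) < 1" using \<theta> powr_less_mono2[of "1 - \<theta>" "1/2" 1] by simp
  have C: "0 < C" "1 + C * (1/2) powr (1 - \<theta>) = C" using half by (auto simp: C_def divide_simps)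
  have Sc: "S \<subseteq> cells" using S by (simp add: sparse_def)
  have fS: "finite S" using S by (rule sparse_finite)
  have Qc: "Q \<in> cells" using less.prems Sc by auto
  define T where "T = {R \<in> S. R \<subset> Q}"
  have Tc: "T \<subseteq> cells" using Sc by (auto simp: T_def)
  have fT: "finite (tops T)" using fS by (auto simp: tops_def T_def)
  have topsT: "M \<in> S" "M \<subset> Q" "M \<in> cells" if "M \<in> tops T" for M
    using that Tc by (auto simp: tops_def T_def)
  have "{R \<in> S. R \<subseteq> Q} = insert Q T" "Q \<notin> T" using less.prems by (auto simp: T_def)
  then have "(\<Sum>R | R \<in> S \<and> R \<subseteq> Q. ?h R) = ?h Q + (\<Sum>R\<in>T. ?h R)"
    using fS by (simp add: T_def)
  also have "(\<Sum>R\<in>T. ?h R) = (\<Sum>M\<in>tops T. \<Sum>R | R \<in> T \<and> R \<subseteq> M. ?h R)"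
    by (rule sum_by_tops[OF Tc])
  also have "\<dots> \<le> (\<Sum>M\<in>tops T. C * ?h M)"
  proof (intro sum_mono)
    fix M assume M: "M \<in> tops T"
    have "{R. R \<in> T \<and> R \<subseteq> M} = {R. R \<in> S \<and> R \<subseteq> M}" using topsT[OF M] by (auto simp: T_def)
    moreover have "card M < card Q" using topsT[OF M] cells_fin[OF Qc] by (intro psubset_card_mono)
    ultimately show "(\<Sum>R | R \<in> T \<and> R \<subseteq> M. ?h R) \<le> C * ?h M"
      using less.hyps[of M] topsT[OF M] by (simp add: C_def)
  qed
  also have "\<dots> = C * (\<Sum>M\<in>tops T. ?h M)" by (simp only: sum_distrib_left)
  also have "(\<Sum>M\<in>tops T. ?h M) \<le> (\<Sum>M\<in>tops T. sum \<sigma> M) powr \<theta> * (\<Sum>M\<in>tops T. sum \<mu> M) powr (1 - \<theta>)"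
    using fT \<theta> topsT sum_cell_pos \<mu> \<sigma> by (intro Holder_sum_theta) (auto intro: less_imp_le)
  also have "\<dots> = sum \<sigma> (\<Union>T) powr \<theta> * sum \<mu> (\<Union>T) powr (1 - \<theta>)"
    by (simp only: sum_tops_masses'[OF Tc])
  also have "\<dots> \<le> sum \<sigma> Q powr \<theta> * (sum \<mu> Q / 2) powr (1 - \<theta>)"
  proof -
    have sub: "\<Union>T \<subseteq> Q" "Q \<subseteq> X" using cells_sub[OF Qc] by (auto simp: T_def)
    have "sum \<sigma> (\<Union>T) \<le> sum \<sigma> Q"
      using sub \<sigma> cells_fin[OF Qc] by (intro sum_mono2) (auto intro: less_imp_le)
    moreover have "sum \<mu> (\<Union>T) \<le> sum \<mu> Q / 2" using S less.prems by (auto simp: sparse_def T_def)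
    moreover have "0 \<le> sum \<sigma> (\<Union>T)" "0 \<le> sum \<mu> (\<Union>T)"
      using subset_trans[OF sub] \<mu> \<sigma> by (meson less_imp_le subsetD sum_nonneg)+
    ultimately show ?thesis using \<theta> by (intro mult_mono powr_mono2) auto
  qed
  also have "\<dots> = (1/2) powr (1 - \<theta>) * ?h Q"
    using sum_cell_pos[OF \<mu> Qc] by (simp add: powr_divide)
  finally have "(\<Sum>R | R \<in> S \<and> R \<subseteq> Q. ?h R) \<le> (1 + C * (1/2) powr (1 - \<theta>)) * ?h Q"
    using C(1) by (simp add: algebra_simps)
  then show ?case unfolding C(2) by (simp add: C_def)
qed

end

text \<open>
  The factors come from the ratio of averages within a group, the passage to cores, the Kolmogorov
  lemma with \<open>\<theta> = 2 - p\<close>, and the embedding below.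
\<close>

definition testing_const :: "real \<Rightarrow> real" where
  "testing_const p = 2 * 2 powr (p - 1) * (1 / (1 - (1/2) powr (p - 1))) * 
     (2 * 2 powr p * (p / (p - 1)) powr p) powr (1 / p)"

lemma testing_const_pos: "1 < p \<Longrightarrow> 0 < testing_const p"
proof -
  assume p: "1 < p"
  have "(1/2::real) powr (p - 1) < 1" using p powr_less_mono2[of "p - 1" "1/2" 1] by simp
  then show ?thesis using p by (simp add: testing_const_def)
qed

context tree
begin

text \<open>
  In contrast to the Carleson embedding, the full masses of the cells of \<open>T\<close> are counted, not those
  of disjoint cores. This is possible because \<open>T\<close> contains, for each dyadic size of the average,
  only maximal cells: the averages over the cells of \<open>T\<close> around a fixed point have different dyadic
  sizes and sum up geometrically to the maximal function.
\<close>

lemma dyadic_tops_embedding: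
  assumes \<nu>: "\<forall>x\<in>X. 0 < \<nu> x" and f: "\<forall>x\<in>X. 0 \<le> f x" and p: "1 < p"
    and S: "S \<subseteq> cells" and pos: "\<And>Q. Q \<in> S \<Longrightarrow> 0 < avg \<nu> f Q"
    and T: "T = (\<Union>n::int. tops {Q \<in> S. \<lfloor>log 2 (avg \<nu> f Q)\<rfloor> = n})"
  shows "(\<Sum>Q\<in>T. avg \<nu> f Q powr p * sum \<nu> Q) \<le>
    2 * 2 powr p * (p / (p - 1)) powr p * (\<Sum>x\<in>X. f x powr p * \<nu> x)"
proof -
  define lev where "lev Q = \<lfloor>log 2 (avg \<nu> f Q)\<rfloor>" for Q
  have TS: "T \<subseteq> S" unfolding T by (auto simp: tops_def)
  have fT: "finite T" by (rule finite_subset[OF subset_trans[OF TS S] finite_cells])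
  have lev: "2 powr lev Q \<le> avg \<nu> f Q" "avg \<nu> f Q \<le> 2 powr (lev Q + 1)" if "Q \<in> S" for Q
  proof -
    have "2 powr log 2 (avg \<nu> f Q) = avg \<nu> f Q" using pos[OF that] by simp
    moreover have "2 powr lev Q \<le> 2 powr log 2 (avg \<nu> f Q)"
      "2 powr log 2 (avg \<nu> f Q) \<le> 2 powr (lev Q + 1)"
      unfolding lev_def by (auto simp: powr_le_cancel_iff intro: less_imp_le)
    ultimately show "2 powr lev Q \<le> avg \<nu> f Q" "avg \<nu> f Q \<le> 2 powr (lev Q + 1)" by auto
  qed
  obtain M where M: "\<forall>x\<in>X. 0 \<le> M x \<and> (\<forall>Q\<in>cells. x \<in> Q \<longrightarrow> avg \<nu> f Q \<le> M x)"
    and le: "(\<Sum>x\<in>X. M x powr p * \<nu> x) \<le> (p / (p - 1)) powr p * (\<Sum>x\<in>X. f x powr p * \<nu> x)"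
    using Doob[OF \<nu> f p] by (elim exE conjE) (rule that)
  have pt: "(\<Sum>Q | Q \<in> T \<and> x \<in> Q. avg \<nu> f Q powr p) \<le> 2 * 2 powr p * M x powr p"
    if x: "x \<in> X" for x
  proof -
    let ?T = "{Q \<in> T. x \<in> Q}"
    have inj: "inj_on lev ?T"
    proof (rule inj_onI)
      fix Q R assume Q: "Q \<in> ?T" and R: "R \<in> ?T" and e: "lev Q = lev R"
      obtain n m where n: "Q \<in> tops {Q \<in> S. lev Q = n}" and m: "R \<in> tops {Q \<in> S. lev Q = m}"
        using Q R unfolding T lev_def by auto
      then have "n = lev Q" "m = lev R" by (auto simp: tops_def)
      then show "Q = R" using n m e Q R S by (intro tops_disjoint[of "{Q \<in> S. lev Q = n}" Q R x]) auto
    qed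
    show ?thesis
    proof (cases "?T = {}")
      case True
      show ?thesis unfolding True by simp
    next
      case False
      define m where "m = Max (lev ` ?T)"
      have "m \<in> lev ` ?T" unfolding m_def using fT False by (intro Max_in) auto
      then obtain R where R: "R \<in> T" "x \<in> R" "lev R = m" by auto
      have "2 powr m \<le> avg \<nu> f R" using lev(1)[of R] R TS by auto
      also have "\<dots> \<le> M x" using M x R TS S by blast
      finally have mM: "2 powr m \<le> M x" .
      have "(\<Sum>Q\<in>?T. avg \<nu> f Q powr p) \<le> (\<Sum>Q\<in>?T. 2 powr p * 2 powr (of_int (lev Q) * p))"
      proof (intro sum_mono)
        fix Q assume "Q \<in> ?T"
        then have Q: "Q \<in> S" using TS by auto
        have "avg \<nu> f Q powr p \<le> (2 powr (lev Q + 1)) powr p"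
          using p pos[OF Q] lev(2)[OF Q] by (intro powr_mono2) auto
        also have "\<dots> = 2 powr p * 2 powr (of_int (lev Q) * p)"
          by (simp add: powr_powr powr_add[symmetric] algebra_simps)
        finally show "avg \<nu> f Q powr p \<le> 2 powr p * 2 powr (of_int (lev Q) * p)" .
      qed
      also have "\<dots> = 2 powr p * (\<Sum>n\<in>lev ` ?T. 2 powr (of_int n * p))"
        by (simp add: sum_distrib_left[symmetric] sum.reindex[OF inj])
      also have "\<dots> \<le> 2 powr p * (2 * 2 powr (of_int m * p))"
        using p fT by (intro mult_left_mono sum_powers_le) (auto simp: m_def)
      also have "2 powr (of_int m * p) = (2 powr m) powr p" by (simp add: powr_powr)
      also have "\<dots> \<le> M x powr p" using mM p by (intro powr_mono2) auto
      finally show ?thesis by simp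
    qed
  qed
  have "(\<Sum>Q\<in>T. avg \<nu> f Q powr p * sum \<nu> Q) = (\<Sum>Q\<in>T. \<Sum>x | x \<in> X \<and> x \<in> Q. avg \<nu> f Q powr p * \<nu> x)"
  proof (intro sum.cong refl)
    fix Q assume "Q \<in> T"
    then have "{x. x \<in> X \<and> x \<in> Q} = Q" using TS S cells_sub by blast
    then show "avg \<nu> f Q powr p * sum \<nu> Q = (\<Sum>x | x \<in> X \<and> x \<in> Q. avg \<nu> f Q powr p * \<nu> x)"
      by (simp add: sum_distrib_left)
  qed
  also have "\<dots> = (\<Sum>x\<in>X. \<Sum>Q | Q \<in> T \<and> x \<in> Q. avg \<nu> f Q powr p * \<nu> x)"
    by (rule sum.swap_restrict[OF fT fin])
  also have "\<dots> = (\<Sum>x\<in>X. (\<Sum>Q | Q \<in> T \<and> x \<in> Q. avg \<nu> f Q powr p) * \<nu> x)"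
    by (simp only: sum_distrib_right)
  also have "\<dots> \<le> (\<Sum>x\<in>X. 2 * 2 powr p * M x powr p * \<nu> x)"
    using \<nu> by (intro sum_mono mult_right_mono pt) (auto intro: less_imp_le)
  also have "\<dots> = 2 * 2 powr p * (\<Sum>x\<in>X. M x powr p * \<nu> x)"
    by (simp add: sum_distrib_left mult.assoc)
  also have "\<dots> \<le> 2 * 2 powr p * ((p / (p - 1)) powr p * (\<Sum>x\<in>X. f x powr p * \<nu> x))"
    by (intro mult_left_mono le) auto
  finally show ?thesis by (simp add: mult.assoc)
qed

end

context weighted_tree
begin

text \<open>
  Integrated against \<open>w\<close>, a cell contributes at most \<open>K\<close> times the \<open>\<sigma>\<close>-average of \<open>f\<close> times
  \<open>\<sigma>(Q)^(2-p) \<mu>(Q)^(p-1)\<close>. Cells with comparable averages are grouped; by the Kolmogorov lemma with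
  \<open>\<theta> = 2 - p\<close> each group is controlled by its maximal cells. For these the factor is passed to the
  core in \<open>w\<close> but left on the whole cell in \<open>\<sigma>\<close>, since \<open>2 - p > 0\<close> here, and the previous embedding
  applies.
\<close>

lemma testing_local:
  assumes p2: "p < 2" and S: "sparse \<mu> S" and Q0: "Q0 \<in> cells" and sub: "\<forall>Q\<in>S. Q \<subseteq> Q0"
    and f: "\<forall>x\<in>X. 0 \<le> f x"
  shows "(\<Sum>Q\<in>S. (\<Sum>x\<in>Q. f x * \<sigma> x) * sum w Q / sum \<mu> Q) \<le>
    testing_const p * K * (\<Sum>x\<in>X. f x powr p * \<sigma> x) powr (1 / p) * sum w Q0 powr (1 - 1 / p)"
proof -
  let ?a = "\<lambda>Q. avg \<sigma> f Q"
  let ?h = "\<lambda>Q. sum \<sigma> Q powr (2 - p) * sum \<mu> Q powr (1 - (2 - p))"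
  define \<Gamma> :: real where "\<Gamma> = 1 / (1 - (1/2) powr (p - 1))"
  have half: "(1/2::real) powr (p - 1) < 1" using p powr_less_mono2[of "p - 1" "1/2" 1] by simp
  have \<Gamma>: "0 < \<Gamma>" using half by (simp add: \<Gamma>_def)
  have K: "0 < K" by (rule K_pos[OF Q0])
  have Sc: "S \<subseteq> cells" using S by (simp add: sparse_def)
  have fS: "finite S" by (rule sparse_finite[OF S])
  have a_nn: "0 \<le> ?a Q" if "Q \<in> S" for Q
    by (rule avg_nonneg[OF \<sigma>_pos f cells_sub[OF subsetD[OF Sc that]]])
  \<comment> \<open>Cells with average zero contribute nothing; the others are grouped by the dyadic size of the average.\<close>
  define P where "P = {Q \<in> S. 0 < ?a Q}"
  define lev where "lev Q = \<lfloor>log 2 (?a Q)\<rfloor>" for Q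
  define G where "G n = {Q \<in> P. lev Q = n}" for n
  define T where "T = (\<Union>n. tops (G n))"
  have PS: "P \<subseteq> S" and GS: "G n \<subseteq> S" for n by (auto simp: P_def G_def)
  have Pc: "P \<subseteq> cells" and Gc: "G n \<subseteq> cells" for n using PS GS Sc by blast+
  have TP: "T \<subseteq> P" by (auto simp: T_def G_def tops_def)
  have fP: "finite P" by (rule finite_subset[OF PS fS])
  have fT: "finite T" by (rule finite_subset[OF TP fP])
  have lev: "2 powr lev Q \<le> ?a Q" "?a Q \<le> 2 * 2 powr lev Q" if "Q \<in> P" for Q
  proof -
    have pos: "0 < ?a Q" using that by (auto simp: P_def)
    have "2 powr log 2 (?a Q) = ?a Q" using pos by simp
    moreover have "2 powr lev Q \<le> 2 powr log 2 (?a Q)"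
      "2 powr log 2 (?a Q) \<le> 2 powr (lev Q + 1)"
      unfolding lev_def by (auto simp: powr_le_cancel_iff intro: less_imp_le)
    moreover have "2 powr (lev Q + 1) = 2 * 2 powr (lev Q)" by (simp add: powr_add)
    ultimately show "2 powr lev Q \<le> ?a Q" "?a Q \<le> 2 * 2 powr lev Q" by auto
  qed
  have pm1: "1 - (2 - p) = p - 1" by simp
  have "(\<Sum>Q\<in>S. (\<Sum>x\<in>Q. f x * \<sigma> x) * sum w Q / sum \<mu> Q) \<le> (\<Sum>Q\<in>S. K * (?a Q * ?h Q))"
  proof (intro sum_mono)
    fix Q assume Q: "Q \<in> S"
    then have Qc: "Q \<in> cells" using Sc by auto
    have "(\<Sum>x\<in>Q. f x * \<sigma> x) * sum w Q / sum \<mu> Q = ?a Q * (sum \<sigma> Q * sum w Q / sum \<mu> Q)"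
      using sum_cell_pos[OF \<sigma>_pos Qc] by (simp add: avg_def)
    also have "\<dots> \<le> ?a Q * (K * ?h Q)"
      unfolding pm1 by (intro mult_left_mono Ap_cell' Qc a_nn Q)
    finally show "(\<Sum>x\<in>Q. f x * \<sigma> x) * sum w Q / sum \<mu> Q \<le> K * (?a Q * ?h Q)" by (simp add: ac_simps)
  qed
  also have "\<dots> = K * (\<Sum>Q\<in>S. ?a Q * ?h Q)" by (simp only: sum_distrib_left)
  also have "(\<Sum>Q\<in>S. ?a Q * ?h Q) = (\<Sum>Q\<in>P. ?a Q * ?h Q)"
    using a_nn fS by (intro sum.mono_neutral_right) (auto simp: P_def less_le)
  also have "\<dots> = (\<Sum>n\<in>lev ` P. \<Sum>Q\<in>G n. ?a Q * ?h Q)"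
    unfolding G_def by (rule sum.image_gen[OF fP])
  also have "\<dots> \<le> (\<Sum>n\<in>lev ` P. \<Sum>Q\<in>tops (G n). 2 * \<Gamma> * (?a Q * ?h Q))"
  proof (intro sum_mono)
    fix n
    have "(\<Sum>Q\<in>G n. ?a Q * ?h Q) \<le> (\<Sum>Q\<in>G n. 2 * 2 powr n * ?h Q)"
      using lev(2) by (intro sum_mono mult_right_mono) (auto simp: G_def)
    also have "\<dots> = 2 * 2 powr n * (\<Sum>Q\<in>G n. ?h Q)" by (simp only: sum_distrib_left)
    also have "(\<Sum>Q\<in>G n. ?h Q) = (\<Sum>M\<in>tops (G n). \<Sum>Q | Q \<in> G n \<and> Q \<subseteq> M. ?h Q)"
      by (rule sum_by_tops[OF Gc])
    also have "2 * 2 powr n * \<dots> \<le> 2 * 2 powr n * (\<Sum>M\<in>tops (G n). \<Gamma> * ?h M)"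
    proof (intro mult_left_mono sum_mono)
      fix M assume M: "M \<in> tops (G n)"
      have "sparse \<mu> (G n)" by (rule sparse_subset[OF \<mu>_pos S GS])
      then show "(\<Sum>Q | Q \<in> G n \<and> Q \<subseteq> M. ?h Q) \<le> \<Gamma> * ?h M"
        using Kolmogorov[OF \<mu>_pos \<sigma>_pos, of "G n" "2 - p" M] p p2 M by (simp add: \<Gamma>_def tops_def)
    qed auto
    also have "\<dots> = (\<Sum>M\<in>tops (G n). 2 * \<Gamma> * (2 powr n * ?h M))"
      by (simp add: sum_distrib_left ac_simps)
    also have "\<dots> \<le> (\<Sum>Q\<in>tops (G n). 2 * \<Gamma> * (?a Q * ?h Q))"
      using lev(1) \<Gamma> by (intro sum_mono mult_left_mono mult_right_mono) (auto simp: tops_def G_def)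
    finally show "(\<Sum>Q\<in>G n. ?a Q * ?h Q) \<le> (\<Sum>Q\<in>tops (G n). 2 * \<Gamma> * (?a Q * ?h Q))" .
  qed
  also have "\<dots> = (\<Sum>Q\<in>T. 2 * \<Gamma> * (?a Q * ?h Q))"
  proof -
    have "T = (\<Union>n\<in>lev ` P. tops (G n))" by (auto simp: T_def tops_def G_def)
    then show ?thesis
      using fP by (simp only: sum.UNION_disjoint[symmetric])
        (subst sum.UNION_disjoint[symmetric], auto simp: tops_def G_def)
  qed
  also have "\<dots> = 2 * \<Gamma> * (\<Sum>Q\<in>T. ?a Q * ?h Q)" by (simp only: sum_distrib_left)
  also have "(\<Sum>Q\<in>T. ?a Q * ?h Q) \<le> (\<Sum>Q\<in>T. 2 powr (p - 1) *
     ((?a Q powr p * sum \<sigma> Q) powr (1 / p) * sum w (core S Q) powr (1 - 1 / p)))"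
  proof (intro sum_mono)
    fix Q assume "Q \<in> T"
    then have Q: "Q \<in> S" using TP PS by auto
    then have Qc: "Q \<in> cells" using Sc by auto
    note s = sum_cell_pos[OF \<sigma>_pos Qc]
    note cp = core_pos[OF S Q]
    have "sum \<mu> Q powr (p - 1) \<le>
      2 powr (p - 1) * (sum w (core S Q) powr (1 - 1 / p) * sum \<sigma> Q powr ((p - 1)\<^sup>2 / p))"
      using p cp by (intro order_trans[OF core_mass_powr[OF S Q]] mult_left_mono powr_mono2) auto
    then have "?a Q * ?h Q \<le> ?a Q * (sum \<sigma> Q powr (2 - p) *
      (2 powr (p - 1) * (sum w (core S Q) powr (1 - 1 / p) * sum \<sigma> Q powr ((p - 1)\<^sup>2 / p))))"
      unfolding pm1 using a_nn[OF Q] by (intro mult_left_mono) auto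
    also have "\<dots> = 2 powr (p - 1) * ((?a Q * (sum \<sigma> Q powr (2 - p) * sum \<sigma> Q powr ((p - 1)\<^sup>2 / p))) *
       sum w (core S Q) powr (1 - 1 / p))" by (simp add: ac_simps)
    also have "sum \<sigma> Q powr (2 - p) * sum \<sigma> Q powr ((p - 1)\<^sup>2 / p) = sum \<sigma> Q powr (1 / p)"
    proof -
      have "2 - p + (p - 1)\<^sup>2 / p = 1 / p" using p by (simp add: field_simps power2_eq_square)
      then show ?thesis by (simp flip: powr_add)
    qed
    also have "?a Q * sum \<sigma> Q powr (1 / p) = (?a Q powr p * sum \<sigma> Q) powr (1 / p)"
      using a_nn[OF Q] s p by (simp add: powr_mult powr_powr)
    finally show "?a Q * ?h Q \<le> 2 powr (p - 1) *
     ((?a Q powr p * sum \<sigma> Q) powr (1 / p) * sum w (core S Q) powr (1 - 1 / p))" .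
  qed
  also have "\<dots> = 2 powr (p - 1) * (\<Sum>Q\<in>T. (?a Q powr p * sum \<sigma> Q) powr (1 / p) *
     sum w (core S Q) powr (1 - 1 / p))" by (simp only: sum_distrib_left)
  also have "(\<Sum>Q\<in>T. (?a Q powr p * sum \<sigma> Q) powr (1 / p) * sum w (core S Q) powr (1 - 1 / p)) \<le>
     (\<Sum>Q\<in>T. ?a Q powr p * sum \<sigma> Q) powr (1 / p) * (\<Sum>Q\<in>T. sum w (core S Q)) powr (1 - 1 / p)"
  proof (intro Holder_sum_theta fT)
    fix Q assume "Q \<in> T"
    then have Q: "Q \<in> S" using TP PS by auto
    then show "0 \<le> ?a Q powr p * sum \<sigma> Q" "0 \<le> sum w (core S Q)"
      using sum_cell_pos[OF \<sigma>_pos subsetD[OF Sc Q]] core_pos(2)[OF S Q] by simp_all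
  qed (use p in auto)
  also have "\<dots> \<le> (2 * 2 powr p * (p / (p - 1)) powr p * (\<Sum>x\<in>X. f x powr p * \<sigma> x)) powr (1 / p) *
     sum w Q0 powr (1 - 1 / p)"
  proof (intro mult_mono powr_mono2)
    show "(\<Sum>Q\<in>T. ?a Q powr p * sum \<sigma> Q) \<le> 2 * 2 powr p * (p / (p - 1)) powr p * (\<Sum>x\<in>X. f x powr p * \<sigma> x)"
      by (rule dyadic_tops_embedding[OF \<sigma>_pos f p Pc]) (auto simp: P_def T_def G_def lev_def)
    have "(\<Sum>Q\<in>T. sum w (core S Q)) \<le> (\<Sum>Q\<in>S. sum w (core S Q))"
      using TP PS fS core_pos(2)[OF S] by (intro sum_mono2) (auto intro: less_imp_le)
    also have "\<dots> = sum w (\<Union>Q\<in>S. core S Q)"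
      using fS core_disjoint[OF Sc] finite_subset[OF core_sub cells_fin] Sc
      by (intro sum.UNION_disjoint[symmetric]) auto
    also have "\<dots> \<le> sum w Q0"
    proof (intro sum_mono2 cells_fin Q0)
      show "(\<Union>Q\<in>S. core S Q) \<subseteq> Q0" using sub core_sub by blast
      show "0 \<le> w x" if "x \<in> Q0 - (\<Union>Q\<in>S. core S Q)" for x
        using that cells_sub[OF Q0] w_pos by (auto intro: less_imp_le)
    qed
    finally show "(\<Sum>Q\<in>T. sum w (core S Q)) \<le> sum w Q0" .
    show "0 \<le> (\<Sum>Q\<in>T. sum w (core S Q))"
      using TP PS core_pos(2)[OF S] by (intro sum_nonneg[of T] less_imp_le) blast
    show "0 \<le> (\<Sum>Q\<in>T. ?a Q powr p * sum \<sigma> Q)"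
      using TP PS Sc sum_cell_pos[OF \<sigma>_pos] by (intro sum_nonneg[of T] mult_nonneg_nonneg less_imp_le[of _ "sum \<sigma> _"]) auto
  qed (use p in auto)
  also have "\<dots> = (2 * 2 powr p * (p / (p - 1)) powr p) powr (1 / p) *
      (\<Sum>x\<in>X. f x powr p * \<sigma> x) powr (1 / p) * sum w Q0 powr (1 - 1 / p)"
    using p \<sigma>_pos by (subst powr_mult) (auto intro!: sum_nonneg intro: less_imp_le)
  finally show ?thesis
    using K \<Gamma> by (simp add: testing_const_def \<Gamma>_def[symmetric] mult_left_mono ac_simps)
qed

text \<open>
  Only the values of \<open>f\<close> on \<open>Q0\<close> matter on the left side, so the local estimate may be applied to
  the restriction of \<open>f\<close>.
\<close>

lemma testing:
  assumes p2: "p < 2" and S: "sparse \<mu> S" and Q0: "Q0 \<in> cells" and f: "\<forall>x\<in>X. 0 \<le> f x"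
  shows "(\<Sum>Q | Q \<in> S \<and> Q \<subseteq> Q0. (\<Sum>x\<in>Q. f x * \<sigma> x) * sum w Q / sum \<mu> Q) \<le>
    testing_const p * K * (\<Sum>x\<in>Q0. f x powr p * \<sigma> x) powr (1 / p) * sum w Q0 powr (1 - 1 / p)"
proof -
  let ?S = "{Q \<in> S. Q \<subseteq> Q0}" and ?f = "\<lambda>x. if x \<in> Q0 then f x else 0"
  have "(\<Sum>Q\<in>?S. (\<Sum>x\<in>Q. f x * \<sigma> x) * sum w Q / sum \<mu> Q) =
      (\<Sum>Q\<in>?S. (\<Sum>x\<in>Q. ?f x * \<sigma> x) * sum w Q / sum \<mu> Q)"
  proof (intro sum.cong refl)
    fix Q assume "Q \<in> ?S"
    then have "(\<Sum>x\<in>Q. f x * \<sigma> x) = (\<Sum>x\<in>Q. ?f x * \<sigma> x)" by (intro sum.cong) auto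
    then show "(\<Sum>x\<in>Q. f x * \<sigma> x) * sum w Q / sum \<mu> Q = (\<Sum>x\<in>Q. ?f x * \<sigma> x) * sum w Q / sum \<mu> Q"
      by simp
  qed
  also have "\<dots> \<le> testing_const p * K * (\<Sum>x\<in>X. ?f x powr p * \<sigma> x) powr (1 / p) * sum w Q0 powr (1 - 1 / p)"
    using f by (intro testing_local p2 Q0 sparse_subset[OF \<mu>_pos S]) auto
  also have "(\<Sum>x\<in>X. ?f x powr p * \<sigma> x) = (\<Sum>x\<in>Q0. f x powr p * \<sigma> x)"
    using cells_sub[OF Q0] fin by (intro sum.mono_neutral_cong_right) auto
  finally show ?thesis .
qed

end

context tree
begin

text \<open>
  The level set of a positive sum over cells is a union of cells, the maximal ones being those for
  which the sum over the cells containing them first exceeds \<open>\<alpha>\<close>. At a point of such a cell \<open>M\<close> the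
  cells strictly above \<open>M\<close> contribute at most \<open>\<alpha>\<close>, which leaves the cells inside \<open>M\<close>.
\<close>

lemma level_set_tops:
  fixes a :: "'x set \<Rightarrow> real"
  assumes S: "S \<subseteq> cells" and \<alpha>: "0 < \<alpha>" and a: "\<And>Q. Q \<in> S \<Longrightarrow> 0 \<le> a Q"
    and H: "H = {Q \<in> S. \<alpha> < (\<Sum>R | R \<in> S \<and> Q \<subseteq> R. a R)}"
  shows "{x \<in> X. \<alpha> < (\<Sum>Q | Q \<in> S \<and> x \<in> Q. a Q)} = \<Union>H"
    and "\<And>M x. M \<in> tops H \<Longrightarrow> x \<in> M \<Longrightarrow>
      (\<Sum>Q | Q \<in> S \<and> x \<in> Q. a Q) \<le> \<alpha> + (\<Sum>Q | (Q \<in> S \<and> Q \<subseteq> M) \<and> x \<in> Q. a Q)"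
proof -
  have fS: "finite S" by (rule finite_subset[OF S finite_cells])
  show "{x \<in> X. \<alpha> < (\<Sum>Q | Q \<in> S \<and> x \<in> Q. a Q)} = \<Union>H"
  proof (intro equalityI subsetI)
    fix x assume "x \<in> {x \<in> X. \<alpha> < (\<Sum>Q | Q \<in> S \<and> x \<in> Q. a Q)}"
    then have x: "\<alpha> < (\<Sum>Q | Q \<in> S \<and> x \<in> Q. a Q)" by auto
    define T where "T = {Q \<in> S. x \<in> Q}"
    have "T \<noteq> {}" using x \<alpha> unfolding T_def by (metis less_asym sum.empty)
    moreover have "finite T" using fS by (simp add: T_def)
    ultimately obtain Q where Q: "Q \<in> T" and min: "\<And>R. R \<in> T \<Longrightarrow> R \<subseteq> Q \<Longrightarrow> R = Q"
      using finite_has_minimal[of T] by metis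
    have "Q \<subseteq> R" if R: "R \<in> T" for R
      using cells_laminar[of Q R x] Q R S min[OF R] by (auto simp: T_def)
    then have "T = {R \<in> S. Q \<subseteq> R}" using Q by (auto simp: T_def)
    then have "Q \<in> H" using Q x by (auto simp: H T_def)
    then show "x \<in> \<Union>H" using Q by (auto simp: T_def)
  next
    fix x assume "x \<in> \<Union>H"
    then obtain Q where Q: "Q \<in> H" "x \<in> Q" by auto
    then have "Q \<in> S" "\<alpha> < (\<Sum>R | R \<in> S \<and> Q \<subseteq> R. a R)" by (auto simp: H)
    moreover have "(\<Sum>R | R \<in> S \<and> Q \<subseteq> R. a R) \<le> (\<Sum>R | R \<in> S \<and> x \<in> R. a R)"
      using fS Q a by (intro sum_mono2) auto
    moreover have "x \<in> X" using Q(2) cells_sub[OF subsetD[OF S \<open>Q \<in> S\<close>]] by auto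
    ultimately show "x \<in> {x \<in> X. \<alpha> < (\<Sum>Q | Q \<in> S \<and> x \<in> Q. a Q)}" by auto
  qed
  fix M x assume M: "M \<in> tops H" and x: "x \<in> M"
  have MS: "M \<in> S" using M by (auto simp: tops_def H)
  define T where "T = {Q \<in> S. M \<subset> Q}"
  have fT: "finite T" using fS by (simp add: T_def)
  have "(\<Sum>Q\<in>T. a Q) \<le> \<alpha>"
  proof (cases "T = {}")
    case True
    then show ?thesis using \<alpha> by simp
  next
    case False
    then obtain P where P: "P \<in> T" and min: "\<And>R. R \<in> T \<Longrightarrow> R \<subseteq> P \<Longrightarrow> R = P"
      using finite_has_minimal[OF fT] by metis
    have "P \<subseteq> R" if R: "R \<in> T" for R
      using cells_laminar[of P R x] P R S x min[OF R] by (auto simp: T_def)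
    then have "T = {R \<in> S. P \<subseteq> R}" using P by (auto simp: T_def)
    moreover have "P \<notin> H" using M P by (auto simp: tops_def T_def)
    ultimately show ?thesis using P by (auto simp: H T_def)
  qed
  moreover have "(\<Sum>Q | Q \<in> S \<and> x \<in> Q. a Q) = (\<Sum>Q\<in>T. a Q) + (\<Sum>Q | (Q \<in> S \<and> Q \<subseteq> M) \<and> x \<in> Q. a Q)"
  proof (subst sum.union_disjoint[symmetric])
    have "Q \<in> T \<or> Q \<subseteq> M" if "Q \<in> S" "x \<in> Q" for Q
      using cells_laminar[of Q M x] that S MS x by (auto simp: T_def)
    then have "{Q \<in> S. x \<in> Q} = T \<union> {Q. (Q \<in> S \<and> Q \<subseteq> M) \<and> x \<in> Q}"
      using x by (auto simp: T_def)
    then show "(\<Sum>Q | Q \<in> S \<and> x \<in> Q. a Q) = sum a (T \<union> {Q. (Q \<in> S \<and> Q \<subseteq> M) \<and> x \<in> Q})" by simp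
  qed (use fT fS in \<open>auto simp: T_def\<close>)
  ultimately show "(\<Sum>Q | Q \<in> S \<and> x \<in> Q. a Q) \<le> \<alpha> + (\<Sum>Q | (Q \<in> S \<and> Q \<subseteq> M) \<and> x \<in> Q. a Q)"
    by simp
qed

end

text \<open>
  The second factor is the constant of the good-\<open>\<lambda>\<close> inequality for \<open>1/\<eta> = 2^(p+1)\<close>; the first one
  comes from comparing the heights \<open>\<alpha>\<close> and \<open>2 \<alpha>\<close> and from absorbing one half.
\<close>

definition weak_const :: "real \<Rightarrow> real" where
  "weak_const p = 2 powr (p + 1) * (testing_const p * (2 powr (p + 1)) powr (1 - 1 / p))"

context weighted_tree
begin

text \<open>
  Decompose the level set at height \<open>\<alpha>\<close> into maximal cells \<open>M\<close>. If the level set at height \<open>2 \<alpha>\<close>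
  fills at most the fraction \<open>\<eta>\<close> of \<open>M\<close>, this goes into the first term. Otherwise \<open>w(M)\<close> is
  controlled by the part of the higher level set in \<open>M\<close>, on which the cells inside \<open>M\<close> alone
  contribute at least \<open>\<alpha>\<close>; there the testing estimate applies.
\<close>

lemma good_lambda:
  assumes p2: "p < 2" and S: "sparse \<mu> S" and F: "\<forall>x\<in>X. 0 \<le> F x" and \<alpha>: "0 < \<alpha>" and \<eta>: "0 < \<eta>"
    and Ne: "X \<noteq> {}"
  defines "E \<equiv> \<lambda>\<alpha>. {x \<in> X. \<alpha> < sparse_op \<mu> S F x}"
  shows "\<alpha> * sum w (E (2 * \<alpha>)) \<le> \<eta> * \<alpha> * sum w (E \<alpha>) +
    testing_const p * K * (1 / \<eta>) powr (1 - 1 / p) *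
    (\<Sum>x\<in>X. (F x * \<mu> x / \<sigma> x) powr p * \<sigma> x) powr (1 / p) * sum w (E (2 * \<alpha>)) powr (1 - 1 / p)"
proof -
  let ?f = "\<lambda>x. F x * \<mu> x / \<sigma> x"
  let ?a = "avg \<mu> F"
  let ?c = "testing_const p * K"
  let ?G = "\<lambda>M. (\<Sum>x\<in>M. ?f x powr p * \<sigma> x)"
  have K: "0 < K" using Ne K_pos by (auto simp: cells_def)
  have c0: "0 < ?c" using K testing_const_pos[OF p] by simp
  have Sc: "S \<subseteq> cells" using S by (simp add: sparse_def)
  have f: "\<forall>x\<in>X. 0 \<le> ?f x" using F \<mu>_pos \<sigma>_pos by (auto simp: less_imp_le)
  have a: "0 \<le> ?a Q" if "Q \<in> S" for Q
    by (rule avg_nonneg[OF \<mu>_pos F cells_sub[OF subsetD[OF Sc that]]])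
  define H where "H = {Q \<in> S. \<alpha> < (\<Sum>R | R \<in> S \<and> Q \<subseteq> R. ?a R)}"
  have Hc: "H \<subseteq> cells" using Sc by (auto simp: H_def)
  have fH: "finite (tops H)"
    by (rule finite_subset[OF _ sparse_finite[OF S]]) (auto simp: tops_def H_def)
  have E: "E \<alpha> = \<Union>H"
    unfolding E_def sparse_op_def by (rule level_set_tops(1)[OF Sc \<alpha> a H_def])
  have E2: "E (2 * \<alpha>) \<subseteq> \<Union>H" unfolding E[symmetric] using \<alpha> by (auto simp: E_def)
  have Mc: "M \<in> cells" if "M \<in> tops H" for M using that Hc by (auto simp: tops_def)
  have wnn: "0 \<le> sum w A" if "A \<subseteq> X" for A
    using that w_pos by (intro sum_nonneg) (auto intro: less_imp_le)
  have Gnn: "0 \<le> ?G A" if "A \<subseteq> X" for A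
    using that \<sigma>_pos by (intro sum_nonneg mult_nonneg_nonneg) (auto intro: less_imp_le)
  have step: "\<alpha> * sum w (M \<inter> E (2 * \<alpha>)) \<le> \<eta> * \<alpha> * sum w M +
     ?c * (1 / \<eta>) powr (1 - 1 / p) * (?G M powr (1 / p) * sum w (M \<inter> E (2 * \<alpha>)) powr (1 - 1 / p))"
    if M: "M \<in> tops H" for M
  proof -
    let ?ME = "M \<inter> E (2 * \<alpha>)"
    let ?SM = "{Q \<in> S. Q \<subseteq> M}"
    have MX: "M \<subseteq> X" by (rule cells_sub[OF Mc[OF M]])
    have wM: "0 \<le> sum w M" "0 \<le> sum w ?ME" using wnn MX by (auto intro: wnn)
    show ?thesis
    proof (cases "sum w ?ME \<le> \<eta> * sum w M")
      case True
      then have "\<alpha> * sum w ?ME \<le> \<alpha> * (\<eta> * sum w M)" using \<alpha> by (intro mult_left_mono) auto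
      moreover have "0 \<le> ?c * (1 / \<eta>) powr (1 - 1 / p) * (?G M powr (1 / p) * sum w ?ME powr (1 - 1 / p))"
        using c0 by (intro mult_nonneg_nonneg[OF mult_nonneg_nonneg]) auto
      ultimately show ?thesis by (simp add: ac_simps)
    next
      case False
      have "\<alpha> * sum w ?ME = (\<Sum>x\<in>?ME. \<alpha> * w x)" by (simp add: sum_distrib_left)
      also have "\<dots> \<le> (\<Sum>x\<in>?ME. sparse_op \<mu> ?SM F x * w x)"
      proof (intro sum_mono mult_right_mono)
        fix x assume x: "x \<in> ?ME"
        then have "2 * \<alpha> < sparse_op \<mu> S F x" by (auto simp: E_def)
        moreover have "sparse_op \<mu> S F x \<le> \<alpha> + sparse_op \<mu> ?SM F x"
          using level_set_tops(2)[OF Sc \<alpha> a H_def M, of x] x by (simp add: sparse_op_def)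
        ultimately show "\<alpha> \<le> sparse_op \<mu> ?SM F x" by simp
        show "0 \<le> w x" using x MX w_pos by (auto intro: less_imp_le)
      qed
      also have "\<dots> = (\<Sum>Q\<in>?SM. ?a Q * sum w (Q \<inter> ?ME))"
        using Sc MX by (intro sum_sparse_op) auto
      also have "\<dots> \<le> (\<Sum>Q\<in>?SM. (\<Sum>x\<in>Q. ?f x * \<sigma> x) * sum w Q / sum \<mu> Q)"
      proof (intro sum_mono)
        fix Q assume Q: "Q \<in> ?SM"
        then have Qc: "Q \<in> cells" and QX: "Q \<subseteq> X" using Sc cells_sub by auto
        have "sum w (Q \<inter> ?ME) \<le> sum w Q"
          using QX w_pos cells_fin[OF Qc] by (intro sum_mono2) (auto intro: less_imp_le)
        then have "?a Q * sum w (Q \<inter> ?ME) \<le> ?a Q * sum w Q" using a Q by (intro mult_left_mono) auto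
        moreover have "(\<Sum>x\<in>Q. ?f x * \<sigma> x) = (\<Sum>x\<in>Q. F x * \<mu> x)"
          using QX \<sigma>_pos by (intro sum.cong refl) (auto simp: subset_iff, metis less_irrefl)
        ultimately show "?a Q * sum w (Q \<inter> ?ME) \<le> (\<Sum>x\<in>Q. ?f x * \<sigma> x) * sum w Q / sum \<mu> Q"
          by (simp add: avg_def)
      qed
      also have "\<dots> \<le> ?c * ?G M powr (1 / p) * sum w M powr (1 - 1 / p)"
        by (rule testing[OF p2 S Mc[OF M] f])
      also have "\<dots> \<le> ?c * ?G M powr (1 / p) * ((1 / \<eta>) * sum w ?ME) powr (1 - 1 / p)"
      proof (intro mult_left_mono powr_mono2)
        show "0 \<le> ?c * ?G M powr (1 / p)" by (intro mult_nonneg_nonneg less_imp_le[OF c0]) simp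
      qed (use False \<eta> p wM in \<open>auto simp: field_simps\<close>)
      also have "\<dots> = ?c * (1 / \<eta>) powr (1 - 1 / p) * (?G M powr (1 / p) * sum w ?ME powr (1 - 1 / p))"
        using \<eta> wM by (subst powr_mult) (auto simp: ac_simps)
      finally show ?thesis using \<eta> \<alpha> wM(1) by (auto intro: order_trans)
    qed
  qed
  have "\<alpha> * sum w (E (2 * \<alpha>)) = \<alpha> * (\<Sum>M\<in>tops H. sum w (M \<inter> E (2 * \<alpha>)))"
    using E2 by (simp add: sum_tops_masses[OF Hc] Int_absorb1)
  also have "\<dots> = (\<Sum>M\<in>tops H. \<alpha> * sum w (M \<inter> E (2 * \<alpha>)))" by (simp add: sum_distrib_left)
  also have "\<dots> \<le> (\<Sum>M\<in>tops H. \<eta> * \<alpha> * sum w M +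
     ?c * (1 / \<eta>) powr (1 - 1 / p) * (?G M powr (1 / p) * sum w (M \<inter> E (2 * \<alpha>)) powr (1 - 1 / p)))"
    by (intro sum_mono step)
  also have "\<dots> = \<eta> * \<alpha> * (\<Sum>M\<in>tops H. sum w M) + ?c * (1 / \<eta>) powr (1 - 1 / p) *
     (\<Sum>M\<in>tops H. ?G M powr (1 / p) * sum w (M \<inter> E (2 * \<alpha>)) powr (1 - 1 / p))"
    by (simp only: sum.distrib sum_distrib_left)
  also have "\<dots> \<le> \<eta> * \<alpha> * sum w (E \<alpha>) + ?c * (1 / \<eta>) powr (1 - 1 / p) *
     (?G X powr (1 / p) * sum w (E (2 * \<alpha>)) powr (1 - 1 / p))"
  proof (intro add_mono mult_left_mono)
    show "(\<Sum>M\<in>tops H. sum w M) \<le> sum w (E \<alpha>)" by (simp only: sum_tops_masses'[OF Hc] E)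
    have "(\<Sum>M\<in>tops H. ?G M powr (1 / p) * sum w (M \<inter> E (2 * \<alpha>)) powr (1 - 1 / p)) \<le>
       (\<Sum>M\<in>tops H. ?G M) powr (1 / p) * (\<Sum>M\<in>tops H. sum w (M \<inter> E (2 * \<alpha>))) powr (1 - 1 / p)"
      using p Mc cells_sub by (intro Holder_sum_theta fH) (auto intro!: Gnn wnn)
    also have "(\<Sum>M\<in>tops H. sum w (M \<inter> E (2 * \<alpha>))) = sum w (E (2 * \<alpha>))"
      using E2 by (simp add: sum_tops_masses[OF Hc] Int_absorb1)
    also have "(\<Sum>M\<in>tops H. ?G M) = ?G (\<Union>H)" by (rule sum_tops_masses'[OF Hc])
    also have "?G (\<Union>H) powr (1 / p) * sum w (E (2 * \<alpha>)) powr (1 - 1 / p) \<le>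
        ?G X powr (1 / p) * sum w (E (2 * \<alpha>)) powr (1 - 1 / p)"
    proof (intro mult_right_mono powr_mono2)
      have "\<Union>H \<subseteq> X" using Hc cells_sub by auto
      then show "0 \<le> ?G (\<Union>H)" "?G (\<Union>H) \<le> ?G X"
        using \<sigma>_pos fin by (auto intro!: Gnn sum_mono2 mult_nonneg_nonneg intro: less_imp_le)
    qed (use p in auto)
    finally show "(\<Sum>M\<in>tops H. ?G M powr (1 / p) * sum w (M \<inter> E (2 * \<alpha>)) powr (1 - 1 / p)) \<le>
        ?G X powr (1 / p) * sum w (E (2 * \<alpha>)) powr (1 - 1 / p)" .
  qed (use c0 \<alpha> \<eta> in \<open>auto intro: mult_nonneg_nonneg[OF less_imp_le[OF c0]]\<close>)
  finally show ?thesis by (simp add: mult.assoc)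
qed

text \<open>
  With \<open>\<eta> = 2^(-p-1)\<close> the first term of the good-\<open>\<lambda>\<close> inequality is half of the supremum \<open>N\<close> over all
  heights and can be absorbed, as \<open>N\<close> is finite on a finite tree.
\<close>

theorem sparse_weak:
  assumes p2: "p < 2" and S: "sparse \<mu> S" and F: "\<forall>x\<in>X. 0 \<le> F x" and \<alpha>: "0 < \<alpha>"
  shows "\<alpha> powr p * sum w {x \<in> X. \<alpha> < sparse_op \<mu> S F x} \<le>
    (weak_const p * K) powr p * (\<Sum>x\<in>X. (F x * \<mu> x) powr p * \<sigma> x powr (1 - p))"
proof (cases "X = {}")
  case False
  have Sc: "S \<subseteq> cells" using S by (simp add: sparse_def)
  define E where "E = (\<lambda>\<alpha>. {x \<in> X. \<alpha> < sparse_op \<mu> S F x})"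
  define G where "G = (\<Sum>x\<in>X. (F x * \<mu> x / \<sigma> x) powr p * \<sigma> x)"
  define \<phi> where "\<phi> \<alpha> = \<alpha> powr p * sum w (E \<alpha>)" for \<alpha>
  define N where "N = (SUP \<alpha>\<in>{0<..}. \<phi> \<alpha>)"
  define \<eta> :: real where "\<eta> = 1 / 2 powr (p + 1)"
  define B where "B = testing_const p * K * (1 / \<eta>) powr (1 - 1 / p)"
  have K: "0 < K" using False K_pos by (auto simp: cells_def)
  have B: "0 < B" using K testing_const_pos[OF p] by (simp add: B_def \<eta>_def)
  have wnn: "0 \<le> sum w (E \<alpha>)" for \<alpha>
    using w_pos by (intro sum_nonneg) (auto simp: E_def intro: less_imp_le)
  have G: "0 \<le> G" unfolding G_def using \<sigma>_pos by (intro sum_nonneg mult_nonneg_nonneg) (auto intro: less_imp_le)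
  define m where "m = (\<Sum>x\<in>X. sparse_op \<mu> S F x)"
  have Ann: "0 \<le> sparse_op \<mu> S F x" for x by (rule sparse_op_nonneg[OF \<mu>_pos F Sc])
  have m: "sparse_op \<mu> S F x \<le> m" if "x \<in> X" for x
    unfolding m_def using that fin Ann by (intro member_le_sum) auto
  have bdd: "bdd_above (\<phi> ` {0<..})"
  proof (rule bdd_aboveI2)
    fix \<alpha> :: real assume "\<alpha> \<in> {0<..}"
    then have \<alpha>: "0 < \<alpha>" by simp
    show "\<phi> \<alpha> \<le> m powr p * sum w X"
    proof (cases "E \<alpha> = {}")
      case True
      then show ?thesis using w_pos by (auto simp: \<phi>_def intro!: mult_nonneg_nonneg sum_nonneg intro: less_imp_le)
    next
      case False
      then obtain x where "x \<in> X" "\<alpha> < sparse_op \<mu> S F x" by (auto simp: E_def)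
      then have "\<alpha> \<le> m" using m[of x] by simp
      moreover have "sum w (E \<alpha>) \<le> sum w X"
        using fin w_pos by (intro sum_mono2) (auto simp: E_def intro: less_imp_le)
      ultimately show ?thesis
        unfolding \<phi>_def using \<alpha> p wnn by (intro mult_mono powr_mono2) auto
    qed
  qed
  have \<phi>N: "\<phi> \<alpha> \<le> N" if "0 < \<alpha>" for \<alpha> unfolding N_def using that bdd by (intro cSUP_upper) auto
  have \<phi>0: "0 \<le> \<phi> \<alpha>" for \<alpha> using wnn by (simp add: \<phi>_def)
  have N0: "0 \<le> N" using \<phi>N[of 1] \<phi>0[of 1] by simp
  have half: "\<phi> \<beta> \<le> N / 2 + 2 powr p * B * G powr (1 / p) * N powr (1 - 1 / p)" if \<beta>: "0 < \<beta>" for \<beta>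
  proof -
    define \<alpha> where "\<alpha> = \<beta> / 2"
    have \<alpha>: "0 < \<alpha>" "\<beta> = 2 * \<alpha>" using \<beta> by (auto simp: \<alpha>_def)
    have gl: "\<alpha> * sum w (E (2 * \<alpha>)) \<le> \<eta> * \<alpha> * sum w (E \<alpha>) +
        B * G powr (1 / p) * sum w (E (2 * \<alpha>)) powr (1 - 1 / p)"
      using good_lambda[OF p2 S F \<alpha>(1) _ False, of \<eta>] by (simp add: E_def B_def G_def \<eta>_def)
    have ap: "\<alpha> powr p = \<alpha> powr (p - 1) * \<alpha>" using \<alpha>(1) by (simp add: powr_mult_base mult.commute)
    have "\<phi> \<beta> = 2 powr p * (\<alpha> powr (p - 1) * (\<alpha> * sum w (E (2 * \<alpha>))))"
      using \<alpha>(1) by (simp add: \<phi>_def \<alpha>(2) powr_mult ap ac_simps)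
    also have "\<dots> \<le> 2 powr p * (\<alpha> powr (p - 1) * (\<eta> * \<alpha> * sum w (E \<alpha>) +
        B * G powr (1 / p) * sum w (E (2 * \<alpha>)) powr (1 - 1 / p)))"
      by (intro mult_left_mono gl) auto
    also have "\<dots> = 2 powr p * \<eta> * \<phi> \<alpha> + 2 powr p * B * G powr (1 / p) *
        (\<alpha> powr (p - 1) * sum w (E (2 * \<alpha>)) powr (1 - 1 / p))"
      by (simp add: \<phi>_def ap algebra_simps)
    also have "2 powr p * \<eta> = 1 / 2" by (simp add: \<eta>_def powr_add)
    also have "\<alpha> powr (p - 1) * sum w (E (2 * \<alpha>)) powr (1 - 1 / p) \<le> N powr (1 - 1 / p)"
    proof -
      have e: "p - 1 = p * (1 - 1 / p)" using p by (simp add: field_simps)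
      have "\<alpha> powr (p - 1) \<le> \<beta> powr (p - 1)" using \<alpha> p by (intro powr_mono2) auto
      then have "\<alpha> powr (p - 1) * sum w (E (2 * \<alpha>)) powr (1 - 1 / p) \<le>
          \<beta> powr (p - 1) * sum w (E (2 * \<alpha>)) powr (1 - 1 / p)" by (intro mult_right_mono) auto
      also have "\<dots> = \<phi> \<beta> powr (1 - 1 / p)"
        using \<beta> wnn by (simp add: \<phi>_def powr_mult powr_powr \<alpha>(2)[symmetric] e[symmetric])
      also have "\<dots> \<le> N powr (1 - 1 / p)" using p \<phi>N[OF \<beta>] \<phi>0 by (intro powr_mono2) auto
      finally show ?thesis .
    qed
    finally show ?thesis using \<phi>N[OF \<alpha>(1)] B by (simp add: mult_left_mono)
  qed
  have "N \<le> N / 2 + 2 powr p * B * G powr (1 / p) * N powr (1 - 1 / p)"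
    unfolding N_def by (rule cSUP_least) (use half in \<open>auto simp: N_def\<close>)
  then have "N \<le> (2 powr (p + 1) * B) * G powr (1 / p) * N powr (1 - 1 / p)"
    by (simp add: powr_add)
  then have "N \<le> (2 powr (p + 1) * B) powr p * G"
    using B p G N0 by (intro absorb_powr) auto
  also have "2 powr (p + 1) * B = weak_const p * K"
    by (simp add: weak_const_def B_def \<eta>_def ac_simps)
  also have "G = (\<Sum>x\<in>X. (F x * \<mu> x) powr p * \<sigma> x powr (1 - p))"
    unfolding G_def
  proof (intro sum.cong refl)
    fix x assume x: "x \<in> X"
    have "(F x * \<mu> x / \<sigma> x) powr p * \<sigma> x = (F x * \<mu> x) powr p * (\<sigma> x / \<sigma> x powr p)"
      using F x \<mu>_pos \<sigma>_pos by (simp add: powr_divide)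
    also have "\<sigma> x / \<sigma> x powr p = \<sigma> x powr (1 - p)" using \<sigma>_pos[rule_format, OF x] by (simp add: powr_diff)
    finally show "(F x * \<mu> x / \<sigma> x) powr p * \<sigma> x = (F x * \<mu> x) powr p * \<sigma> x powr (1 - p)" .
  qed
  finally show ?thesis using \<phi>N[OF \<alpha>] by (simp add: \<phi>_def E_def)
qed simp

end

section \<open>Sparse domination of Haar shifts on a finite tree\<close>

text \<open>
  The constant of the stopping argument for a doubling constant \<open>D\<close> and an operator norm \<open>B0 * \<kappa>\<close>:
  it is \<open>3 * \<Lambda> + 8\<close> with the threshold \<open>\<Lambda> = 32 + 64 * B0 * D\<close> used there.
\<close>

definition dom_const :: "real \<Rightarrow> real \<Rightarrow> real" where
  "dom_const D B0 = 104 + 192 * B0 * D"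

text \<open>
  A sequence of Haar shifts on a finite tree, of which the first \<open>J\<close> enter the norm, with the
  functions of generation \<open>l\<close> combined into functions \<open>h j l\<close> and \<open>k j l\<close> on the whole tree. By
  \<open>h_top\<close> only those generations act on which the functions are constant on cells of the tree.
\<close>

locale shift_tree = tree X c L for X :: "'x set" and c L +
  fixes \<mu> :: "'x \<Rightarrow> real" and D :: real and \<kappa> J :: nat and r :: real
    and h k :: "nat \<Rightarrow> nat \<Rightarrow> 'x \<Rightarrow> real"
  assumes \<mu>_pos: "\<forall>x\<in>X. 0 < \<mu> x"
    and D: "1 \<le> D" and doubling: "x \<in> X \<Longrightarrow> sum \<mu> (c l x) \<le> D * sum \<mu> (c (Suc l) x)"
    and \<kappa>: "1 \<le> \<kappa>" and r: "1 < r"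
    and kernel: "x \<in> X \<Longrightarrow> y \<in> c l x \<Longrightarrow> \<bar>h j l x * k j l y\<bar> \<le> 1 / sum \<mu> (c l x)"
    and h_const: "x \<in> X \<Longrightarrow> y \<in> c (l + \<kappa>) x \<Longrightarrow> h j l y = h j l x"
    and k_const: "x \<in> X \<Longrightarrow> y \<in> c (l + \<kappa>) x \<Longrightarrow> k j l y = k j l x"
    and h_top: "L < l + \<kappa> \<Longrightarrow> h j l x = 0"
begin

definition piece :: "nat \<Rightarrow> (nat \<Rightarrow> 'x \<Rightarrow> real) \<Rightarrow> 'x \<Rightarrow> nat \<Rightarrow> real" where
  "piece l f x j = h j l x * (\<Sum>y\<in>c l x. k j l y * f j y * \<mu> y)"

text \<open>
  The sum over the generations from \<open>a\<close> on. On a cell of generation \<open>a\<close> it only depends on the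
  values in that cell, so it is the shift localised to all these cells simultaneously.
\<close>

definition tail :: "nat \<Rightarrow> (nat \<Rightarrow> 'x \<Rightarrow> real) \<Rightarrow> 'x \<Rightarrow> nat \<Rightarrow> real" where
  "tail a f x j = (\<Sum>l\<in>{a..<L}. piece l f x j)"

abbreviation nm :: "(nat \<Rightarrow> real) \<Rightarrow> real" where "nm \<equiv> lr J r"

definition size_of :: "(nat \<Rightarrow> 'x \<Rightarrow> real) \<Rightarrow> 'x \<Rightarrow> real" where
  "size_of f x = nm (\<lambda>j. f j x)"

definition tail_bounded :: "real \<Rightarrow> real \<Rightarrow> bool" where
  "tail_bounded q B \<longleftrightarrow> (\<forall>a f. (\<Sum>x\<in>X. nm (tail a f x) powr q * \<mu> x) \<le>
      B powr q * (\<Sum>x\<in>X. size_of f x powr q * \<mu> x))"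

lemma size_nonneg [simp]: "0 \<le> size_of f x"
  by (simp add: size_of_def)

lemma mass_nonneg: "A \<subseteq> X \<Longrightarrow> 0 \<le> sum \<mu> A"
  using \<mu>_pos by (intro sum_nonneg) (auto intro: less_imp_le)

lemma mass_pos: "x \<in> X \<Longrightarrow> 0 < sum \<mu> (c l x)"
  by (rule sum_cell_pos[OF \<mu>_pos c_cells])

text \<open>
  The size condition on the kernel. The subset \<open>Y\<close> is needed where cancellation removes part of the
  cell.
\<close>

lemma partial_piece_le:
  assumes x: "x \<in> X" and Y: "Y \<subseteq> c l x"
  shows "nm (\<lambda>j. h j l x * (\<Sum>y\<in>Y. k j l y * f j y * \<mu> y)) \<le> (\<Sum>y\<in>Y. size_of f y * \<mu> y) / sum \<mu> (c l x)"
proof -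
  have fY: "finite Y" by (rule finite_subset[OF Y cells_fin[OF c_cells[OF x]]])
  let ?m = "sum \<mu> (c l x)"
  have m: "0 < ?m" by (rule mass_pos[OF x])
  have "nm (\<lambda>j. h j l x * (\<Sum>y\<in>Y. k j l y * f j y * \<mu> y)) =
      nm (\<lambda>j. \<Sum>y\<in>Y. (h j l x * k j l y) * f j y * \<mu> y)"
    by (simp add: sum_distrib_left mult.assoc)
  also have "\<dots> \<le> (\<Sum>y\<in>Y. nm (\<lambda>j. (h j l x * k j l y) * f j y * \<mu> y))"
    by (rule lr_sum[OF r fY])
  also have "\<dots> \<le> (\<Sum>y\<in>Y. nm (\<lambda>j. (\<mu> y / ?m) * f j y))"
  proof (intro sum_mono lr_mono r)
    fix y j assume y: "y \<in> Y"
    then have "0 < \<mu> y" using Y c_sub[OF x] \<mu>_pos by blast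
    have "\<bar>(h j l x * k j l y) * f j y * \<mu> y\<bar> = \<bar>h j l x * k j l y\<bar> * (\<bar>f j y\<bar> * \<mu> y)"
      using \<open>0 < \<mu> y\<close> by (simp add: abs_mult)
    also have "\<dots> \<le> 1 / ?m * (\<bar>f j y\<bar> * \<mu> y)"
      using kernel[OF x, of y l j] y Y \<open>0 < \<mu> y\<close> by (intro mult_right_mono) auto
    finally show "\<bar>(h j l x * k j l y) * f j y * \<mu> y\<bar> \<le> \<bar>(\<mu> y / ?m) * f j y\<bar>"
      using \<open>0 < \<mu> y\<close> m by (simp add: abs_mult mult.commute)
  qed
  also have "\<dots> = (\<Sum>y\<in>Y. size_of f y * \<mu> y / ?m)"
  proof (intro sum.cong refl)
    fix y assume "y \<in> Y"
    then have "0 < \<mu> y" using Y c_sub[OF x] \<mu>_pos by blast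
    then show "nm (\<lambda>j. (\<mu> y / ?m) * f j y) = size_of f y * \<mu> y / ?m"
      using m by (subst lr_scale[OF r]) (simp add: size_of_def)
  qed
  finally show ?thesis by (simp add: sum_divide_distrib)
qed

lemma piece_le: "x \<in> X \<Longrightarrow> nm (piece l f x) \<le> avg \<mu> (size_of f) (c l x)"
  using partial_piece_le[of x "c l x" l f] by (simp add: piece_def[abs_def] avg_def)

lemma avg_size_nonneg: "x \<in> X \<Longrightarrow> 0 \<le> avg \<mu> (size_of f) (c l x)"
  using avg_nonneg[OF \<mu>_pos _ c_sub[of x l], of "size_of f"] by simp

lemma piece_cong: "x \<in> X \<Longrightarrow> (\<And>y j. y \<in> c l x \<Longrightarrow> f j y = g j y) \<Longrightarrow> piece l f x = piece l g x"
  by (auto simp: piece_def fun_eq_iff intro!: sum.cong arg_cong2[of _ _ _ _ "(*)"])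

lemma tail_cong:
  assumes "x \<in> X" "\<And>y j. y \<in> c a x \<Longrightarrow> f j y = g j y" shows "tail a f x = tail a g x"
  unfolding tail_def
proof (intro ext sum.cong refl)
  fix j l assume "l \<in> {a..<L}"
  then have "c l x \<subseteq> c a x" using c_antimono[OF assms(1), of a l] by auto
  then have "piece l f x = piece l g x" using assms(2) by (intro piece_cong[OF assms(1)]) blast
  then show "piece l f x j = piece l g x j" by simp
qed

lemma piece_const:
  assumes "x \<in> X" "y \<in> c (l + \<kappa>) x" shows "piece l f y = piece l f x"
proof -
  have "y \<in> c l x" using c_antimono[OF assms(1), of l "l + \<kappa>"] assms(2) by auto
  then have "c l y = c l x" using c_eq[OF assms(1)] by blast
  moreover have "h j l y = h j l x" for j using h_const[OF assms] .
  ultimately show ?thesis by (simp add: piece_def fun_eq_iff)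
qed

lemma piece_linear: "piece l (\<lambda>j y. f j y + g j y) x j = piece l f x j + piece l g x j"
  by (simp add: piece_def algebra_simps sum.distrib)

lemma nm_sum_pieces: "x \<in> X \<Longrightarrow> finite I \<Longrightarrow>
   nm (\<lambda>j. \<Sum>l\<in>I. piece l f x j) \<le> (\<Sum>l\<in>I. avg \<mu> (size_of f) (c l x))"
  by (rule order_trans[OF lr_sum[OF r] sum_mono]) (auto intro: piece_le)

text \<open>
  Chebyshev's inequality for a bounded function, localised to a set that is a union of cells of
  generation \<open>t\<close>.
\<close>

lemma tail_local_weak:
  assumes tb: "tail_bounded q B" and q: "1 \<le> q" and Y: "Y \<subseteq> X" and cl: "\<And>x. x \<in> Y \<Longrightarrow> c t x \<subseteq> Y"
    and g: "\<And>x. x \<in> Y \<Longrightarrow> size_of g x \<le> G" and \<delta>: "0 < \<delta>" and BG: "0 \<le> B" "B * G \<le> \<delta> / 16" "0 \<le> G"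
  shows "sum \<mu> {x \<in> Y. \<delta> < nm (tail t g x)} \<le> sum \<mu> Y / 16"
proof -
  let ?g = "\<lambda>j x. if x \<in> Y then g j x else 0"
  let ?W = "{x \<in> Y. \<delta> < nm (tail t g x)}"
  have mu: "0 \<le> \<mu> x" if "x \<in> X" for x using that \<mu>_pos less_imp_le by blast
  have "\<delta> powr q * sum \<mu> ?W = (\<Sum>x\<in>?W. \<delta> powr q * \<mu> x)" by (simp add: sum_distrib_left)
  also have "\<dots> \<le> (\<Sum>x\<in>?W. nm (tail t ?g x) powr q * \<mu> x)"
  proof (intro sum_mono mult_right_mono powr_mono2)
    fix x assume x: "x \<in> ?W"
    then have "tail t ?g x = tail t g x" using cl Y by (intro tail_cong) auto
    then show "\<delta> \<le> nm (tail t ?g x)" using x by simp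
    show "0 \<le> \<mu> x" using x Y mu by auto
  qed (use \<delta> q in auto)
  also have "\<dots> \<le> (\<Sum>x\<in>X. nm (tail t ?g x) powr q * \<mu> x)"
    using Y fin mu by (intro sum_mono2) auto
  also have "\<dots> \<le> B powr q * (\<Sum>x\<in>X. size_of ?g x powr q * \<mu> x)"
    using tb by (simp add: tail_bounded_def)
  also have "\<dots> \<le> B powr q * (G powr q * sum \<mu> Y)"
  proof (intro mult_left_mono)
    have "(\<Sum>x\<in>X. size_of ?g x powr q * \<mu> x) = (\<Sum>x\<in>Y. size_of g x powr q * \<mu> x)"
      using Y fin q by (intro sum.mono_neutral_cong_right) (auto simp: size_of_def lr_zero)
    also have "\<dots> \<le> (\<Sum>x\<in>Y. G powr q * \<mu> x)"
      using g q mu Y by (intro sum_mono mult_right_mono powr_mono2) auto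
    finally show "(\<Sum>x\<in>X. size_of ?g x powr q * \<mu> x) \<le> G powr q * sum \<mu> Y"
      by (simp add: sum_distrib_left)
  qed simp
  also have "B powr q * (G powr q * sum \<mu> Y) = (B * G) powr q * sum \<mu> Y"
    using BG by (simp add: powr_mult)
  also have "\<dots> \<le> (\<delta> / 16) powr q * sum \<mu> Y"
    using BG q mass_nonneg[OF Y] by (intro mult_right_mono powr_mono2) auto
  also have "\<dots> = \<delta> powr q * ((1 / 16) powr q * sum \<mu> Y)"
    using \<delta> by (simp add: powr_divide)
  also have "\<dots> \<le> \<delta> powr q * (sum \<mu> Y / 16)"
  proof (intro mult_left_mono)
    have "(1 / 16 :: real) powr q \<le> (1 / 16) powr 1" using q by (intro powr_mono') auto
    then show "(1 / 16) powr q * sum \<mu> Y \<le> sum \<mu> Y / 16"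
      using mult_right_mono[OF _ mass_nonneg[OF Y], of "(1/16) powr q" "1/16"] by simp
  qed auto
  finally show ?thesis using \<delta> by simp
qed

text \<open>
  One step of the iteration inside \<open>Q = c l0 x0\<close>: \<open>\<Omega>\<close> is the union of the stopped cells and
  \<open>\<tau> x\<close> the generation at which the cell of \<open>x\<close> is stopped. Stopping on \<open>a l x\<close>, the sum of the
  pieces that are constant on \<open>c l x\<close>, replaces a maximal truncation. On a stopped cell it differs
  from the sum \<open>T f\<close> of all pieces above that cell by fewer than \<open>\<kappa>\<close> pieces, each of which is at
  most an average over a cell that was not stopped.
\<close>

lemma stopping_step:
  assumes tb: "tail_bounded q (B0 * real \<kappa>)" and q: "1 \<le> q" and B0: "0 \<le> B0" and x0: "x0 \<in> X"
  shows "\<exists>\<Omega> \<tau>. \<Omega> \<subseteq> c l0 x0 \<and> sum \<mu> \<Omega> \<le> sum \<mu> (c l0 x0) / 2 \<and>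
    (\<forall>x\<in>\<Omega>. c (\<tau> x) x \<subseteq> \<Omega> \<and> (\<forall>y\<in>c (\<tau> x) x. \<tau> y = \<tau> x)) \<and>
    (\<forall>x\<in>\<Omega>. nm (tail l0 f x) \<le>
       dom_const D B0 * real \<kappa> * avg \<mu> (size_of f) (c l0 x0) + nm (tail (\<tau> x) f x)) \<and>
    (\<forall>x\<in>c l0 x0 - \<Omega>. nm (tail l0 f x) \<le> dom_const D B0 * real \<kappa> * avg \<mu> (size_of f) (c l0 x0))"
proof -
  define Q where "Q = c l0 x0"
  define m where "m = avg \<mu> (size_of f) Q"
  have QX: "Q \<subseteq> X" and fQ: "finite Q" and Qpos: "0 < sum \<mu> Q"
    using c_sub[OF x0] cells_fin[OF c_cells[OF x0]] mass_pos[OF x0] by (auto simp: Q_def)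
  have m0: "0 \<le> m" using avg_size_nonneg[OF x0] by (simp add: m_def Q_def)
  have mu: "0 \<le> \<mu> x" if "x \<in> X" for x using that \<mu>_pos less_imp_le by blast
  have cQ: "c l x \<subseteq> Q" if "x \<in> Q" "l0 \<le> l" for x l
    using c_antimono[of x l0 l] that QX c_eq[OF x0, of x l0] by (auto simp: Q_def)
  have cQ0: "c l0 x = Q" if "x \<in> Q" for x using c_eq[OF x0, of x l0] that by (simp add: Q_def)
  show ?thesis
  proof (cases "m = 0")
    case True
    have "avg \<mu> (size_of f) (c l x) = 0" if x: "x \<in> Q" "l0 \<le> l" for x l
    proof -
      have "(\<Sum>y\<in>Q. size_of f y * \<mu> y) = 0" using True Qpos by (simp add: m_def avg_def)
      then have "\<forall>y\<in>Q. size_of f y * \<mu> y = 0"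
        using fQ QX mu by (subst (asm) sum_nonneg_eq_0_iff) auto
      then have "(\<Sum>y\<in>c l x. size_of f y * \<mu> y) = 0" using cQ[OF x] by (intro sum.neutral) auto
      then show ?thesis by (simp add: avg_def)
    qed
    then have "nm (tail l0 f x) \<le> 0" if "x \<in> Q" for x
      using nm_sum_pieces[of x "{l0..<L}" f] that QX by (auto simp: tail_def[abs_def])
    then show ?thesis using True by (intro exI[of _ "{}"]) (auto simp: Q_def[symmetric] m_def[symmetric] sum_nonneg less_imp_le[OF Qpos])
  next
    case False
    then have m: "0 < m" using m0 by simp
    \<comment> \<open>Thresholds: \<open>\<Lambda> \<ge> 32\<close> serves the bad part, \<open>\<Lambda> \<ge> 64 * B0 * D\<close> the good part, and
      \<open>A'\<close> leaves \<open>3 * \<delta>\<close> for the three parts of \<open>T f\<close> after the error of \<open>4 * \<kappa> * m\<close>.\<close>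
    define \<Lambda> where "\<Lambda> = 32 + 64 * B0 * D"
    define A' where "A' = 3 * \<Lambda> + 4"
    define \<delta> where "\<delta> = \<Lambda> * real \<kappa> * m"
    have \<Lambda>: "32 \<le> \<Lambda>" using B0 D by (simp add: \<Lambda>_def)
    have \<kappa>0: "1 \<le> real \<kappa>" using \<kappa> by simp
    have \<delta>: "0 < \<delta>" using \<Lambda> \<kappa>0 m by (simp add: \<delta>_def)
    have A': "0 \<le> A'" using \<Lambda> by (simp add: A'_def)
    let ?F = "size_of f"
    define a where "a l x j = (\<Sum>l'\<in>{l'. l0 \<le> l' \<and> l' + \<kappa> \<le> l}. piece l' f x j)" for l x j
    have fin_a: "finite {l'. l0 \<le> l' \<and> l' + \<kappa> \<le> l}" for l
      by (rule finite_subset[of _ "{..l}"]) auto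
    define stop where "stop l x \<longleftrightarrow> l0 < l \<and> l \<le> L \<and>
      (4 * m < avg \<mu> ?F (c l x) \<or> A' * real \<kappa> * m < nm (a l x))" for l x
    define P where "P l x \<longleftrightarrow> stop l x \<or> (L \<le> l \<and> l0 \<le> l)" for l x
    define \<tau> where "\<tau> x = (LEAST l. P l x)" for x
    define C where "C x = c (\<tau> x) x" for x
    define \<Omega> where "\<Omega> = {x \<in> Q. stop (\<tau> x) x}"
    have a_const: "a l y = a l x" if "x \<in> X" "y \<in> c l x" for l x y
    proof (rule ext)
      fix j
      show "a l y j = a l x j" unfolding a_def
      proof (intro sum.cong refl)
        fix l' assume "l' \<in> {l'. l0 \<le> l' \<and> l' + \<kappa> \<le> l}"
        then have "y \<in> c (l' + \<kappa>) x" using that c_antimono[OF that(1), of "l' + \<kappa>" l] by auto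
        then show "piece l' f y j = piece l' f x j" using piece_const[OF that(1)] by simp
      qed
    qed
    have P_const: "P l y = P l x" if "x \<in> X" "y \<in> c l x" for l x y
      using a_const[OF that] c_eq[OF that] by (simp add: P_def stop_def)
    have P_ex: "P (max L l0) x" for x by (simp add: P_def)
    have P\<tau>: "P (\<tau> x) x" for x unfolding \<tau>_def by (rule LeastI[of "\<lambda>l. P l x", OF P_ex])
    have not_P: "\<not> P l x" if "l < \<tau> x" for l x using that not_less_Least by (auto simp: \<tau>_def)
    have \<tau>_ge: "l0 \<le> \<tau> x" for x using P\<tau>[of x] by (auto simp: P_def stop_def)
    have \<tau>_const: "\<tau> y = \<tau> x" if x: "x \<in> X" and y: "y \<in> C x" for x y
    proof -
      have PP: "P l y = P l x" if "l \<le> \<tau> x" for l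
      proof -
        have "y \<in> c l x" using c_antimono[OF x that] y by (auto simp: C_def)
        then show ?thesis by (rule P_const[OF x])
      qed
      show ?thesis
        unfolding \<tau>_def[of y]
      proof (rule Least_equality)
        show "P (\<tau> x) y" using PP[of "\<tau> x"] P\<tau>[of x] by simp
        show "\<tau> x \<le> l" if "P l y" for l using PP[of l] not_P[of l x] that by (cases "l < \<tau> x") auto
      qed
    qed
    have C_self: "x \<in> C x" if "x \<in> X" for x using c_self[OF that] by (simp add: C_def)
    have C_sub: "C x \<subseteq> Q" if "x \<in> Q" for x using cQ[OF that \<tau>_ge] by (simp add: C_def)
    have C_eq: "C y = C x" if "x \<in> X" "y \<in> C x" for x y
      using \<tau>_const[OF that] c_eq[OF that(1), of y "\<tau> x"] that(2) by (simp add: C_def)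
    have \<Omega>Q: "\<Omega> \<subseteq> Q" by (auto simp: \<Omega>_def)
    have \<Omega>X: "\<Omega> \<subseteq> X" using \<Omega>Q QX by auto
    have \<tau>\<Omega>: "l0 < \<tau> x" "\<tau> x \<le> L" if "x \<in> \<Omega>" for x using that by (auto simp: \<Omega>_def stop_def)
    have off\<Omega>: "C x = {x}" if "x \<in> Q" "x \<notin> \<Omega>" for x
    proof -
      have "L \<le> \<tau> x" using P\<tau>[of x] that by (auto simp: P_def \<Omega>_def)
      then show ?thesis unfolding C_def using that QX by (intro c_beyond) auto
    qed
    \<comment> \<open>Before stopping, the averages and the accumulated operator are under control.\<close>
    have before: "avg \<mu> ?F (c l x) \<le> 4 * m" "nm (a l x) \<le> A' * real \<kappa> * m"
      if x: "x \<in> Q" and l: "l0 \<le> l" "l < \<tau> x" for x l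
    proof -
      have "\<not> P l x" using not_P l by simp
      then have ns: "\<not> stop l x" and lL: "l < L" using l by (auto simp: P_def)
      show "avg \<mu> ?F (c l x) \<le> 4 * m"
        using ns lL l m cQ0[OF x] by (cases "l = l0") (auto simp: stop_def m_def)
      have "a l0 x = (\<lambda>j. 0)" using \<kappa> by (auto simp: a_def fun_eq_iff intro!: sum.neutral)
      then have "nm (a l0 x) \<le> A' * real \<kappa> * m" using A' m by (simp add: lr_zero)
      then show "nm (a l x) \<le> A' * real \<kappa> * m"
        using ns lL l by (cases "l = l0") (auto simp: stop_def)
    qed
    define T where "T u x j = (\<Sum>l\<in>{l0..<\<tau> x}. piece l u x j)" for u x j
    have split: "tail l0 u x j = T u x j + tail (\<tau> x) u x j" if "x \<in> \<Omega>" for u x j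
      unfolding tail_def T_def
      using \<tau>\<Omega>[OF that] by (simp add: sum.atLeastLessThan_concat)
    have extra: "nm (\<lambda>j. \<Sum>l\<in>I. piece l f x j) \<le> real \<kappa> * (4 * m)"
      if x: "x \<in> Q" and I: "I \<subseteq> {l0..<\<tau> x}" "I \<subseteq> {t..<t + \<kappa>}" for x I t
    proof -
      have fI: "finite I" using I finite_subset by blast
      have "nm (\<lambda>j. \<Sum>l\<in>I. piece l f x j) \<le> (\<Sum>l\<in>I. avg \<mu> ?F (c l x))"
        using x QX by (intro nm_sum_pieces fI) auto
      also have "\<dots> \<le> (\<Sum>l\<in>I. 4 * m)" using I x by (intro sum_mono before) auto
      also have "\<dots> = real (card I) * (4 * m)" by simp
      also have "\<dots> \<le> real \<kappa> * (4 * m)"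
        using card_mono[OF _ I(2)] m by (intro mult_right_mono) auto
      finally show ?thesis .
    qed
    have T_upper: "nm (T f x) \<le> (A' + 4) * real \<kappa> * m" if x: "x \<in> \<Omega>" for x
    proof -
      have xQ: "x \<in> Q" using x \<Omega>Q by auto
      obtain t where t: "\<tau> x = Suc t" "l0 \<le> t" using \<tau>\<Omega>(1)[OF x] by (cases "\<tau> x") auto
      let ?I = "{l. l0 \<le> l \<and> l < \<tau> x \<and> t < l + \<kappa>}"
      have "{l0..<\<tau> x} = {l'. l0 \<le> l' \<and> l' + \<kappa> \<le> t} \<union> ?I" using t \<kappa> by auto
      then have "T f x j = a t x j + (\<Sum>l\<in>?I. piece l f x j)" for j
        unfolding T_def a_def using fin_a[of t]
        by (subst sum.union_disjoint[symmetric]) auto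
      then have "nm (T f x) \<le> nm (a t x) + nm (\<lambda>j. \<Sum>l\<in>?I. piece l f x j)"
        using lr_triangle[OF r, of J "a t x" "\<lambda>j. \<Sum>l\<in>?I. piece l f x j"] by presburger
      also have "\<dots> \<le> A' * real \<kappa> * m + real \<kappa> * (4 * m)"
        using t by (intro add_mono before(2) extra[of _ _ "Suc t - \<kappa>"] xQ) auto
      finally show ?thesis by (simp add: algebra_simps)
    qed
    have T_lower: "nm (a (\<tau> x) x) \<le> nm (T f x) + real \<kappa> * (4 * m)" if x: "x \<in> \<Omega>" for x
    proof -
      have xQ: "x \<in> Q" using x \<Omega>Q by auto
      let ?I = "{l. l0 \<le> l \<and> l < \<tau> x \<and> \<tau> x < l + \<kappa>}"
      have "{l0..<\<tau> x} = {l'. l0 \<le> l' \<and> l' + \<kappa> \<le> \<tau> x} \<union> ?I" using \<kappa> by auto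
      then have "T f x j = a (\<tau> x) x j + (\<Sum>l\<in>?I. piece l f x j)" for j
        unfolding T_def a_def using fin_a[of "\<tau> x"]
        by (subst sum.union_disjoint[symmetric]) auto
      then have "a (\<tau> x) x = (\<lambda>j. T f x j + - (\<Sum>l\<in>?I. piece l f x j))" by auto
      then have "nm (a (\<tau> x) x) \<le> nm (T f x) + nm (\<lambda>j. - (\<Sum>l\<in>?I. piece l f x j))"
        using lr_triangle[OF r, of J "T f x" "\<lambda>j. - (\<Sum>l\<in>?I. piece l f x j)"] by simp
      also have "\<dots> \<le> nm (T f x) + real \<kappa> * (4 * m)"
        unfolding lr_minus by (intro add_left_mono extra[of _ _ "\<tau> x - \<kappa>"] xQ) auto
      finally show ?thesis .
    qed
    \<comment> \<open>The Calderon-Zygmund decomposition along the stopped cells; the parent of a stopped cell was not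
      stopped, so by doubling the averages \<open>g\<close> are bounded.\<close>
    define g where "g j x = avg \<mu> (f j) (C x)" for j x
    define b where "b j x = f j x - g j x" for j x
    have avgC: "(\<Sum>x\<in>Y. u x * avg \<mu> \<phi> (C x) * \<mu> x) = (\<Sum>x\<in>Y. u x * \<phi> x * \<mu> x)"
      if Y: "Y \<subseteq> X" "\<And>x. x \<in> Y \<Longrightarrow> C x \<subseteq> Y" and u: "\<And>x y. x \<in> Y \<Longrightarrow> y \<in> C x \<Longrightarrow> u y = u x"
      for Y and u \<phi> :: "'x \<Rightarrow> real"
    proof (rule sum_avg_cells[OF finite_subset[OF Y(1) fin]])
      fix x assume "x \<in> Y"
      then have x: "x \<in> X" using Y by auto
      show "0 < \<mu> x" "x \<in> C x" using \<mu>_pos C_self x by auto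
      show "C y = C x" if "y \<in> C x" for y by (rule C_eq[OF x that])
    qed (use Y u in auto)
    have avgF: "(\<Sum>x\<in>Q. avg \<mu> ?F (C x) * \<mu> x) = m * sum \<mu> Q"
      using avgC[OF QX C_sub, of "\<lambda>_. 1" ?F] Qpos by (simp add: m_def avg_def)
    have g_le: "size_of g x \<le> avg \<mu> ?F (C x)" if x: "x \<in> Q" for x
    proof -
      let ?M = "sum \<mu> (C x)"
      have CX: "C x \<subseteq> X" using C_sub[OF x] QX by auto
      have M: "0 < ?M" unfolding C_def using x QX by (intro mass_pos) auto
      have "size_of g x = nm (\<lambda>j. \<Sum>y\<in>C x. (\<mu> y / ?M) * f j y)"
        unfolding size_of_def g_def avg_def by (simp add: sum_divide_distrib mult.commute)
      also have "\<dots> \<le> (\<Sum>y\<in>C x. nm (\<lambda>j. (\<mu> y / ?M) * f j y))"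
        by (rule lr_sum[OF r finite_subset[OF CX fin]])
      also have "\<dots> = (\<Sum>y\<in>C x. ?F y * \<mu> y / ?M)"
      proof (intro sum.cong refl)
        fix y assume "y \<in> C x"
        then have "0 \<le> \<mu> y" using CX mu by auto
        then show "nm (\<lambda>j. (\<mu> y / ?M) * f j y) = ?F y * \<mu> y / ?M"
          using M by (subst lr_scale[OF r]) (simp add: size_of_def)
      qed
      finally show ?thesis by (simp add: avg_def sum_divide_distrib)
    qed
    have g_bdd: "size_of g x \<le> 4 * D * m" if x: "x \<in> Q" for x
    proof (cases "\<tau> x = l0")
      case True
      then have "size_of g x \<le> m" using g_le[OF x] cQ0[OF x] by (simp add: C_def m_def)
      also have "m \<le> 4 * D * m" using m D by simp
      finally show ?thesis .
    next
      case False
      then obtain t where t: "\<tau> x = Suc t" "l0 \<le> t" using \<tau>_ge[of x] by (cases "\<tau> x") auto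
      have xX: "x \<in> X" using x QX by auto
      have "avg \<mu> ?F (c (Suc t) x) \<le> D * avg \<mu> ?F (c t x)"
      proof -
        have "(\<Sum>y\<in>c (Suc t) x. ?F y * \<mu> y) \<le> (\<Sum>y\<in>c t x. ?F y * \<mu> y)"
          using c_Suc[OF xX] cells_fin[OF c_cells[OF xX]] c_sub[OF xX, of t] mu by (intro sum_mono2) auto
        moreover have "0 \<le> (\<Sum>y\<in>c t x. ?F y * \<mu> y)"
          using c_sub[OF xX, of t] mu by (intro sum_nonneg) auto
        moreover have "1 / sum \<mu> (c (Suc t) x) \<le> D / sum \<mu> (c t x)"
          using doubling[OF xX, of t] mass_pos[OF xX] by (simp add: field_simps)
        ultimately have "(\<Sum>y\<in>c (Suc t) x. ?F y * \<mu> y) * (1 / sum \<mu> (c (Suc t) x)) \<le>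
            (\<Sum>y\<in>c t x. ?F y * \<mu> y) * (D / sum \<mu> (c t x))"
          using mass_pos[OF xX, of "Suc t"] by (intro mult_mono) (auto intro: less_imp_le)
        then show ?thesis by (simp add: avg_def mult.commute)
      qed
      also have "\<dots> \<le> D * (4 * m)" using before(1)[OF x t(2)] t D by (intro mult_left_mono) auto
      finally show ?thesis using g_le[OF x] t by (simp add: C_def mult.commute mult.left_commute)
    qed
    have b_L1: "(\<Sum>x\<in>Q. size_of b x * \<mu> x) \<le> 2 * m * sum \<mu> Q"
    proof -
      have "(\<Sum>x\<in>Q. size_of b x * \<mu> x) \<le> (\<Sum>x\<in>Q. (?F x + avg \<mu> ?F (C x)) * \<mu> x)"
      proof (intro sum_mono mult_right_mono)
        fix x assume x: "x \<in> Q"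
        have "size_of b x \<le> ?F x + size_of g x"
          using lr_triangle[OF r, of J "\<lambda>j. f j x" "\<lambda>j. - g j x"] by (simp add: size_of_def b_def lr_minus)
        then show "size_of b x \<le> ?F x + avg \<mu> ?F (C x)" using g_le[OF x] by simp
        show "0 \<le> \<mu> x" using x QX mu by auto
      qed
      also have "\<dots> = (\<Sum>x\<in>Q. ?F x * \<mu> x) + (\<Sum>x\<in>Q. avg \<mu> ?F (C x) * \<mu> x)"
        by (simp add: distrib_right sum.distrib)
      also have "(\<Sum>x\<in>Q. ?F x * \<mu> x) = m * sum \<mu> Q" using Qpos by (simp add: m_def avg_def)
      finally show ?thesis unfolding avgF by simp
    qed
    \<comment> \<open>The bad part has mean zero on stopped cells, and \<open>k\<close> is constant on a cell stopped at least \<open>\<kappa>\<close>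
      generations further down.\<close>
    define bl where "bl l y = (if l < \<tau> y \<and> \<tau> y < l + \<kappa> then size_of b y else 0)" for l y
    have b_piece: "nm (piece l b x) \<le> avg \<mu> (bl l) (c l x)"
      if x: "x \<in> Q" and l: "l0 \<le> l" "l < \<tau> x" for x l
    proof -
      have xX: "x \<in> X" using x QX by auto
      have clX: "c l x \<subseteq> X" by (rule c_sub[OF xX])
      have later: "l < \<tau> y" if y: "y \<in> c l x" for y
      proof (rule ccontr)
        assume "\<not> l < \<tau> y"
        then have "x \<in> C y"
          using c_sym[OF xX y] c_antimono[of y "\<tau> y" l] clX y by (auto simp: C_def)
        then show False using \<tau>_const[of y x] clX y l \<open>\<not> l < \<tau> y\<close> by auto
      qed
      let ?Y = "{y \<in> c l x. l + \<kappa> \<le> \<tau> y}" and ?Z = "{y \<in> c l x. \<tau> y < l + \<kappa>}"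
      have fc: "finite (c l x)" by (rule cells_fin[OF c_cells[OF xX]])
      have CY: "C y \<subseteq> c (l + \<kappa>) y" if "y \<in> ?Y" for y
        using c_antimono[of y "l + \<kappa>" "\<tau> y"] that clX by (auto simp: C_def)
      have zero: "(\<Sum>y\<in>?Y. k j l y * b j y * \<mu> y) = 0" for j
      proof -
        have "(\<Sum>y\<in>?Y. k j l y * avg \<mu> (f j) (C y) * \<mu> y) = (\<Sum>y\<in>?Y. k j l y * f j y * \<mu> y)"
        proof (rule avgC)
          show "?Y \<subseteq> X" using clX by auto
          fix y assume y: "y \<in> ?Y"
          then have yX: "y \<in> X" using clX by auto
          have "C y \<subseteq> c l y" using CY[OF y] c_antimono[OF yX, of l "l + \<kappa>"] by auto
          also have "c l y = c l x" using c_eq[OF xX, of y l] y by auto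
          finally show "C y \<subseteq> ?Y" using \<tau>_const[OF yX] y by auto
          show "k j l z = k j l y" if "z \<in> C y" for z
            using k_const[OF yX, of z l j] CY[OF y] that by auto
        qed
        then show ?thesis
          by (simp add: b_def g_def right_diff_distrib left_diff_distrib sum_subtractf)
      qed
      have "(\<Sum>y\<in>c l x. k j l y * b j y * \<mu> y) = (\<Sum>y\<in>?Y. k j l y * b j y * \<mu> y) + (\<Sum>y\<in>?Z. k j l y * b j y * \<mu> y)" for j
        using fc by (subst sum.union_disjoint[symmetric]) (auto intro!: sum.cong)
      then have "piece l b x = (\<lambda>j. h j l x * (\<Sum>y\<in>?Z. k j l y * b j y * \<mu> y))"
        by (simp add: piece_def fun_eq_iff zero)
      then have "nm (piece l b x) \<le> (\<Sum>y\<in>?Z. size_of b y * \<mu> y) / sum \<mu> (c l x)"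
        using partial_piece_le[OF xX, of ?Z l b] by auto
      also have "(\<Sum>y\<in>?Z. size_of b y * \<mu> y) = (\<Sum>y\<in>c l x. bl l y * \<mu> y)"
        using fc later by (intro sum.mono_neutral_cong_left) (auto simp: bl_def)
      finally show ?thesis by (simp add: avg_def)
    qed
    have bad: "(\<Sum>x\<in>\<Omega>. nm (T b x) * \<mu> x) \<le> real \<kappa> * (2 * m * sum \<mu> Q)"
    proof -
      have bl0: "0 \<le> bl l y" for l y by (simp add: bl_def)
      have avbl: "0 \<le> avg \<mu> (bl l) (c l x)" if "x \<in> Q" for l x
        using avg_nonneg[OF \<mu>_pos _ c_sub[of x l], of "bl l"] that QX bl0 by auto
      have "(\<Sum>x\<in>\<Omega>. nm (T b x) * \<mu> x) \<le> (\<Sum>x\<in>\<Omega>. (\<Sum>l\<in>{l0..<L}. avg \<mu> (bl l) (c l x)) * \<mu> x)"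
      proof (intro sum_mono mult_right_mono)
        fix x assume x: "x \<in> \<Omega>"
        then have xQ: "x \<in> Q" using \<Omega>Q by auto
        have "nm (T b x) \<le> (\<Sum>l\<in>{l0..<\<tau> x}. nm (piece l b x))"
          using lr_sum[OF r, of "{l0..<\<tau> x}" J "\<lambda>l. piece l b x"] by (simp add: T_def[abs_def])
        also have "\<dots> \<le> (\<Sum>l\<in>{l0..<\<tau> x}. avg \<mu> (bl l) (c l x))"
          using xQ by (intro sum_mono b_piece) auto
        also have "\<dots> \<le> (\<Sum>l\<in>{l0..<L}. avg \<mu> (bl l) (c l x))"
          using \<tau>\<Omega>(2)[OF x] avbl[OF xQ] by (intro sum_mono2) auto
        finally show "nm (T b x) \<le> (\<Sum>l\<in>{l0..<L}. avg \<mu> (bl l) (c l x))" .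
        show "0 \<le> \<mu> x" using x \<Omega>X mu by auto
      qed
      also have "\<dots> \<le> (\<Sum>x\<in>Q. (\<Sum>l\<in>{l0..<L}. avg \<mu> (bl l) (c l x)) * \<mu> x)"
        using \<Omega>Q fQ avbl mu QX by (intro sum_mono2 mult_nonneg_nonneg sum_nonneg) auto
      also have "\<dots> = (\<Sum>l\<in>{l0..<L}. \<Sum>x\<in>Q. avg \<mu> (bl l) (c l x) * \<mu> x)"
        unfolding sum_distrib_right by (rule sum.swap)
      also have "\<dots> = (\<Sum>l\<in>{l0..<L}. \<Sum>x\<in>Q. bl l x * \<mu> x)"
      proof (rule sum.cong[OF refl])
        fix l assume l: "l \<in> {l0..<L}"
        have "(\<Sum>x\<in>Q. 1 * avg \<mu> (bl l) (c l x) * \<mu> x) = (\<Sum>x\<in>Q. 1 * bl l x * \<mu> x)"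
        proof (rule sum_avg_cells[OF fQ])
          fix x assume x: "x \<in> Q"
          then have xX: "x \<in> X" using QX by auto
          show "0 < \<mu> x" "x \<in> c l x" using \<mu>_pos c_self xX by auto
          show "c l x \<subseteq> Q" using cQ[OF x] l by auto
          show "c l y = c l x" if "y \<in> c l x" for y by (rule c_eq[OF xX that])
        qed auto
        then show "(\<Sum>x\<in>Q. avg \<mu> (bl l) (c l x) * \<mu> x) = (\<Sum>x\<in>Q. bl l x * \<mu> x)" by simp
      qed
      also have "\<dots> = (\<Sum>x\<in>Q. \<Sum>l\<in>{l0..<L}. bl l x * \<mu> x)" by (rule sum.swap)
      also have "\<dots> \<le> (\<Sum>x\<in>Q. real \<kappa> * (size_of b x * \<mu> x))"
      proof (intro sum_mono)
        fix x assume x: "x \<in> Q"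
        have "(\<Sum>l\<in>{l0..<L}. bl l x * \<mu> x) = (\<Sum>l | l \<in> {l0..<L} \<and> l < \<tau> x \<and> \<tau> x < l + \<kappa>. size_of b x * \<mu> x)"
          by (intro sum.mono_neutral_cong_right) (auto simp: bl_def)
        also have "\<dots> = real (card {l. l \<in> {l0..<L} \<and> l < \<tau> x \<and> \<tau> x < l + \<kappa>}) * (size_of b x * \<mu> x)" by simp
        also have "\<dots> \<le> real \<kappa> * (size_of b x * \<mu> x)"
        proof (intro mult_right_mono)
          have "card {l. l \<in> {l0..<L} \<and> l < \<tau> x \<and> \<tau> x < l + \<kappa>} \<le> card {\<tau> x - \<kappa>..<\<tau> x - \<kappa> + \<kappa>}"
            by (intro card_mono) auto
          then show "real (card {l. l \<in> {l0..<L} \<and> l < \<tau> x \<and> \<tau> x < l + \<kappa>}) \<le> real \<kappa>" by simp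
          show "0 \<le> size_of b x * \<mu> x" using x QX mu by auto
        qed
        finally show "(\<Sum>l\<in>{l0..<L}. bl l x * \<mu> x) \<le> real \<kappa> * (size_of b x * \<mu> x)" .
      qed
      also have "\<dots> = real \<kappa> * (\<Sum>x\<in>Q. size_of b x * \<mu> x)" by (simp add: sum_distrib_left)
      also have "\<dots> \<le> real \<kappa> * (2 * m * sum \<mu> Q)" by (intro mult_left_mono b_L1) auto
      finally show ?thesis .
    qed
    have BG: "0 \<le> B0 * real \<kappa>" "B0 * real \<kappa> * (4 * D * m) \<le> \<delta> / 16" "0 \<le> 4 * D * m"
    proof -
      show "0 \<le> B0 * real \<kappa>" "0 \<le> 4 * D * m" using B0 D m by auto
      have "64 * B0 * D * (real \<kappa> * m) \<le> \<Lambda> * (real \<kappa> * m)"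
        using m by (intro mult_right_mono) (auto simp: \<Lambda>_def)
      then show "B0 * real \<kappa> * (4 * D * m) \<le> \<delta> / 16" by (simp add: \<delta>_def ac_simps)
    qed
    have fsub: "finite Y" if "Y \<subseteq> Q" for Y using that fQ by (rule finite_subset)
    define V where "V = {x \<in> \<Omega>. 4 * m < avg \<mu> ?F (C x)}"
    define W1 where "W1 = {x \<in> Q. \<delta> < nm (tail l0 g x)}"
    define W2 where "W2 = {x \<in> Q. \<delta> < nm (tail (\<tau> x) g x)}"
    define W3 where "W3 = {x \<in> \<Omega>. \<delta> < nm (T b x)}"
    have cover: "\<Omega> \<subseteq> V \<union> W1 \<union> W2 \<union> W3"
    proof
      fix x assume x: "x \<in> \<Omega>"
      show "x \<in> V \<union> W1 \<union> W2 \<union> W3"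
      proof (cases "x \<in> V")
        case False
        then have "A' * real \<kappa> * m < nm (a (\<tau> x) x)"
          using x by (auto simp: \<Omega>_def stop_def V_def C_def)
        then have "A' * real \<kappa> * m - real \<kappa> * (4 * m) < nm (T f x)" using T_lower[OF x] by simp
        then have big: "3 * \<delta> < nm (T f x)" by (simp add: A'_def \<delta>_def algebra_simps)
        have "T f x j = (tail l0 g x j + - tail (\<tau> x) g x j) + T b x j" for j
        proof -
          have feq: "(\<lambda>j y. g j y + b j y) = f" by (simp add: b_def fun_eq_iff)
          have "T f x j = T g x j + T b x j"
            unfolding T_def sum.distrib[symmetric] piece_linear[of _ g b x j, unfolded feq] ..
          then show ?thesis using split[OF x, of g j] by simp
        qed
        then have "T f x = (\<lambda>j. (tail l0 g x j + - tail (\<tau> x) g x j) + T b x j)" by auto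
        then have "nm (T f x) \<le> nm (\<lambda>j. tail l0 g x j + - tail (\<tau> x) g x j) + nm (T b x)"
          using lr_triangle[OF r, of J "\<lambda>j. tail l0 g x j + - tail (\<tau> x) g x j" "T b x"] by simp
        also have "\<dots> \<le> nm (tail l0 g x) + nm (tail (\<tau> x) g x) + nm (T b x)"
          using lr_triangle[OF r, of J "tail l0 g x" "\<lambda>j. - tail (\<tau> x) g x j"] by (simp add: lr_minus)
        finally have "\<delta> < nm (tail l0 g x) \<or> \<delta> < nm (tail (\<tau> x) g x) \<or> \<delta> < nm (T b x)"
          using big by linarith
        then show ?thesis using x \<Omega>Q by (auto simp: W1_def W2_def W3_def)
      qed simp
    qed
    \<comment> \<open>The masses add up to \<open>1/4 + 3/16\<close>, which is less than one half.\<close>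
    have V: "sum \<mu> V \<le> sum \<mu> Q / 4"
    proof -
      have VQ: "V \<subseteq> Q" using \<Omega>Q by (auto simp: V_def)
      have "4 * m * sum \<mu> V = (\<Sum>x\<in>V. 4 * m * \<mu> x)" by (simp add: sum_distrib_left)
      also have "\<dots> \<le> (\<Sum>x\<in>V. avg \<mu> ?F (C x) * \<mu> x)"
        using VQ QX mu by (intro sum_mono mult_right_mono) (auto simp: V_def)
      also have "\<dots> \<le> (\<Sum>x\<in>Q. avg \<mu> ?F (C x) * \<mu> x)"
        using VQ QX fQ mu avg_size_nonneg unfolding C_def by (intro sum_mono2 mult_nonneg_nonneg) auto
      finally show ?thesis unfolding avgF using m by simp
    qed
    have W1: "sum \<mu> W1 \<le> sum \<mu> Q / 16"
      unfolding W1_def using cQ by (intro tail_local_weak[OF tb q QX _ g_bdd \<delta> BG]) auto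
    have W2: "sum \<mu> W2 \<le> sum \<mu> Q / 16"
    proof -
      have "sum \<mu> W2 = (\<Sum>t\<in>\<tau> ` Q. sum \<mu> {x \<in> W2. \<tau> x = t})"
        using fQ by (intro sum.group[symmetric]) (auto simp: W2_def)
      also have "\<dots> \<le> (\<Sum>t\<in>\<tau> ` Q. sum \<mu> {x \<in> Q. \<tau> x = t} / 16)"
      proof (intro sum_mono)
        fix t assume "t \<in> \<tau> ` Q"
        have "sum \<mu> {x \<in> {x \<in> Q. \<tau> x = t}. \<delta> < nm (tail t g x)} \<le> sum \<mu> {x \<in> Q. \<tau> x = t} / 16"
        proof (rule tail_local_weak[OF tb q _ _ _ \<delta> BG])
          show "{x \<in> Q. \<tau> x = t} \<subseteq> X" using QX by auto
          show "c t x \<subseteq> {x \<in> Q. \<tau> x = t}" if "x \<in> {x \<in> Q. \<tau> x = t}" for x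
          proof -
            have x: "x \<in> Q" "x \<in> X" "c t x = C x" using that QX by (auto simp: C_def)
            then show ?thesis using C_sub[OF x(1)] \<tau>_const[OF x(2)] that by auto
          qed
        qed (use g_bdd in auto)
        moreover have "{x \<in> W2. \<tau> x = t} = {x \<in> {x \<in> Q. \<tau> x = t}. \<delta> < nm (tail t g x)}"
          by (auto simp: W2_def)
        ultimately show "sum \<mu> {x \<in> W2. \<tau> x = t} \<le> sum \<mu> {x \<in> Q. \<tau> x = t} / 16" by simp
      qed
      also have "\<dots> = (\<Sum>t\<in>\<tau> ` Q. sum \<mu> {x \<in> Q. \<tau> x = t}) / 16" by (simp add: sum_divide_distrib)
      also have "(\<Sum>t\<in>\<tau> ` Q. sum \<mu> {x \<in> Q. \<tau> x = t}) = sum \<mu> Q"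
        using fQ by (intro sum.group) auto
      finally show ?thesis .
    qed
    have W3: "sum \<mu> W3 \<le> sum \<mu> Q / 16"
    proof -
      have "\<delta> * sum \<mu> W3 = (\<Sum>x\<in>W3. \<delta> * \<mu> x)" by (simp add: sum_distrib_left)
      also have "\<dots> \<le> (\<Sum>x\<in>W3. nm (T b x) * \<mu> x)"
        using \<Omega>X mu by (intro sum_mono mult_right_mono) (auto simp: W3_def)
      also have "\<dots> \<le> (\<Sum>x\<in>\<Omega>. nm (T b x) * \<mu> x)"
        using fsub[OF \<Omega>Q] \<Omega>X mu by (intro sum_mono2) (auto simp: W3_def)
      also have "\<dots> \<le> real \<kappa> * (2 * m * sum \<mu> Q)" by (rule bad)
      also have "\<dots> \<le> \<delta> * (sum \<mu> Q / 16)"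
      proof -
        have "32 * (real \<kappa> * m * sum \<mu> Q) \<le> \<Lambda> * (real \<kappa> * m * sum \<mu> Q)"
          using \<Lambda> m Qpos by (intro mult_right_mono) auto
        then show ?thesis by (simp add: \<delta>_def ac_simps)
      qed
      finally show ?thesis using \<delta> by simp
    qed
    have half: "sum \<mu> \<Omega> \<le> sum \<mu> Q / 2"
    proof -
      have sub: "V \<subseteq> Q" "W1 \<subseteq> Q" "W2 \<subseteq> Q" "W3 \<subseteq> Q"
        using \<Omega>Q by (auto simp: V_def W1_def W2_def W3_def)
      have un: "sum \<mu> (Y \<union> Z) \<le> sum \<mu> Y + sum \<mu> Z" if "Y \<subseteq> Q" "Z \<subseteq> Q" for Y Z
        using that mass_nonneg[of "Y \<inter> Z"] QX by (subst sum.union_inter[symmetric])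
          (auto intro: fsub)
      have "sum \<mu> \<Omega> \<le> sum \<mu> (V \<union> W1 \<union> W2 \<union> W3)"
        using cover sub QX mu by (intro sum_mono2 fsub) auto
      also have "\<dots> \<le> sum \<mu> V + sum \<mu> W1 + sum \<mu> W2 + sum \<mu> W3"
        using un[of "V \<union> W1 \<union> W2" W3] un[of "V \<union> W1" W2] un[of V W1] sub by auto
      finally show ?thesis using V W1 W2 W3 Qpos by simp
    qed
    have G: "dom_const D B0 * real \<kappa> * m = (A' + 4) * real \<kappa> * m"
      by (simp add: dom_const_def A'_def \<Lambda>_def)
    have on: "nm (tail l0 f x) \<le> dom_const D B0 * real \<kappa> * m + nm (tail (\<tau> x) f x)" if x: "x \<in> \<Omega>" for x
    proof -
      have "tail l0 f x = (\<lambda>j. T f x j + tail (\<tau> x) f x j)" using split[OF x] by auto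
      then have "nm (tail l0 f x) \<le> nm (T f x) + nm (tail (\<tau> x) f x)"
        using lr_triangle[OF r, of J "T f x" "tail (\<tau> x) f x"] by simp
      then show ?thesis using T_upper[OF x] unfolding G by simp
    qed
    have off: "nm (tail l0 f x) \<le> dom_const D B0 * real \<kappa> * m" if x: "x \<in> Q" "x \<notin> \<Omega>" for x
    proof -
      have le: "A' * real \<kappa> * m \<le> dom_const D B0 * real \<kappa> * m" unfolding G using m by (intro mult_right_mono) auto
      have pos: "0 \<le> A' * real \<kappa> * m" using A' m by simp
      show ?thesis
      proof (cases "l0 < L")
        case False
        then have "nm (tail l0 f x) = 0" by (intro lr_zero) (simp add: tail_def)
        then show ?thesis using le pos by simp
      next
        case True
        have "P L x" using True by (simp add: P_def)
        then have "\<tau> x \<le> L" unfolding \<tau>_def by (rule Least_le)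
        moreover have "L \<le> \<tau> x" using P\<tau>[of x] x by (auto simp: P_def \<Omega>_def)
        ultimately have "\<not> stop L x" using x by (auto simp: \<Omega>_def)
        then have "nm (a L x) \<le> A' * real \<kappa> * m" using True by (auto simp: stop_def)
        have hz: "i + \<kappa> \<le> L" if "h j i x \<noteq> 0" for i j
          using h_top[of i j x] that by (meson not_le)
        have "tail l0 f x j = a L x j" for j
          unfolding tail_def a_def
          using \<kappa> by (intro sum.mono_neutral_right) (auto simp: piece_def dest: hz)
        then have "tail l0 f x = a L x" by auto
        moreover note \<open>nm (a L x) \<le> A' * real \<kappa> * m\<close>
        ultimately show ?thesis using le by simp
      qed
    qed
    have "\<forall>x\<in>\<Omega>. c (\<tau> x) x \<subseteq> \<Omega> \<and> (\<forall>y\<in>c (\<tau> x) x. \<tau> y = \<tau> x)"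
    proof (intro ballI conjI)
      fix x assume x: "x \<in> \<Omega>"
      then have xX: "x \<in> X" "x \<in> Q" using \<Omega>X \<Omega>Q by auto
      show \<tau>y: "\<tau> y = \<tau> x" if "y \<in> c (\<tau> x) x" for y using \<tau>_const[OF xX(1)] that by (simp add: C_def)
      show "c (\<tau> x) x \<subseteq> \<Omega>"
      proof
        fix y assume y: "y \<in> c (\<tau> x) x"
        then have "y \<in> Q" using C_sub[OF xX(2)] by (auto simp: C_def)
        moreover have "stop (\<tau> x) y"
          using x a_const[OF xX(1) y] c_eq[OF xX(1) y] by (simp add: \<Omega>_def stop_def)
        ultimately show "y \<in> \<Omega>" using \<tau>y[OF y] by (simp add: \<Omega>_def)
      qed
    qed
    then show ?thesis
      using \<Omega>Q half on off unfolding Q_def[symmetric] m_def[symmetric]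
      by (intro exI[of _ \<Omega>] exI[of _ \<tau>]) auto
  qed
qed

text \<open>
  Induction over the size of the cell. The sparse family of the cell consists of the cell itself and
  the families of the stopped cells, and sparseness at the top is the bound for \<open>\<Omega>\<close>.
\<close>

lemma sparse_domination_on_cell:
  assumes tb: "tail_bounded q (B0 * real \<kappa>)" and q: "1 \<le> q" and B0: "0 \<le> B0" and x0: "x0 \<in> X"
  shows "\<exists>S. sparse \<mu> S \<and> (\<forall>R\<in>S. R \<subseteq> c l0 x0) \<and>
    (\<forall>x\<in>c l0 x0. nm (tail l0 f x) \<le> dom_const D B0 * real \<kappa> * sparse_op \<mu> S (size_of f) x)"
  using x0
proof (induction "card (c l0 x0)" arbitrary: l0 x0 rule: less_induct)
  case less
  define Q where "Q = c l0 x0"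
  define G where "G = dom_const D B0 * real \<kappa>"
  let ?F = "size_of f"
  have G: "0 \<le> G" using B0 D by (simp add: G_def dom_const_def)
  have Qc: "Q \<in> cells" and QX: "Q \<subseteq> X" using less.prems c_sub by (auto simp: Q_def)
  have fQ: "finite Q" by (rule cells_fin[OF Qc])
  have Qpos: "0 < sum \<mu> Q" by (rule sum_cell_pos[OF \<mu>_pos Qc])
  obtain \<Omega> \<tau> where \<Omega>: "\<Omega> \<subseteq> Q" "sum \<mu> \<Omega> \<le> sum \<mu> Q / 2"
    and \<tau>: "\<forall>x\<in>\<Omega>. c (\<tau> x) x \<subseteq> \<Omega> \<and> (\<forall>y\<in>c (\<tau> x) x. \<tau> y = \<tau> x)"
    and on: "\<forall>x\<in>\<Omega>. nm (tail l0 f x) \<le> G * avg \<mu> ?F Q + nm (tail (\<tau> x) f x)"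
    and off: "\<forall>x\<in>Q - \<Omega>. nm (tail l0 f x) \<le> G * avg \<mu> ?F Q"
    using stopping_step[OF tb q B0 less.prems, of l0 f] unfolding Q_def[symmetric] G_def[symmetric]
    by (elim exE conjE) (rule that)
  have "\<Omega> \<noteq> Q" using \<Omega> Qpos by auto
  then have \<Omega>Q: "\<Omega> \<subset> Q" using \<Omega> by auto
  have \<Omega>X: "\<Omega> \<subseteq> X" using \<Omega> QX by auto
  define C where "C x = c (\<tau> x) x" for x
  have \<tau>_const: "\<tau> y = \<tau> x" if "x \<in> \<Omega>" "y \<in> C x" for x y
    using \<tau> that unfolding C_def by blast
  have C: "x \<in> C x" "C x \<subseteq> \<Omega>" "C x \<in> cells" if x: "x \<in> \<Omega>" for x
  proof -
    have xX: "x \<in> X" using x \<Omega>X by blast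
    show "x \<in> C x" "C x \<in> cells" unfolding C_def by (rule c_self[OF xX], rule c_cells[OF xX])
    show "C x \<subseteq> \<Omega>" using \<tau> x unfolding C_def by blast
  qed
  have C_eq: "C y = C x" if x: "x \<in> \<Omega>" and y: "y \<in> C x" for x y
    unfolding C_def \<tau>_const[OF x y] using c_eq[of x y "\<tau> x"] x y \<Omega>X unfolding C_def by blast
  have "\<exists>S. sparse \<mu> S \<and> (\<forall>R\<in>S. R \<subseteq> C x) \<and>
    (\<forall>y\<in>C x. nm (tail (\<tau> x) f y) \<le> G * sparse_op \<mu> S ?F y)" if x: "x \<in> \<Omega>" for x
  proof -
    have "card (c (\<tau> x) x) < card (c l0 x0)"
      using C(2)[OF x] \<Omega>Q fQ unfolding C_def Q_def by (intro psubset_card_mono) auto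
    then show ?thesis using less.hyps[of "\<tau> x" x] x \<Omega>X by (auto simp: C_def G_def)
  qed
  then have ex: "\<forall>R\<in>C ` \<Omega>. \<exists>S. sparse \<mu> S \<and> (\<forall>P\<in>S. P \<subseteq> R) \<and>
    (\<forall>y\<in>R. nm (tail (\<tau> y) f y) \<le> G * sparse_op \<mu> S ?F y)"
    using \<tau>_const by auto
  obtain SS where SS: "\<forall>R\<in>C ` \<Omega>. sparse \<mu> (SS R) \<and> (\<forall>P\<in>SS R. P \<subseteq> R) \<and>
    (\<forall>y\<in>R. nm (tail (\<tau> y) f y) \<le> G * sparse_op \<mu> (SS R) ?F y)"
    using bchoice[OF ex] by (elim exE) (rule that)
  define S where "S = insert Q (\<Union>R\<in>C ` \<Omega>. SS R)"
  have sub: "P \<subseteq> R" "P \<in> cells" "P \<noteq> {}" if R0: "R \<in> C ` \<Omega>" and P0: "P \<in> SS R" for R P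
  proof -
    have R: "sparse \<mu> (SS R)" "\<forall>P\<in>SS R. P \<subseteq> R" using bspec[OF SS R0] by simp_all
    show "P \<subseteq> R" using R(2) P0 by simp
    show P: "P \<in> cells" by (rule sparse_cells[OF R(1) P0])
    show "P \<noteq> {}" by (rule cells_nonempty[OF P])
  qed
  have disj: "R = R'" if RR: "R \<in> C ` \<Omega>" "R' \<in> C ` \<Omega>" and x: "x \<in> R" "x \<in> R'" for R R' x
  proof -
    obtain z z' where z: "z \<in> \<Omega>" "R = C z" "z' \<in> \<Omega>" "R' = C z'" using RR by blast
    then show ?thesis using C_eq[of z x] C_eq[of z' x] x by simp
  qed
  have below: "{P \<in> S. P \<subset> P0} = {P \<in> SS R. P \<subset> P0}" if R: "R \<in> C ` \<Omega>" and P0: "P0 \<in> SS R" for R P0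
  proof -
    have "P \<in> SS R" if P: "P \<in> S" "P \<subset> P0" for P
    proof -
      have "P0 \<subseteq> \<Omega>" using sub(1)[OF R P0] R C(2) by auto
      then have "P \<noteq> Q" using P \<Omega>Q by auto
      then obtain R' where R': "R' \<in> C ` \<Omega>" "P \<in> SS R'" using P(1) unfolding S_def by blast
      obtain x where "x \<in> P" using sub(3)[OF R'] by auto
      then have "R' = R" using disj[OF R'(1) R, of x] sub(1)[OF R'] sub(1)[OF R P0] P by auto
      then show ?thesis using R' by simp
    qed
    then show ?thesis using R by (auto simp: S_def)
  qed
  have sparseS: "sparse \<mu> S"
    unfolding sparse_def
  proof (intro conjI ballI)
    show Sc: "S \<subseteq> cells" using Qc sub(2) unfolding S_def by blast
    fix P0 assume "P0 \<in> S"
    then consider "P0 = Q" | R where "R \<in> C ` \<Omega>" "P0 \<in> SS R" by (auto simp: S_def)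
    then show "sum \<mu> (\<Union>{P \<in> S. P \<subset> P0}) \<le> sum \<mu> P0 / 2"
    proof cases
      case 1
      have "P \<subseteq> \<Omega>" if P: "P \<in> S" "P \<subset> P0" for P
      proof -
        obtain R where R: "R \<in> C ` \<Omega>" "P \<in> SS R" using P 1 unfolding S_def by blast
        obtain z where "z \<in> \<Omega>" "R = C z" using R(1) by blast
        then show ?thesis using sub(1)[OF R] C(2)[of z] by simp
      qed
      then have "\<Union>{P \<in> S. P \<subset> P0} \<subseteq> \<Omega>" by blast
      moreover have "finite \<Omega>" by (rule finite_subset[OF \<Omega>(1) fQ])
      moreover have "0 \<le> \<mu> x" if "x \<in> \<Omega>" for x using that \<Omega>X \<mu>_pos less_imp_le by blast
      ultimately have "sum \<mu> (\<Union>{P \<in> S. P \<subset> P0}) \<le> sum \<mu> \<Omega>"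
        by (intro sum_mono2) blast+
      then show ?thesis using \<Omega>(2) 1 by simp
    next
      case 2
      then show ?thesis using bspec[OF SS 2(1)] unfolding below[OF 2] sparse_def using 2(2) by blast
    qed
  qed
  have fS: "finite S" by (rule sparse_finite[OF sparseS])
  have QS: "Q \<in> S" by (simp add: S_def)
  have SSS: "SS R \<subseteq> S" if "R \<in> C ` \<Omega>" for R using that unfolding S_def by blast
  have F0: "0 \<le> avg \<mu> ?F P" if "P \<in> S" for P
    using avg_nonneg[OF \<mu>_pos _ cells_sub[OF sparse_cells[OF sparseS that]], of ?F] by simp
  have "\<forall>x\<in>Q. nm (tail l0 f x) \<le> G * sparse_op \<mu> S ?F x"
  proof
    fix x assume x: "x \<in> Q"
    show "nm (tail l0 f x) \<le> G * sparse_op \<mu> S ?F x"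
    proof (cases "x \<in> \<Omega>")
      case False
      have "avg \<mu> ?F Q \<le> sparse_op \<mu> S ?F x"
        unfolding sparse_op_def using x fS F0 by (intro member_le_sum) (auto simp: QS)
      then have "G * avg \<mu> ?F Q \<le> G * sparse_op \<mu> S ?F x" using G by (intro mult_left_mono)
      then show ?thesis using off x False by force
    next
      case True
      let ?R = "C x"
      have R: "?R \<in> C ` \<Omega>" using True by auto
      have Q: "Q \<notin> SS ?R" using sub(1)[OF R] C(2)[OF True] \<Omega>Q by blast
      have fR: "finite (SS ?R)" using bspec[OF SS R] sparse_finite by auto
      have "avg \<mu> ?F Q + sparse_op \<mu> (SS ?R) ?F x = (\<Sum>P | P \<in> insert Q (SS ?R) \<and> x \<in> P. avg \<mu> ?F P)"
      proof -
        have "{P. P \<in> insert Q (SS ?R) \<and> x \<in> P} = insert Q {P. P \<in> SS ?R \<and> x \<in> P}" using x by auto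
        then show ?thesis using Q fR by (simp add: sparse_op_def)
      qed
      also have "\<dots> \<le> sparse_op \<mu> S ?F x"
        unfolding sparse_op_def using fS F0 SSS[OF R] QS by (intro sum_mono2) auto
      finally have "G * (avg \<mu> ?F Q + sparse_op \<mu> (SS ?R) ?F x) \<le> G * sparse_op \<mu> S ?F x"
        using G by (intro mult_left_mono)
      moreover have "nm (tail (\<tau> x) f x) \<le> G * sparse_op \<mu> (SS ?R) ?F x"
        using bspec[OF SS R] C(1)[OF True] by simp
      moreover have "nm (tail l0 f x) \<le> G * avg \<mu> ?F Q + nm (tail (\<tau> x) f x)" using on True by blast
      ultimately show ?thesis by (simp add: distrib_left)
    qed
  qed
  moreover have "\<forall>R\<in>S. R \<subseteq> Q"
  proof
    fix P assume "P \<in> S"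
    then consider "P = Q" | z where "z \<in> \<Omega>" "P \<in> SS (C z)" unfolding S_def by blast
    then show "P \<subseteq> Q"
    proof cases
      case 2
      then show ?thesis using sub(1)[of "C z" P] C(2)[of z] \<Omega>(1) by simp
    qed simp
  qed
  ultimately show ?case using sparseS unfolding Q_def G_def by blast
qed

theorem sparse_domination:
  assumes "tail_bounded q (B0 * real \<kappa>)" "1 \<le> q" "0 \<le> B0" and root: "\<forall>x\<in>X. c 0 x = X"
  shows "\<exists>S. sparse \<mu> S \<and>
    (\<forall>x\<in>X. nm (tail 0 f x) \<le> dom_const D B0 * real \<kappa> * sparse_op \<mu> S (size_of f) x)"
proof (cases "X = {}")
  case True
  have "sparse \<mu> {}" by (simp add: sparse_def)
  then show ?thesis using True by blast
next
  case False
  then obtain x0 where "x0 \<in> X" by auto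
  then show ?thesis using sparse_domination_on_cell[OF assms(1-3), of x0 0 f] root by auto
qed

lemma unweighted: "1 < p \<Longrightarrow> weighted_tree X c L \<mu> \<mu> \<mu> p 1"
proof
  assume p: "1 < p"
  have e: "t powr p = t * t powr (p - 1)" if "0 < t" for t :: real using that by (simp add: powr_mult_base)
  show "\<mu> x powr p \<le> \<mu> x * \<mu> x powr (p - 1)" if "x \<in> X" for x
    using e[of "\<mu> x"] \<mu>_pos that by simp
  show "sum \<mu> Q * sum \<mu> Q powr (p - 1) \<le> 1 * sum \<mu> Q powr p" if "Q \<in> cells" for Q
    using e[OF sum_cell_pos[OF \<mu>_pos that]] by simp
qed (use \<mu>_pos in auto)

lemma Lp_bound:
  assumes "tail_bounded q (B0 * real \<kappa>)" "1 \<le> q" "0 \<le> B0" and root: "\<forall>x\<in>X. c 0 x = X" and p: "1 < p"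
  shows "(\<Sum>x\<in>X. nm (tail 0 f x) powr p * \<mu> x) \<le>
    (sparse_const p * dom_const D B0 * real \<kappa>) powr p * (\<Sum>x\<in>X. size_of f x powr p * \<mu> x)"
proof -
  interpret W: weighted_tree X c L \<mu> \<mu> \<mu> p 1 by (rule unweighted[OF p])
  let ?G = "dom_const D B0 * real \<kappa>"
  have G: "0 \<le> ?G" using assms(3) D by (simp add: dom_const_def)
  obtain S where S: "sparse \<mu> S" and
    dom: "\<forall>x\<in>X. nm (tail 0 f x) \<le> ?G * sparse_op \<mu> S (size_of f) x"
    using sparse_domination[OF assms(1-3) root, of f] by (elim exE conjE) (rule that)
  have op: "0 \<le> sparse_op \<mu> S (size_of f) x" for x
    using S by (intro sparse_op_nonneg \<mu>_pos) (auto simp: sparse_def)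
  have "(\<Sum>x\<in>X. nm (tail 0 f x) powr p * \<mu> x) \<le> (\<Sum>x\<in>X. (?G * sparse_op \<mu> S (size_of f) x) powr p * \<mu> x)"
    using dom p \<mu>_pos by (intro sum_mono mult_right_mono powr_mono2) (auto intro: less_imp_le)
  also have "\<dots> = ?G powr p * (\<Sum>x\<in>X. sparse_op \<mu> S (size_of f) x powr p * \<mu> x)"
    using G op by (simp add: powr_mult sum_distrib_left mult.assoc)
  also have "\<dots> \<le> ?G powr p * (sparse_const p powr p *
      (\<Sum>x\<in>X. (size_of f x * \<mu> x) powr p * \<mu> x powr (1 - p)))"
    using W.sparse_strong[OF S, of "size_of f"] by (intro mult_left_mono) auto
  also have "(\<Sum>x\<in>X. (size_of f x * \<mu> x) powr p * \<mu> x powr (1 - p)) = (\<Sum>x\<in>X. size_of f x powr p * \<mu> x)"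
  proof (intro sum.cong refl)
    fix x assume "x \<in> X"
    then have m: "0 < \<mu> x" using \<mu>_pos by auto
    have "(size_of f x * \<mu> x) powr p * \<mu> x powr (1 - p) = size_of f x powr p * (\<mu> x powr p * \<mu> x powr (1 - p))"
      using m by (simp add: powr_mult)
    also have "\<mu> x powr p * \<mu> x powr (1 - p) = \<mu> x" using m by (simp flip: powr_add)
    finally show "(size_of f x * \<mu> x) powr p * \<mu> x powr (1 - p) = size_of f x powr p * \<mu> x" .
  qed
  finally show ?thesis
    using sparse_const_pos[OF p] G by (simp add: powr_mult[of "sparse_const p * dom_const D B0"] powr_mult ac_simps)
qed

text \<open>
  The two runs of the argument. For each \<open>j\<close> the \<open>L^2\<close> bound gives sparse domination of the scalar
  shift and thereby its boundedness on \<open>L^r\<close>, also for each tail, since a tail is again a shift. The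
  \<open>r\<close>-th powers are then summed over \<open>j\<close>.
\<close>

theorem vector_sparse_domination:
  assumes L2: "\<And>j a u. (\<Sum>x\<in>X. (\<Sum>l\<in>{a..<L}. h j l x * (\<Sum>y\<in>c l x. k j l y * u y * \<mu> y))\<^sup>2 * \<mu> x)
      \<le> B0\<^sup>2 * (\<Sum>x\<in>X. (u x)\<^sup>2 * \<mu> x)"
    and B0: "0 \<le> B0" and root: "\<forall>x\<in>X. c 0 x = X"
  shows "\<exists>S. sparse \<mu> S \<and> (\<forall>x\<in>X. nm (tail 0 f x) \<le>
     dom_const D (sparse_const r * dom_const D B0) * real \<kappa> * sparse_op \<mu> S (size_of f) x)"
proof -
  define B1 where "B1 = sparse_const r * dom_const D B0"
  have B1: "0 \<le> B1" using B0 D sparse_const_pos[OF r] by (simp add: B1_def dom_const_def)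
  have mu: "0 \<le> \<mu> x" if "x \<in> X" for x using that \<mu>_pos less_imp_le by blast
  have scalar: "(\<Sum>x\<in>X. \<bar>tail a f x j\<bar> powr r * \<mu> x) \<le> (B1 * real \<kappa>) powr r * (\<Sum>x\<in>X. \<bar>f j x\<bar> powr r * \<mu> x)"
    for a j and f :: "nat \<Rightarrow> 'x \<Rightarrow> real"
  proof -
    interpret S: shift_tree X c L \<mu> D \<kappa> 1 r "\<lambda>_ l x. if a \<le> l then h j l x else 0" "\<lambda>_. k j"
    proof
      show "\<bar>(if a \<le> l then h j l x else 0) * k j l y\<bar> \<le> 1 / sum \<mu> (c l x)" if "x \<in> X" "y \<in> c l x" for x y l
        using kernel[OF that, of j] mass_pos[OF that(1), of l] by (auto intro: less_imp_le)
      show "(if a \<le> l then h j l y else 0) = (if a \<le> l then h j l x else 0)" if "x \<in> X" "y \<in> c (l + \<kappa>) x" for x y l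
        using h_const[OF that, of j] by simp
    qed (use \<mu>_pos D doubling \<kappa> r k_const h_top in auto)
    have St: "S.tail t g x 0 = (\<Sum>l\<in>{max a t..<L}. h j l x * (\<Sum>y\<in>c l x. k j l y * g 0 y * \<mu> y))" for t g x
      unfolding S.tail_def S.piece_def by (intro sum.mono_neutral_cong_right) auto
    have tb: "S.tail_bounded 2 (B0 * real \<kappa>)"
      unfolding S.tail_bounded_def
    proof (intro allI)
      fix t g
      have "(\<Sum>x\<in>X. S.nm (S.tail t g x) powr 2 * \<mu> x) = (\<Sum>x\<in>X. (S.tail t g x 0)\<^sup>2 * \<mu> x)"
        by (simp add: lr_one[OF r, simplified])
      also have "\<dots> \<le> B0\<^sup>2 * (\<Sum>x\<in>X. (g 0 x)\<^sup>2 * \<mu> x)" unfolding St by (rule L2)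
      also have "\<dots> \<le> (B0 * real \<kappa>)\<^sup>2 * (\<Sum>x\<in>X. (g 0 x)\<^sup>2 * \<mu> x)"
        using B0 \<kappa> mu by (intro mult_right_mono power_mono sum_nonneg) (auto simp: mult_le_cancel_left1)
      also have "\<dots> = (B0 * real \<kappa>) powr 2 * (\<Sum>x\<in>X. S.size_of g x powr 2 * \<mu> x)"
        unfolding S.size_of_def lr_one[OF r] using B0 by simp
      finally show "(\<Sum>x\<in>X. S.nm (S.tail t g x) powr 2 * \<mu> x) \<le>
        (B0 * real \<kappa>) powr 2 * (\<Sum>x\<in>X. S.size_of g x powr 2 * \<mu> x)" .
    qed
    have "(\<Sum>x\<in>X. S.nm (S.tail 0 (\<lambda>_. f j) x) powr r * \<mu> x) \<le>
      (sparse_const r * dom_const D B0 * real \<kappa>) powr r * (\<Sum>x\<in>X. S.size_of (\<lambda>_. f j) x powr r * \<mu> x)"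
      by (rule S.Lp_bound[OF tb _ B0 root r]) simp
    then show ?thesis
      unfolding S.size_of_def lr_one[OF r] St by (simp add: tail_def piece_def B1_def)
  qed
  have "tail_bounded r (B1 * real \<kappa>)"
    unfolding tail_bounded_def
  proof (intro allI)
    fix a f
    have "(\<Sum>x\<in>X. nm (tail a f x) powr r * \<mu> x) = (\<Sum>j<J. \<Sum>x\<in>X. \<bar>tail a f x j\<bar> powr r * \<mu> x)"
      unfolding lr_powr[OF r] sum_distrib_right by (rule sum.swap)
    also have "\<dots> \<le> (\<Sum>j<J. (B1 * real \<kappa>) powr r * (\<Sum>x\<in>X. \<bar>f j x\<bar> powr r * \<mu> x))"
      by (intro sum_mono scalar)
    also have "\<dots> = (B1 * real \<kappa>) powr r * (\<Sum>x\<in>X. size_of f x powr r * \<mu> x)"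
      unfolding size_of_def lr_powr[OF r] sum_distrib_right sum_distrib_left[symmetric]
      by (subst sum.swap) simp
    finally show "(\<Sum>x\<in>X. nm (tail a f x) powr r * \<mu> x) \<le>
      (B1 * real \<kappa>) powr r * (\<Sum>x\<in>X. size_of f x powr r * \<mu> x)" .
  qed
  from sparse_domination[OF this _ B1 root] r show ?thesis unfolding B1_def by simp
qed

end

section \<open>Geometry of the dyadic grid\<close>

text \<open>
  The dyadic cube of generation \<open>i\<close>, that is of side length \<open>2 powi (- i)\<close>, around a point is
  determined by the integer vector \<open>idx i x\<close>; passing to a coarser generation is integer division by
  a power of two. Conversely \<open>corner i m\<close> is a sample point of the cube with index \<open>m\<close>.
\<close>

definition idx :: "int \<Rightarrow> real^'n \<Rightarrow> int^'n" where
  "idx i x = (\<chi> s. \<lfloor>2 powi i * x $ s\<rfloor>)"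

definition corner :: "int \<Rightarrow> int^'n \<Rightarrow> real^'n" where
  "corner i m = (\<chi> s. 2 powi (- i) * of_int (m $ s))"

definition vol :: "'n::finite itself \<Rightarrow> int \<Rightarrow> real" where
  "vol _ i = (2 powi (- i)) ^ CARD('n)"

lemma dyadic_cube_eq: "dyadic_cube i m = {x. idx i x = m}"
proof (intro equalityI subsetI)
  have inv: "2 powi i * (2 powi (- i) * t) = (t::real)" "2 powi (- i) * (2 powi i * t) = t" for t
    by (simp_all add: power_int_minus)
  fix x :: "real^'a"
  {
    assume "x \<in> dyadic_cube i m"
    then obtain y where y: "x = 2 powi (- i) *\<^sub>R y" "\<forall>s. of_int (m $ s) \<le> y $ s \<and> y $ s < of_int (m $ s) + 1"
      by (auto simp: dyadic_cube_def)
    then have "\<lfloor>2 powi i * x $ s\<rfloor> = m $ s" for s using y(2) by (auto simp: inv floor_eq_iff)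
    then show "x \<in> {x. idx i x = m}" by (simp add: idx_def vec_eq_iff)
  next
    assume "x \<in> {x. idx i x = m}"
    then have m: "m $ s = \<lfloor>2 powi i * x $ s\<rfloor>" for s by (auto simp: idx_def)
    have "x = 2 powi (- i) *\<^sub>R (2 powi i *\<^sub>R x)" by (simp add: power_int_minus)
    then show "x \<in> dyadic_cube i m"
      unfolding dyadic_cube_def by (rule image_eqI) (auto simp: m)
  }
qed

lemma idx_corner [simp]: "idx i (corner i m) = m"
  by (simp add: idx_def corner_def vec_eq_iff power_int_minus mult.assoc[symmetric])

lemma idx_coarser: "idx i x $ s = idx (i + int d) x $ s div 2 ^ d"
proof -
  have "2 powi i * x $ s = (2 powi (i + int d) * x $ s) / real_of_int (2 ^ d)"
    by (simp add: power_int_add)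
  then show ?thesis
    using floor_divide_real_eq_div[of "2 ^ d" "2 powi (i + int d) * x $ s"] by (simp add: idx_def)
qed

lemma idx_mono:
  assumes "idx i' x = idx i' y" "i \<le> i'" shows "idx i x = idx i y"
proof -
  have "i' = i + int (nat (i' - i))" using assms(2) by simp
  then show ?thesis using idx_coarser[of i x _ "nat (i' - i)"] idx_coarser[of i y _ "nat (i' - i)"] assms(1)
    by (simp add: vec_eq_iff)
qed

abbreviation cube_at :: "int \<Rightarrow> real^'n \<Rightarrow> (real^'n) set" where
  "cube_at i x \<equiv> dyadic_cube i (idx i x)"

lemma cube_at_gen: "cube_at i x \<in> dyadic_generation i"
  by (simp add: dyadic_generation_def)

lemma mem_cube_at: "y \<in> cube_at i x \<longleftrightarrow> idx i y = idx i x"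
  by (simp add: dyadic_cube_eq)

lemma cube_at_antimono: "i \<le> i' \<Longrightarrow> cube_at i' x \<subseteq> cube_at i x"
  using idx_mono by (auto simp: dyadic_cube_eq)

lemma vol_pos [simp]: "0 < vol TYPE('n::finite) i"
  by (simp add: vol_def)

lemma cube_closure:
  fixes i :: int and m :: "int^'n"
  defines "a \<equiv> corner i m" and "b \<equiv> (\<chi> s. corner i m $ s + 2 powi (- i))"
  shows "box a b \<subseteq> dyadic_cube i m" "dyadic_cube i m \<subseteq> cbox a b"
    "emeasure lborel (box a b) = ennreal (vol TYPE('n) i)" "emeasure lborel (cbox a b) = ennreal (vol TYPE('n) i)"
proof -
  have pw: "2 powi i > (0::real)" "2 powi (- i) = 1 / (2 powi i :: real)" by (auto simp: power_int_minus field_simps)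
  have eq: "x \<in> dyadic_cube i m \<longleftrightarrow> (\<forall>s. a $ s \<le> x $ s \<and> x $ s < b $ s)" for x
  proof -
    define P :: real where "P = 2 powi i"
    have P: "0 < P" "2 powi i = P" "2 powi (- i) = 1 / P" using pw by (auto simp: P_def)
    have "(of_int (m $ s) \<le> P * x $ s \<and> P * x $ s < of_int (m $ s) + 1) \<longleftrightarrow>
        (1 / P * of_int (m $ s) \<le> x $ s \<and> x $ s < 1 / P * of_int (m $ s) + 1 / P)" for s
      using P(1) by (simp add: field_simps)
    then show ?thesis
      unfolding dyadic_cube_eq a_def b_def idx_def corner_def P(2,3)
      by (simp add: vec_eq_iff floor_eq_iff)
  qed
  show "box a b \<subseteq> dyadic_cube i m" "dyadic_cube i m \<subseteq> cbox a b"
    by (auto simp: eq mem_box_cart less_imp_le)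
  have le: "\<forall>b'\<in>Basis. a \<bullet> b' \<le> b \<bullet> b'"
    using pw by (auto simp: Basis_vec_def inner_axis a_def b_def)
  have prod: "(\<Prod>b'\<in>Basis. (b - a) \<bullet> b') = vol TYPE('n) i"
  proof -
    have "(\<Prod>b'\<in>Basis. (b - a) \<bullet> b') = (\<Prod>b'\<in>(Basis :: (real^'n) set). 2 powi (- i))"
      by (intro prod.cong refl) (auto simp: Basis_vec_def inner_axis a_def b_def)
    then show ?thesis by (simp add: vol_def)
  qed
  show "emeasure lborel (box a b) = ennreal (vol TYPE('n) i)" "emeasure lborel (cbox a b) = ennreal (vol TYPE('n) i)"
    using le by (simp_all add: emeasure_lborel_box_eq emeasure_lborel_cbox_eq prod)
qed

lemma dyadic_cube_borel [measurable]: "dyadic_cube i m \<in> sets borel"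
proof -
  have "dyadic_cube i m = (\<Inter>s. {x. real_of_int (m $ s) \<le> 2 powi i * x $ s} \<inter> {x. 2 powi i * x $ s < of_int (m $ s) + 1})"
    unfolding dyadic_cube_eq idx_def by (auto simp: vec_eq_iff floor_eq_iff)
  also have "\<dots> \<in> sets borel"
    by (intro sets.countable_INT' sets.Int borel_closed borel_open closed_Collect_le open_Collect_less
        continuous_intros) auto
  finally show ?thesis .
qed

lemma dyadic_cube_sets [measurable]: "dyadic_cube i m \<in> sets lebesgue"
  by (rule sets_completionI_sets) simp

lemma emeasure_dyadic_cube: "emeasure lebesgue (dyadic_cube i (m :: int^'n)) = ennreal (vol TYPE('n) i)"
proof -
  note c = cube_closure[of i m]
  have "emeasure lborel (dyadic_cube i m) = ennreal (vol TYPE('n) i)"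
  proof (rule antisym)
    show "emeasure lborel (dyadic_cube i m) \<le> ennreal (vol TYPE('n) i)"
      unfolding c(4)[symmetric] by (rule emeasure_mono[OF c(2)]) simp
    show "ennreal (vol TYPE('n) i) \<le> emeasure lborel (dyadic_cube i m)"
      unfolding c(3)[symmetric] by (rule emeasure_mono[OF c(1)]) simp
  qed
  then show ?thesis by (simp add: emeasure_completion)
qed

lemma measure_dyadic_cube: "measure lebesgue (dyadic_cube i (m :: int^'n)) = vol TYPE('n) i"
  by (simp add: measure_def emeasure_dyadic_cube less_imp_le)

lemma vol_Suc: "vol TYPE('n::finite) (i + 1) * 2 ^ CARD('n) = vol TYPE('n) i"
proof -
  have "(2::real) powi (- i) = 2 powi (- (i + 1)) * 2"
    using power_int_add[of "2::real" "- (i + 1)" 1] by simp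
  then show ?thesis by (simp only: vol_def power_mult_distrib)
qed

lemma vol_less: "i < i' \<Longrightarrow> vol TYPE('n::finite) i' < vol TYPE('n) i"
  unfolding vol_def by (intro power_strict_mono power_int_strict_increasing) auto

lemma idx_measurable [measurable]: "idx i \<in> measurable lebesgue (count_space UNIV)"
proof (subst measurable_count_space_eq_countable)
  show "idx i \<in> space lebesgue \<rightarrow> UNIV \<and> (\<forall>a\<in>UNIV. idx i -` {a} \<inter> space lebesgue \<in> sets lebesgue)"
  proof (intro conjI ballI)
    fix a
    have "idx i -` {a} \<inter> space lebesgue = dyadic_cube i a" by (auto simp: dyadic_cube_eq)
    then show "idx i -` {a} \<inter> space lebesgue \<in> sets lebesgue" by simp
  qed auto
qed auto

section \<open>Partial sums of a Haar shift\<close>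

text \<open>
  At a point only one cube of each generation contributes, so a partial sum of the shift is a finite
  sum over generations.
\<close>

definition gen_sum :: "'n::finite cube_family \<Rightarrow> 'n cube_family \<Rightarrow> int \<Rightarrow> int \<Rightarrow> (real^'n \<Rightarrow> real) \<Rightarrow> real^'n \<Rightarrow> real" where
  "gen_sum h k a b f x = (\<Sum>i\<in>{a..b}. (\<integral>y. f y * k (cube_at i x) y \<partial>lebesgue) * h (cube_at i x) x)"

lemma cube_at_inj:
  fixes x :: "real^'n"
  assumes "cube_at i x = cube_at i' x" shows "i = i'"
proof -
  have "vol TYPE('n) i = vol TYPE('n) i'" using assms measure_dyadic_cube by metis
  then show ?thesis using vol_less[of i i', where 'n='n] vol_less[of i' i, where 'n='n]
    by (cases i i' rule: linorder_cases) auto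
qed

locale haar =
  fixes \<kappa> :: nat and h k :: "'n::finite cube_family"
  assumes gs: "generalized_haar_shift \<kappa> h k" and \<kappa>: "1 \<le> \<kappa>"
begin

lemma supp: "y \<notin> cube_at i x \<Longrightarrow> h (cube_at i x) y = 0" "y \<notin> cube_at i x \<Longrightarrow> k (cube_at i x) y = 0"
  using gs cube_at_gen[of i x] unfolding generalized_haar_shift_def by blast+

lemma const:
  assumes "idx (i + int \<kappa>) y = idx (i + int \<kappa>) z"
  shows "h (cube_at i x) y = h (cube_at i x) z" "k (cube_at i x) y = k (cube_at i x) z"
proof -
  have "h (cube_at i x) y = h (cube_at i x) z \<and> k (cube_at i x) y = k (cube_at i x) z"
  proof (cases "y \<in> cube_at i x")
    case True
    let ?J = "cube_at (i + int \<kappa>) y"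
    have "idx i y = idx i x" using True by (simp add: mem_cube_at)
    then have "?J \<subseteq> cube_at i x" using cube_at_antimono[of i "i + int \<kappa>" y] by simp
    then have "h (cube_at i x) constant_on ?J \<and> k (cube_at i x) constant_on ?J"
      using gs cube_at_gen[of i x] cube_at_gen[of "i + int \<kappa>" y] unfolding generalized_haar_shift_def by blast
    moreover have "y \<in> ?J" "z \<in> ?J" using assms by (auto simp: mem_cube_at)
    ultimately show ?thesis unfolding constant_on_def by metis
  next
    case False
    moreover have "z \<notin> cube_at i x" using False idx_mono[OF assms, of i] by (simp add: mem_cube_at)
    ultimately show ?thesis using supp by simp
  qed
  then show "h (cube_at i x) y = h (cube_at i x) z" "k (cube_at i x) y = k (cube_at i x) z" by auto
qed

end

lemma finite_int_vec: "finite {m :: int^'n. \<forall>s. m $ s \<in> S s}" if "\<And>s. finite (S s)"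
proof -
  have "finite (Pi\<^sub>E UNIV S)" using that by (intro finite_PiE) auto
  moreover have "vec_nth ` {m :: int^'n. \<forall>s. m $ s \<in> S s} \<subseteq> Pi\<^sub>E UNIV S" by auto
  ultimately have "finite (vec_nth ` {m :: int^'n. \<forall>s. m $ s \<in> S s})" by (rule finite_subset[rotated])
  then show ?thesis by (rule finite_imageD) (auto simp: inj_on_def vec_eq_iff)
qed

lemma finite_descendants: "finite {m :: int^'n. \<forall>s. m $ s div 2 ^ d = m0 $ s}"
proof (rule finite_subset)
  show "{m :: int^'n. \<forall>s. m $ s div 2 ^ d = m0 $ s} \<subseteq> {m. \<forall>s. m $ s \<in> {m0 $ s * 2 ^ d..m0 $ s * 2 ^ d + 2 ^ d}}"
  proof (intro subsetI CollectI allI)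
    fix m :: "int^'n" and s assume m: "m \<in> {m. \<forall>s. m $ s div 2 ^ d = m0 $ s}"
    define r where "r = m $ s mod 2 ^ d"
    have "m $ s = m0 $ s * 2 ^ d + r" using div_mult_mod_eq[of "m $ s" "2 ^ d"] m by (simp add: r_def)
    moreover have "0 \<le> r" "r < 2 ^ d" by (simp_all add: r_def)
    ultimately show "m $ s \<in> {m0 $ s * 2 ^ d..m0 $ s * 2 ^ d + 2 ^ d}" by simp
  qed
  show "finite {m :: int^'n. \<forall>s. m $ s \<in> {m0 $ s * 2 ^ d..m0 $ s * 2 ^ d + 2 ^ d}}"
    by (rule finite_int_vec) simp
qed

context haar
begin

text \<open>
  Each function is constant on the finitely many cubes that are \<open>\<kappa>\<close> generations finer. Hence the
  suprema in the size condition are those of bounded sets and dominate the pointwise values.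
\<close>

lemma finite_values: "finite (range (h (cube_at i x)))" "finite (range (k (cube_at i x)))"
proof -
  define A where "A = corner (i + int \<kappa>) ` {m :: int^'n. \<forall>s. m $ s div 2 ^ \<kappa> = idx i x $ s}"
  have fA: "finite A" unfolding A_def by (intro finite_imageI finite_descendants)
  have "h (cube_at i x) y \<in> insert 0 (h (cube_at i x) ` A) \<and> k (cube_at i x) y \<in> insert 0 (k (cube_at i x) ` A)" for y
  proof (cases "y \<in> cube_at i x")
    case False
    then show ?thesis using supp by simp
  next
    case True
    let ?z = "corner (i + int \<kappa>) (idx (i + int \<kappa>) y)"
    have "?z \<in> A" unfolding A_def using True idx_coarser[of i y _ \<kappa>] by (auto simp: mem_cube_at)
    moreover have "h (cube_at i x) y = h (cube_at i x) ?z" "k (cube_at i x) y = k (cube_at i x) ?z"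
      by (rule const; simp)+
    ultimately show ?thesis by auto
  qed
  then have "range (h (cube_at i x)) \<subseteq> insert 0 (h (cube_at i x) ` A)"
    "range (k (cube_at i x)) \<subseteq> insert 0 (k (cube_at i x) ` A)" by blast+
  then show "finite (range (h (cube_at i x)))" "finite (range (k (cube_at i x)))"
    using fA by (meson finite_imageI finite_insert finite_subset)+
qed

lemma product_bound: "\<bar>h (cube_at i x) y * k (cube_at i x) z\<bar> \<le> 1 / vol TYPE('n) i"
proof -
  let ?h = "h (cube_at i x)" and ?k = "k (cube_at i x)"
  have bdd: "bdd_above (range (\<lambda>y. \<bar>?h y\<bar>))" "bdd_above (range (\<lambda>y. \<bar>?k y\<bar>))"
    using finite_imageI[OF finite_values(1)[of i x], of abs] finite_imageI[OF finite_values(2)[of i x], of abs]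
    by (auto simp: image_image intro: bdd_above_finite)
  have "\<bar>?h y * ?k z\<bar> = \<bar>?h y\<bar> * \<bar>?k z\<bar>" by (rule abs_mult)
  also have "\<dots> \<le> (SUP y. \<bar>?h y\<bar>) * (SUP y. \<bar>?k y\<bar>)"
    by (intro mult_mono cSUP_upper bdd order_trans[OF _ cSUP_upper[OF _ bdd(1), of y]]) auto
  also have "\<dots> \<le> 1 / measure lebesgue (cube_at i x)"
    using gs cube_at_gen[of i x] unfolding generalized_haar_shift_def by blast
  finally show ?thesis by (simp add: measure_dyadic_cube)
qed

lemma partial_sum_eq: "shift_partial_sum h k N f x = gen_sum h k (- int N) (int N) f x"
proof -
  let ?g = "\<lambda>I. (\<integral>y. f y * k I y \<partial>lebesgue) * h I x"
  let ?A = "\<Union>i\<in>{- int N..int N}. dyadic_generation i" and ?B = "(\<lambda>i. cube_at i x) ` {- int N..int N}"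
  have "infsum ?g ?A = infsum ?g ?B"
  proof (rule infsum_cong_neutral)
    fix I assume I: "I \<in> ?A - ?B"
    then obtain i m where i: "i \<in> {- int N..int N}" "I = dyadic_cube i m" by (auto simp: dyadic_generation_def)
    have ic: "I = cube_at i (corner i m)" using i by simp
    have "x \<notin> I"
    proof
      assume "x \<in> I"
      then have "I = cube_at i x" using i by (simp add: dyadic_cube_eq)
      then show False using I i(1) by blast
    qed
    then have "h I x = 0" unfolding ic by (rule supp)
    then show "?g I = 0" by simp
  qed (use cube_at_gen in auto)
  also have "\<dots> = (\<Sum>I\<in>?B. ?g I)" by (rule infsum_finite) simp
  also have "\<dots> = gen_sum h k (- int N) (int N) f x"
    unfolding gen_sum_def by (rule sum.reindex_cong[OF _ refl]) (auto simp: inj_on_def dest: cube_at_inj)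
  finally show ?thesis by (simp add: shift_partial_sum_def)
qed

lemma gen_sum_const:
  assumes "idx (b + int \<kappa>) y = idx (b + int \<kappa>) x" shows "gen_sum h k a b f y = gen_sum h k a b f x"
  unfolding gen_sum_def
proof (intro sum.cong refl)
  fix i assume i: "i \<in> {a..b}"
  have "idx i y = idx i x" using idx_mono[OF assms, of i] i by auto
  moreover have "h (cube_at i x) y = h (cube_at i x) x"
    by (rule const(1)) (use idx_mono[OF assms, of "i + int \<kappa>"] i in auto)
  ultimately show "(LINT y'|lebesgue. f y' * k (cube_at i y) y') * h (cube_at i y) y =
      (LINT y|lebesgue. f y * k (cube_at i x) y) * h (cube_at i x) x" by simp
qed

lemma gen_sum_measurable [measurable]: "gen_sum h k a b f \<in> borel_measurable lebesgue"
proof -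
  have "gen_sum h k a b f = (\<lambda>x. gen_sum h k a b f (corner (b + int \<kappa>) (idx (b + int \<kappa>) x)))"
    by (rule ext, rule gen_sum_const[symmetric]) simp
  also have "\<dots> \<in> borel_measurable lebesgue" by measurable
  finally show ?thesis .
qed

end

section \<open>Powers and integrals of extended nonnegative reals\<close>

lemma epowr_ennreal: "0 \<le> x \<Longrightarrow> ennreal x epowr a = ennreal (x powr a)"
  by (simp add: epowr_def)

lemma epowr_top [simp]: "top epowr a = top"
  by (simp add: epowr_def)

lemma epowr_zero [simp]: "0 epowr a = 0"
  by (simp add: epowr_def)

lemma epowr_mono:
  assumes "0 \<le> a" "x \<le> y" shows "x epowr a \<le> y epowr a"
proof (cases y)
  case (real t)
  then obtain s where s: "x = ennreal s" "0 \<le> s" using assms(2) by (cases x) (auto simp: top_unique)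
  then show ?thesis using assms real by (auto simp: epowr_ennreal intro!: ennreal_leI powr_mono2)
qed simp

lemma epowr_epowr: "0 < a \<Longrightarrow> (x epowr a) epowr b = x epowr (a * b)"
  by (cases x) (auto simp: epowr_ennreal powr_powr)

lemma epowr_one [simp]: "x epowr 1 = x"
  by (cases x) (auto simp: epowr_ennreal)

lemma epowr_cancel: "0 < a \<Longrightarrow> (x epowr a) epowr (1 / a) = x"
  by (simp add: epowr_epowr)

lemma epowr_le_cancel: "0 < a \<Longrightarrow> x epowr a \<le> y epowr a \<Longrightarrow> x \<le> y"
  using epowr_mono[of "1 / a" "x epowr a" "y epowr a"] by (simp add: epowr_cancel)

lemma epowr_mult_ennreal:
  assumes "0 < a" "0 \<le> c" shows "(ennreal c * x) epowr a = ennreal (c powr a) * x epowr a"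
proof (cases x)
  case (real t)
  then show ?thesis using assms by (simp add: epowr_ennreal powr_mult flip: ennreal_mult)
next
  case top
  then show ?thesis using assms by (cases "c = 0") (auto simp: ennreal_mult_top epowr_ennreal)
qed

lemma epowr_measurable [measurable]:
  assumes [measurable]: "f \<in> borel_measurable M" shows "(\<lambda>x. f x epowr a) \<in> borel_measurable M"
  unfolding epowr_def by measurable

lemma L2_norm_eq: "L2_norm f = (\<integral>\<^sup>+x. ennreal ((f x)\<^sup>2) \<partial>lebesgue) epowr (1 / 2)"
  unfolding Lp_norm_def by (simp add: epowr_ennreal)

text \<open>
  The relation between the averages of a function and its weighted norm. It is used with \<open>u = 1\<close> to
  compare the masses of an atom, and with \<open>w = s = 1\<close> as the Cauchy-Schwarz inequality.
\<close>

lemma Holder_nn_integral: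
  fixes u w s :: "'a \<Rightarrow> real"
  assumes E [measurable]: "E \<in> sets M" and [measurable]: "u \<in> borel_measurable M" "w \<in> borel_measurable M" "s \<in> borel_measurable M"
    and u: "\<And>x. 0 \<le> u x" and p: "1 < p"
    and ws: "AE x in M. 0 < w x \<and> s x = w x powr (- 1 / (p - 1))"
    and a: "(\<integral>\<^sup>+x\<in>E. ennreal (u x powr p * w x) \<partial>M) \<le> ennreal a" "0 \<le> a"
    and b: "(\<integral>\<^sup>+x\<in>E. ennreal (s x) \<partial>M) \<le> ennreal b" "0 < b"
  shows "(\<integral>\<^sup>+x\<in>E. ennreal (u x) \<partial>M) \<le> ennreal (a powr (1 / p) * b powr (1 - 1 / p))"
proof (cases "a = 0")
  case True
  then have "(\<integral>\<^sup>+x. ennreal (u x powr p * w x) * indicator E x \<partial>M) = 0" using a by simp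
  then have "AE x in M. ennreal (u x powr p * w x) * indicator E x = 0"
    by (subst (asm) nn_integral_0_iff_AE) auto
  then have "AE x in M. ennreal (u x) * indicator E x = 0"
    using ws
  proof eventually_elim
    case (elim x)
    have "u x = 0" if "x \<in> E"
    proof (rule ccontr)
      assume "u x \<noteq> 0"
      then have "0 < u x powr p * w x" using elim u[of x] by simp
      then show False using elim that by (auto simp: ennreal_eq_0_iff)
    qed
    then show ?case by (auto simp: indicator_def)
  qed
  then have "(\<integral>\<^sup>+x. ennreal (u x) * indicator E x \<partial>M) = 0" by (subst nn_integral_0_iff_AE) auto
  then show ?thesis by simp
next
  case False
  then have a0: "0 < a" using a by simp
  define c where "c = a powr (1 / p) * b powr (1 - 1 / p)"
  have c: "0 < c" using a0 b by (simp add: c_def)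
  have "(\<integral>\<^sup>+x. ennreal (u x) * indicator E x \<partial>M) \<le>
     (\<integral>\<^sup>+x. ennreal (c / (p * a)) * (ennreal (u x powr p * w x) * indicator E x) +
       ennreal (c * (1 - 1 / p) / b) * (ennreal (s x) * indicator E x) \<partial>M)"
  proof (rule nn_integral_mono_AE, use ws in eventually_elim)
    case (elim x)
    have sp: "0 < s x" using elim by simp
    have "u x \<le> c / (p * a) * (u x powr p * w x) + c * (1 - 1 / p) / b * s x"
    proof (cases "u x = 0")
      case True
      then show ?thesis using c b p sp a0 elim by simp
    next
      case False
      then have up: "0 < u x" using u[of x] by simp
      have "- 1 / (p - 1) * (1 - 1 / p) = - (1 / p)" using p by (simp add: field_simps)
      then have "s x powr (1 - 1 / p) = w x powr (- (1 / p))" using elim by (simp add: powr_powr)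
      then have "u x = (u x powr p * w x) powr (1 / p) * s x powr (1 - 1 / p)"
        using elim p up by (simp add: powr_mult powr_powr mult.assoc powr_add[symmetric])
      also have "\<dots> = c * ((u x powr p * w x / a) powr (1 / p) * (s x / b) powr (1 - 1 / p))"
        using a0 b up sp elim by (simp add: c_def powr_divide)
      also have "\<dots> \<le> c * (1 / p * (u x powr p * w x / a) + (1 - 1 / p) * (s x / b))"
        using c p up sp elim a0 b by (intro mult_left_mono Youngs_inequality_0) auto
      finally show ?thesis by (simp add: algebra_simps diff_divide_distrib)
    qed
    then have "ennreal (u x) \<le> ennreal (c / (p * a) * (u x powr p * w x) + c * (1 - 1 / p) / b * s x)"
      by (rule ennreal_leI)
    also have "\<dots> = ennreal (c / (p * a)) * ennreal (u x powr p * w x) + ennreal (c * (1 - 1 / p) / b) * ennreal (s x)"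
    proof -
      have gen: "ennreal (\<alpha> * U + \<beta> * V) = ennreal \<alpha> * ennreal U + ennreal \<beta> * ennreal V"
        if "0 \<le> \<alpha>" "0 \<le> \<beta>" "0 \<le> U" "0 \<le> V" for \<alpha> \<beta> U V
        using that by (simp add: ennreal_plus ennreal_mult)
      show ?thesis by (rule gen) (use c p a0 b sp elim in auto)
    qed
    finally show ?case by (auto simp: indicator_def)
  qed
  also have "\<dots> = ennreal (c / (p * a)) * (\<integral>\<^sup>+x\<in>E. ennreal (u x powr p * w x) \<partial>M) +
       ennreal (c * (1 - 1 / p) / b) * (\<integral>\<^sup>+x\<in>E. ennreal (s x) \<partial>M)"
    by (subst nn_integral_add) (auto simp: nn_integral_cmult)
  also have "\<dots> \<le> ennreal (c / (p * a)) * ennreal a + ennreal (c * (1 - 1 / p) / b) * ennreal b"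
    using a(1) b(1) by (intro add_mono mult_left_mono) auto
  also have "\<dots> = ennreal (c / (p * a) * a + c * (1 - 1 / p) / b * b)"
    using c p a0 b by (simp add: ennreal_mult[symmetric] ennreal_plus[symmetric] del: ennreal_plus)
  also have "c / (p * a) * a + c * (1 - 1 / p) / b * b = c" using a0 b p by (simp add: field_simps)
  finally show ?thesis by (simp add: c_def)
qed

lemma nn_integral_dyadic_split:
  fixes m0 :: "int^'n" and G :: "real^'n \<Rightarrow> ennreal"
  assumes [measurable]: "G \<in> borel_measurable lebesgue"
  shows "(\<integral>\<^sup>+x\<in>dyadic_cube i m0. G x \<partial>lebesgue) =
    (\<Sum>m\<in>{m. \<forall>s. m $ s div 2 ^ d = m0 $ s}. \<integral>\<^sup>+x\<in>dyadic_cube (i + int d) m. G x \<partial>lebesgue)"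
proof -
  let ?D = "{m :: int^'n. \<forall>s. m $ s div 2 ^ d = m0 $ s}"
  have "G x * indicator (dyadic_cube i m0) x = (\<Sum>m\<in>?D. G x * indicator (dyadic_cube (i + int d) m) x)" for x
  proof -
    have "indicator (dyadic_cube i m0) x = (\<Sum>m\<in>?D. if m = idx (i + int d) x then 1 else 0 :: ennreal)"
      unfolding sum.delta[OF finite_descendants[of d m0]] using idx_coarser[of i x _ d]
      by (auto simp: indicator_def dyadic_cube_eq vec_eq_iff)
    also have "\<dots> = (\<Sum>m\<in>?D. indicator (dyadic_cube (i + int d) m) x)"
      by (intro sum.cong refl) (auto simp: dyadic_cube_eq indicator_def)
    finally show ?thesis by (simp add: sum_distrib_left)
  qed
  then show ?thesis by (simp add: nn_integral_sum)
qed

section \<open>Truncations of a Haar shift are bounded on square integrable functions\<close>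

lemma sum_inverse_vol: "(\<Sum>i\<in>{a - int d..a - 1}. 1 / vol TYPE('n::finite) i) \<le> 1 / vol TYPE('n) a"
proof (induction d arbitrary: a)
  case 0
  show ?case by (simp add: less_imp_le)
next
  case (Suc d)
  have "{a - int (Suc d)..a - 1} = insert (a - 1) {a - 1 - int d..a - 1 - 1}" by auto
  then have "(\<Sum>i\<in>{a - int (Suc d)..a - 1}. 1 / vol TYPE('n) i) =
      1 / vol TYPE('n) (a - 1) + (\<Sum>i\<in>{a - 1 - int d..a - 1 - 1}. 1 / vol TYPE('n) i)" by simp
  also have "\<dots> \<le> 2 / vol TYPE('n) (a - 1)" using Suc.IH[of "a - 1"] by simp
  also have "\<dots> \<le> 1 / vol TYPE('n) a"
  proof -
    have "(2::real) ^ 1 \<le> 2 ^ CARD('n)" by (intro power_increasing) (auto simp: Suc_le_eq)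
    then have "2 * vol TYPE('n) a \<le> vol TYPE('n) (a - 1)"
      using vol_Suc[of "a - 1", where 'n='n] vol_pos[of a, where 'n='n]
      by (metis diff_add_cancel mult.commute mult_right_mono less_imp_le power_one_right)
    then show ?thesis using vol_pos[of a, where 'n='n] vol_pos[of "a - 1", where 'n='n] by (simp add: field_simps)
  qed
  finally show ?case .
qed

context haar
begin

lemma term_bound:
  assumes f: "integrable lebesgue f"
  shows "\<bar>(\<integral>y. f y * k (cube_at i x) y \<partial>lebesgue) * h (cube_at i x) x\<bar> \<le> 1 / vol TYPE('n) i * (\<integral>y. \<bar>f y\<bar> \<partial>lebesgue)"
proof -
  have "\<bar>(\<integral>y. f y * k (cube_at i x) y \<partial>lebesgue) * h (cube_at i x) x\<bar>
      = \<bar>\<integral>y. f y * k (cube_at i x) y * h (cube_at i x) x \<partial>lebesgue\<bar>" by simp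
  also have "\<dots> \<le> (\<integral>y. \<bar>f y * k (cube_at i x) y * h (cube_at i x) x\<bar> \<partial>lebesgue)"
    by (rule integral_abs_bound)
  also have "\<dots> \<le> (\<integral>y. 1 / vol TYPE('n) i * \<bar>f y\<bar> \<partial>lebesgue)"
  proof (rule integral_mono')
    show "integrable lebesgue (\<lambda>y. 1 / vol TYPE('n) i * \<bar>f y\<bar>)" using f by auto
    fix y
    have "\<bar>f y * k (cube_at i x) y * h (cube_at i x) x\<bar> = \<bar>h (cube_at i x) x * k (cube_at i x) y\<bar> * \<bar>f y\<bar>"
      by (simp add: abs_mult)
    also have "\<dots> \<le> 1 / vol TYPE('n) i * \<bar>f y\<bar>" by (intro mult_right_mono product_bound) simp
    finally show "\<bar>f y * k (cube_at i x) y * h (cube_at i x) x\<bar> \<le> 1 / vol TYPE('n) i * \<bar>f y\<bar>" .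
  qed (simp add: less_imp_le)
  finally show ?thesis by simp
qed

text \<open>
  On the cube, the sum over the generations from \<open>a\<close> on is the full partial sum minus the
  contribution of the larger cubes. The former approaches the shift, which is a contraction; the
  latter is bounded by the average \<open>A\<close> of \<open>\<bar>f\<bar>\<close>, as the sizes of the kernels form a geometric
  series.
\<close>

lemma local_L2:
  fixes f :: "real^'n \<Rightarrow> real"
  assumes f: "integrable lebesgue f" and fin: "(\<integral>\<^sup>+x. ennreal ((f x)\<^sup>2) \<partial>lebesgue) < \<infinity>"
    and off: "\<And>x. x \<notin> dyadic_cube a m \<Longrightarrow> f x = 0" and \<epsilon>: "0 < (\<epsilon> :: real)"
  shows "\<forall>\<^sub>F M in sequentially. (\<integral>\<^sup>+x\<in>dyadic_cube a m. ennreal ((gen_sum h k a (int M) f x)\<^sup>2) \<partial>lebesgue) \<le>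
    6 * (\<integral>\<^sup>+x. ennreal ((f x)\<^sup>2) \<partial>lebesgue) + ennreal \<epsilon>"
proof -
  let ?Q = "dyadic_cube a m"
  let ?v = "vol TYPE('n) a"
  define F where "F = (\<integral>\<^sup>+x. ennreal ((f x)\<^sup>2) \<partial>lebesgue)"
  have [measurable]: "f \<in> borel_measurable lebesgue" using f by auto
  have "L2_norm f < \<infinity>" unfolding L2_norm_eq epowr_def using fin by auto
  from bspec[OF conjunct2[OF gs[unfolded generalized_haar_shift_def]] \<open>f \<in> borel_measurable lebesgue\<close>, rule_format, OF this]
  obtain g where [measurable]: "g \<in> borel_measurable lebesgue"
    and lim: "(\<lambda>N. L2_norm (\<lambda>x. shift_partial_sum h k N f x - g x)) \<longlonglongrightarrow> 0"
    and g: "L2_norm g \<le> L2_norm f"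
    by (elim bexE conjE) (rule that)
  have gF: "(\<integral>\<^sup>+x. ennreal ((g x)\<^sup>2) \<partial>lebesgue) \<le> F"
    using g unfolding L2_norm_eq F_def by (rule epowr_le_cancel[rotated]) simp
  have "0 < ennreal (\<epsilon> / 4) epowr (1 / 2)" using \<epsilon> by (simp add: epowr_ennreal)
  then have "\<forall>\<^sub>F M in sequentially. L2_norm (\<lambda>x. shift_partial_sum h k M f x - g x) < ennreal (\<epsilon> / 4) epowr (1 / 2)"
    by (rule order_tendstoD(2)[OF lim])
  then have ev: "\<forall>\<^sub>F M in sequentially. (\<integral>\<^sup>+x. ennreal ((shift_partial_sum h k M f x - g x)\<^sup>2) \<partial>lebesgue) \<le> ennreal (\<epsilon> / 4)"
  proof eventually_elim
    case (elim M)
    show ?case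
    proof (rule epowr_le_cancel)
      show "(\<integral>\<^sup>+x. ennreal ((shift_partial_sum h k M f x - g x)\<^sup>2) \<partial>lebesgue) epowr (1 / 2) \<le> ennreal (\<epsilon> / 4) epowr (1 / 2)"
        using less_imp_le[OF elim] by (simp only: L2_norm_eq)
    qed simp
  qed
  define A where "A = 1 / ?v * (\<integral>y. \<bar>f y\<bar> \<partial>lebesgue)"
  have A0: "0 \<le> A" by (simp add: A_def less_imp_le)
  have A2: "ennreal (A\<^sup>2) * ennreal ?v \<le> F"
  proof -
    have Ff: "F < \<infinity>" using fin by (simp add: F_def)
    then obtain t where t: "F = ennreal t" "0 \<le> t" by (cases F) auto
    have "(\<integral>\<^sup>+x\<in>?Q. ennreal \<bar>f x\<bar> \<partial>lebesgue) \<le> ennreal (t powr (1 / 2) * ?v powr (1 - 1 / 2))"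
    proof (rule Holder_nn_integral[where w="\<lambda>_. 1" and s="\<lambda>_. 1"])
      have "(\<integral>\<^sup>+x\<in>?Q. ennreal (\<bar>f x\<bar> powr 2 * 1) \<partial>lebesgue) \<le> F"
        unfolding F_def by (intro nn_integral_mono) (auto simp: indicator_def)
      then show "(\<integral>\<^sup>+x\<in>?Q. ennreal (\<bar>f x\<bar> powr 2 * 1) \<partial>lebesgue) \<le> ennreal t" using t by simp
      show "(\<integral>\<^sup>+x\<in>?Q. ennreal 1 \<partial>lebesgue) \<le> ennreal ?v" by (simp add: emeasure_dyadic_cube)
    qed (use t in auto)
    also have "(\<integral>\<^sup>+x\<in>?Q. ennreal \<bar>f x\<bar> \<partial>lebesgue) = (\<integral>\<^sup>+x. ennreal \<bar>f x\<bar> \<partial>lebesgue)"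
      by (intro nn_integral_cong) (auto simp: indicator_def off)
    also have "\<dots> = ennreal (\<integral>x. \<bar>f x\<bar> \<partial>lebesgue)" using f by (intro nn_integral_eq_integral) auto
    finally have "(\<integral>x. \<bar>f x\<bar> \<partial>lebesgue) \<le> t powr (1 / 2) * ?v powr (1 / 2)" by simp
    then have "(\<integral>x. \<bar>f x\<bar> \<partial>lebesgue)\<^sup>2 \<le> (t powr (1 / 2) * ?v powr (1 / 2))\<^sup>2" by (intro power_mono) auto
    also have "\<dots> = t * ?v" using t by (simp add: powr_half_sqrt power_mult_distrib less_imp_le)
    finally have "A\<^sup>2 * ?v \<le> t"
      using vol_pos[of a, where 'n='n] t by (simp add: A_def power_mult_distrib power_divide power2_eq_square field_simps)
    then show ?thesis using t by (simp add: ennreal_mult[symmetric] less_imp_le)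
  qed
  show ?thesis
    using ev eventually_ge_at_top[of "nat \<bar>a\<bar>"]
  proof eventually_elim
    case (elim M)
    let ?S = "\<lambda>x. shift_partial_sum h k M f x"
    have pt: "ennreal ((gen_sum h k a (int M) f x)\<^sup>2) * indicator ?Q x \<le>
      4 * ennreal ((?S x - g x)\<^sup>2) + 4 * ennreal ((g x)\<^sup>2) + 2 * (ennreal (A\<^sup>2) * indicator ?Q x)" for x
    proof (cases "x \<in> ?Q")
      case True
      have "{- int M..int M} = {- int M..a - 1} \<union> {a..int M}" using elim(2) by auto
      then have split: "?S x = gen_sum h k (- int M) (a - 1) f x + gen_sum h k a (int M) f x"
        unfolding partial_sum_eq gen_sum_def by (subst sum.union_disjoint[symmetric]) auto
      have "\<bar>gen_sum h k (- int M) (a - 1) f x\<bar> \<le> (\<Sum>i\<in>{- int M..a - 1}. 1 / vol TYPE('n) i * (\<integral>y. \<bar>f y\<bar> \<partial>lebesgue))"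
        unfolding gen_sum_def by (rule order_trans[OF sum_abs]) (intro sum_mono term_bound f)
      also have "\<dots> = (\<Sum>i\<in>{a - int (nat (a + int M))..a - 1}. 1 / vol TYPE('n) i) * (\<integral>y. \<bar>f y\<bar> \<partial>lebesgue)"
        using elim(2) by (simp add: sum_distrib_right)
      also have "\<dots> \<le> A" unfolding A_def by (intro mult_right_mono sum_inverse_vol) simp
      finally have "\<bar>gen_sum h k (- int M) (a - 1) f x\<bar> \<le> A" .
      then have "(gen_sum h k (- int M) (a - 1) f x)\<^sup>2 \<le> A\<^sup>2" using A0 by (simp add: abs_le_square_iff[symmetric])
      moreover have "(X - Y)\<^sup>2 \<le> 2 * X\<^sup>2 + 2 * Y\<^sup>2" "(X + Y)\<^sup>2 \<le> 2 * X\<^sup>2 + 2 * Y\<^sup>2" for X Y :: real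
        using sum_squares_bound[of X Y] sum_squares_bound[of X "- Y"] by (simp_all add: power2_eq_square algebra_simps)
      note sq = this
      have "(gen_sum h k a (int M) f x)\<^sup>2 \<le> 2 * (?S x)\<^sup>2 + 2 * (gen_sum h k (- int M) (a - 1) f x)\<^sup>2"
        using sq(1)[of "?S x" "gen_sum h k (- int M) (a - 1) f x"] split by simp
      moreover have "(?S x)\<^sup>2 \<le> 2 * (?S x - g x)\<^sup>2 + 2 * (g x)\<^sup>2" using sq(2)[of "?S x - g x" "g x"] by simp
      ultimately have "(gen_sum h k a (int M) f x)\<^sup>2 \<le> 4 * (?S x - g x)\<^sup>2 + 4 * (g x)\<^sup>2 + 2 * A\<^sup>2" by linarith
      then have "ennreal ((gen_sum h k a (int M) f x)\<^sup>2) \<le> ennreal (4 * (?S x - g x)\<^sup>2 + 4 * (g x)\<^sup>2 + 2 * A\<^sup>2)"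
        by (rule ennreal_leI)
      also have "\<dots> = 4 * ennreal ((?S x - g x)\<^sup>2) + 4 * ennreal ((g x)\<^sup>2) + 2 * ennreal (A\<^sup>2)"
        by (simp add: ennreal_mult)
      finally show ?thesis using True by simp
    qed simp
    have [measurable]: "?S \<in> borel_measurable lebesgue" unfolding partial_sum_eq by measurable
    have "(\<integral>\<^sup>+x\<in>?Q. ennreal ((gen_sum h k a (int M) f x)\<^sup>2) \<partial>lebesgue) \<le>
      (\<integral>\<^sup>+x. 4 * ennreal ((?S x - g x)\<^sup>2) + 4 * ennreal ((g x)\<^sup>2) + 2 * (ennreal (A\<^sup>2) * indicator ?Q x) \<partial>lebesgue)"
      by (intro nn_integral_mono pt)
    also have "\<dots> = 4 * (\<integral>\<^sup>+x. ennreal ((?S x - g x)\<^sup>2) \<partial>lebesgue) + 4 * (\<integral>\<^sup>+x. ennreal ((g x)\<^sup>2) \<partial>lebesgue)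
       + 2 * (ennreal (A\<^sup>2) * ennreal ?v)"
      by (simp add: nn_integral_add nn_integral_cmult emeasure_dyadic_cube)
    also have "\<dots> \<le> 4 * ennreal (\<epsilon> / 4) + 4 * F + 2 * F"
      by (intro add_mono mult_left_mono elim(1) gF A2) auto
    also have "\<dots> = 6 * F + ennreal \<epsilon>"
    proof -
      have "4 * ennreal (\<epsilon> / 4) = ennreal (4 * (\<epsilon> / 4))" using \<epsilon> by (subst ennreal_mult) auto
      moreover have "4 * F + 2 * F = 6 * F" by (simp flip: distrib_right)
      ultimately show ?thesis by (simp add: add.assoc add.commute)
    qed
    finally show ?case by (simp add: F_def)
  qed
qed

lemma gen_sum_local:
  assumes "x \<in> dyadic_cube a m" "\<And>y. y \<in> dyadic_cube a m \<Longrightarrow> f y = g y"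
  shows "gen_sum h k a b f x = gen_sum h k a b g x"
  unfolding gen_sum_def
proof (intro sum.cong refl)
  fix i assume i: "i \<in> {a..b}"
  have eq: "f y * k (cube_at i x) y = g y * k (cube_at i x) y" for y
  proof (cases "y \<in> cube_at i x")
    case True
    then have "idx a y = idx a x" using i idx_mono[of i y x a] by (auto simp: mem_cube_at)
    then show ?thesis using assms by (auto simp: dyadic_cube_eq)
  qed (simp add: supp)
  show "(LINT y|lebesgue. f y * k (cube_at i x) y) * h (cube_at i x) x =
      (LINT y|lebesgue. g y * k (cube_at i x) y) * h (cube_at i x) x" unfolding eq ..
qed

text \<open>
  The cubes of generation \<open>a\<close> inside the given cube do not interact, so the local bounds add up.
\<close>

lemma eventually_L2:
  fixes f :: "real^'n \<Rightarrow> real"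
  assumes f: "integrable lebesgue f" and fin: "(\<integral>\<^sup>+x. ennreal ((f x)\<^sup>2) \<partial>lebesgue) < \<infinity>"
    and \<epsilon>: "0 < (\<epsilon> :: real)" and a: "i0 \<le> a"
  shows "\<forall>\<^sub>F M in sequentially. (\<integral>\<^sup>+x\<in>dyadic_cube i0 m0. ennreal ((gen_sum h k a (int M) f x)\<^sup>2) \<partial>lebesgue) \<le>
    6 * (\<integral>\<^sup>+x. ennreal ((f x)\<^sup>2) \<partial>lebesgue) + ennreal \<epsilon>"
proof -
  have [measurable]: "f \<in> borel_measurable lebesgue" using f by auto
  have f2: "(\<lambda>x. ennreal ((f x)\<^sup>2)) \<in> borel_measurable lebesgue" by measurable
  define d where "d = nat (a - i0)"
  have ad: "i0 + int d = a" using a by (simp add: d_def)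
  define D where "D = {m :: int^'n. \<forall>s. m $ s div 2 ^ d = m0 $ s}"
  have fD: "finite D" unfolding D_def by (rule finite_descendants)
  define \<epsilon>' where "\<epsilon>' = \<epsilon> / (real (card D) + 1)"
  have \<epsilon>': "0 < \<epsilon>'" "real (card D) * \<epsilon>' \<le> \<epsilon>" using \<epsilon> by (auto simp: \<epsilon>'_def field_simps)
  define fm where "fm m x = f x * indicator (dyadic_cube a m) x" for m x
  have fm: "\<forall>\<^sub>F M in sequentially. (\<integral>\<^sup>+x\<in>dyadic_cube a m. ennreal ((gen_sum h k a (int M) (fm m) x)\<^sup>2) \<partial>lebesgue) \<le>
    6 * (\<integral>\<^sup>+x. ennreal ((fm m x)\<^sup>2) \<partial>lebesgue) + ennreal \<epsilon>'" for m
  proof (rule local_L2[OF _ _ _ \<epsilon>'(1)])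
    show "integrable lebesgue (fm m)"
      unfolding fm_def using f by (intro integrable_real_mult_indicator) auto
    have "(\<integral>\<^sup>+x. ennreal ((fm m x)\<^sup>2) \<partial>lebesgue) \<le> (\<integral>\<^sup>+x. ennreal ((f x)\<^sup>2) \<partial>lebesgue)"
      by (intro nn_integral_mono) (auto simp: fm_def indicator_def)
    then show "(\<integral>\<^sup>+x. ennreal ((fm m x)\<^sup>2) \<partial>lebesgue) < \<infinity>" using fin by simp
  qed (simp add: fm_def)
  have "\<forall>\<^sub>F M in sequentially. \<forall>m\<in>D. (\<integral>\<^sup>+x\<in>dyadic_cube a m. ennreal ((gen_sum h k a (int M) (fm m) x)\<^sup>2) \<partial>lebesgue) \<le>
    6 * (\<integral>\<^sup>+x. ennreal ((fm m x)\<^sup>2) \<partial>lebesgue) + ennreal \<epsilon>'"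
    using fm by (intro eventually_ball_finite fD) auto
  then show ?thesis
  proof eventually_elim
    case (elim M)
    have "(\<integral>\<^sup>+x\<in>dyadic_cube i0 m0. ennreal ((gen_sum h k a (int M) f x)\<^sup>2) \<partial>lebesgue) =
       (\<Sum>m\<in>D. \<integral>\<^sup>+x\<in>dyadic_cube a m. ennreal ((gen_sum h k a (int M) f x)\<^sup>2) \<partial>lebesgue)"
      unfolding D_def ad[symmetric] by (rule nn_integral_dyadic_split) measurable
    also have "\<dots> = (\<Sum>m\<in>D. \<integral>\<^sup>+x\<in>dyadic_cube a m. ennreal ((gen_sum h k a (int M) (fm m) x)\<^sup>2) \<partial>lebesgue)"
    proof (intro sum.cong refl nn_integral_cong)
      fix m x
      show "ennreal ((gen_sum h k a (int M) f x)\<^sup>2) * indicator (dyadic_cube a m) x =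
        ennreal ((gen_sum h k a (int M) (fm m) x)\<^sup>2) * indicator (dyadic_cube a m) x"
        using gen_sum_local[of x a m f "fm m" "int M"] by (auto simp: fm_def indicator_def)
    qed
    also have "\<dots> \<le> (\<Sum>m\<in>D. 6 * (\<integral>\<^sup>+x. ennreal ((fm m x)\<^sup>2) \<partial>lebesgue) + ennreal \<epsilon>')"
      using elim by (intro sum_mono) auto
    also have "\<dots> = 6 * (\<Sum>m\<in>D. \<integral>\<^sup>+x. ennreal ((fm m x)\<^sup>2) \<partial>lebesgue) + ennreal (real (card D) * \<epsilon>')"
      using \<epsilon>' by (simp add: sum.distrib sum_distrib_left ennreal_mult ennreal_of_nat_eq_real_of_nat)
    also have "(\<Sum>m\<in>D. \<integral>\<^sup>+x. ennreal ((fm m x)\<^sup>2) \<partial>lebesgue) = (\<integral>\<^sup>+x\<in>dyadic_cube i0 m0. ennreal ((f x)\<^sup>2) \<partial>lebesgue)"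
      unfolding nn_integral_dyadic_split[OF f2, of i0 m0 d, unfolded ad] D_def
      by (intro sum.cong refl nn_integral_cong) (auto simp: fm_def indicator_def)
    also have "6 * (\<integral>\<^sup>+x\<in>dyadic_cube i0 m0. ennreal ((f x)\<^sup>2) \<partial>lebesgue) + ennreal (real (card D) * \<epsilon>') \<le>
       6 * (\<integral>\<^sup>+x. ennreal ((f x)\<^sup>2) \<partial>lebesgue) + ennreal \<epsilon>"
      using \<epsilon>' by (intro add_mono mult_left_mono nn_integral_mono ennreal_leI) (auto simp: indicator_def)
    finally show ?case .
  qed
qed

text \<open>
  A finite range of generations is the difference of two ranges that are open towards small cubes.
\<close>

theorem gen_sum_L2:
  fixes f :: "real^'n \<Rightarrow> real"
  assumes f: "integrable lebesgue f" and fin: "(\<integral>\<^sup>+x. ennreal ((f x)\<^sup>2) \<partial>lebesgue) < \<infinity>"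
    and a: "i0 \<le> a"
  shows "(\<integral>\<^sup>+x\<in>dyadic_cube i0 m0. ennreal ((gen_sum h k a b f x)\<^sup>2) \<partial>lebesgue) \<le>
    24 * (\<integral>\<^sup>+x. ennreal ((f x)\<^sup>2) \<partial>lebesgue)"
proof (cases "a \<le> b")
  case False
  then have "gen_sum h k a b f = (\<lambda>x. 0)" by (auto simp: gen_sum_def)
  then show ?thesis by simp
next
  case True
  let ?F = "(\<integral>\<^sup>+x. ennreal ((f x)\<^sup>2) \<partial>lebesgue)" and ?Q = "dyadic_cube i0 m0"
  have [measurable]: "f \<in> borel_measurable lebesgue" using f by auto
  have bound: "(\<integral>\<^sup>+x\<in>?Q. ennreal ((gen_sum h k a b f x)\<^sup>2) \<partial>lebesgue) \<le> 24 * ?F + ennreal e" if e: "0 < e" for e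
  proof -
    have "\<forall>\<^sub>F M in sequentially. b \<le> int M \<and>
      (\<integral>\<^sup>+x\<in>?Q. ennreal ((gen_sum h k a (int M) f x)\<^sup>2) \<partial>lebesgue) \<le> 6 * ?F + ennreal (e / 4) \<and>
      (\<integral>\<^sup>+x\<in>?Q. ennreal ((gen_sum h k (b + 1) (int M) f x)\<^sup>2) \<partial>lebesgue) \<le> 6 * ?F + ennreal (e / 4)"
    proof (intro eventually_conj eventually_L2 f fin)
      show "\<forall>\<^sub>F M in sequentially. b \<le> int M"
        using eventually_ge_at_top[of "nat \<bar>b\<bar>"] by eventually_elim simp
    qed (use e a True in auto)
    then obtain M where M: "b \<le> int M"
      "(\<integral>\<^sup>+x\<in>?Q. ennreal ((gen_sum h k a (int M) f x)\<^sup>2) \<partial>lebesgue) \<le> 6 * ?F + ennreal (e / 4)"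
      "(\<integral>\<^sup>+x\<in>?Q. ennreal ((gen_sum h k (b + 1) (int M) f x)\<^sup>2) \<partial>lebesgue) \<le> 6 * ?F + ennreal (e / 4)"
      by (metis (mono_tags, lifting) eventually_sequentially order_refl)
    have pt: "ennreal ((gen_sum h k a b f x)\<^sup>2) \<le>
      2 * ennreal ((gen_sum h k a (int M) f x)\<^sup>2) + 2 * ennreal ((gen_sum h k (b + 1) (int M) f x)\<^sup>2)" for x
    proof -
      have "{a..int M} = {a..b} \<union> {b + 1..int M}" using True M(1) by auto
      then have "gen_sum h k a (int M) f x = gen_sum h k a b f x + gen_sum h k (b + 1) (int M) f x"
        unfolding gen_sum_def by (subst sum.union_disjoint[symmetric]) auto
      then have "gen_sum h k a b f x = gen_sum h k a (int M) f x - gen_sum h k (b + 1) (int M) f x" by simp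
      moreover have "(X - Y)\<^sup>2 \<le> 2 * X\<^sup>2 + 2 * Y\<^sup>2" for X Y :: real
        using sum_squares_bound[of X "- Y"] by (simp add: power2_eq_square algebra_simps)
      ultimately have "(gen_sum h k a b f x)\<^sup>2 \<le>
        2 * (gen_sum h k a (int M) f x)\<^sup>2 + 2 * (gen_sum h k (b + 1) (int M) f x)\<^sup>2" by simp
      then have "ennreal ((gen_sum h k a b f x)\<^sup>2) \<le>
        ennreal (2 * (gen_sum h k a (int M) f x)\<^sup>2 + 2 * (gen_sum h k (b + 1) (int M) f x)\<^sup>2)" by (rule ennreal_leI)
      then show ?thesis by (simp add: ennreal_mult)
    qed
    have "(\<integral>\<^sup>+x\<in>?Q. ennreal ((gen_sum h k a b f x)\<^sup>2) \<partial>lebesgue) \<le>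
      (\<integral>\<^sup>+x. 2 * (ennreal ((gen_sum h k a (int M) f x)\<^sup>2) * indicator ?Q x) +
         2 * (ennreal ((gen_sum h k (b + 1) (int M) f x)\<^sup>2) * indicator ?Q x) \<partial>lebesgue)"
      using pt by (intro nn_integral_mono) (auto simp: indicator_def)
    also have "\<dots> = 2 * (\<integral>\<^sup>+x\<in>?Q. ennreal ((gen_sum h k a (int M) f x)\<^sup>2) \<partial>lebesgue) +
        2 * (\<integral>\<^sup>+x\<in>?Q. ennreal ((gen_sum h k (b + 1) (int M) f x)\<^sup>2) \<partial>lebesgue)"
      by (simp add: nn_integral_add nn_integral_cmult)
    also have "\<dots> \<le> 2 * (6 * ?F + ennreal (e / 4)) + 2 * (6 * ?F + ennreal (e / 4))"
      by (intro add_mono mult_left_mono M) auto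
    also have "\<dots> = 24 * ?F + ennreal e"
    proof -
      have e4: "4 * ennreal (e / 4) = ennreal (4 * (e / 4))" using e by (subst ennreal_mult) auto
      have Y: "2 * Y + 2 * Y = 4 * Y" for Y :: ennreal by (simp flip: distrib_right)
      have F: "4 * (6 * ?F + z) = 24 * ?F + 4 * z" for z by (simp add: distrib_left flip: mult.assoc)
      show ?thesis unfolding Y F e4 by simp
    qed
    finally show ?thesis .
  qed
  show ?thesis by (rule ennreal_le_epsilon) (rule bound)
qed

end

section \<open>The tree of dyadic subcubes of a dyadic cube\<close>

lemma div_power_mono:
  fixes x y :: int
  assumes "x div 2 ^ a = y div 2 ^ a" "a \<le> b" shows "x div 2 ^ b = y div 2 ^ b"
proof -
  have "(2::int) ^ b = 2 ^ a * 2 ^ (b - a)" using assms(2) by (simp flip: power_add)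
  then show ?thesis using assms(1) by (simp add: zdiv_zmult2_eq)
qed

text \<open>
  The cubes of generations \<open>- N\<close> to \<open>M = N + \<kappa>\<close> inside the cube of generation \<open>- N\<close> with index \<open>m0\<close>.
  An atom is the index of a cube of generation \<open>M\<close>, on which all functions of the generations up to
  \<open>N\<close> are constant; the cell of level \<open>l\<close> stands for a cube of generation \<open>l - N\<close>.
\<close>

locale grid =
  fixes N \<kappa> :: nat and m0 :: "int^'n::finite"
  assumes \<kappa>: "1 \<le> \<kappa>"
begin

abbreviation "L \<equiv> 2 * N + \<kappa>"
abbreviation "M \<equiv> int N + int \<kappa>"

definition X :: "(int^'n) set" where
  "X = {m. \<forall>s. m $ s div 2 ^ L = m0 $ s}"

definition c :: "nat \<Rightarrow> int^'n \<Rightarrow> (int^'n) set" where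
  "c l m = {m'. \<forall>s. m' $ s div 2 ^ (L - l) = m $ s div 2 ^ (L - l)}"

sublocale tree X c L
proof
  show "finite X" unfolding X_def by (rule finite_descendants)
  fix x :: "int^'n" and l assume x: "x \<in> X"
  show "c l x \<subseteq> X"
  proof
    fix y assume "y \<in> c l x"
    then have "y $ s div 2 ^ (L - l) = x $ s div 2 ^ (L - l)" for s by (simp add: c_def)
    then have "y $ s div 2 ^ L = x $ s div 2 ^ L" for s by (rule div_power_mono) simp
    then show "y \<in> X" using x by (simp add: X_def)
  qed
  show "x \<in> c l x" by (simp add: c_def)
  show "c l y = c l x" if "y \<in> c l x" for y using that by (auto simp: c_def)
  show "c (Suc l) x \<subseteq> c l x"
  proof
    fix y assume "y \<in> c (Suc l) x"
    then have "y $ s div 2 ^ (L - Suc l) = x $ s div 2 ^ (L - Suc l)" for s by (simp add: c_def)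
    then have "y $ s div 2 ^ (L - l) = x $ s div 2 ^ (L - l)" for s by (rule div_power_mono) simp
    then show "y \<in> c l x" by (simp add: c_def)
  qed
  show "c L x = {x}" by (auto simp: c_def vec_eq_iff)
qed

lemma root: "\<forall>x\<in>X. c 0 x = X"
  by (auto simp: c_def X_def)

lemma idx_level: "l \<le> L \<Longrightarrow> idx (int l - int N) x $ s = idx M x $ s div 2 ^ (L - l)"
proof -
  assume l: "l \<le> L"
  have "int l - int N + int (L - l) = M" using l by simp
  then show ?thesis using idx_coarser[of "int l - int N" x s "L - l"] by simp
qed

lemma mem_c: "l \<le> L \<Longrightarrow> idx M y \<in> c l (idx M x) \<longleftrightarrow> idx (int l - int N) y = idx (int l - int N) x"
  by (simp add: c_def idx_level vec_eq_iff)

lemma integral_cell: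
  assumes "G \<in> borel_measurable lebesgue" and l: "l \<le> L"
  shows "(\<integral>\<^sup>+x\<in>cube_at (int l - int N) z. G x \<partial>lebesgue) =
    (\<Sum>m\<in>c l (idx M z). \<integral>\<^sup>+x\<in>dyadic_cube M m. G x \<partial>lebesgue)"
proof -
  have "int l - int N + int (L - l) = M" using l by simp
  moreover have "{m. \<forall>s. m $ s div 2 ^ (L - l) = idx (int l - int N) z $ s} = c l (idx M z)"
    using l by (simp add: c_def idx_level)
  ultimately show ?thesis
    using nn_integral_dyadic_split[OF assms(1), of "int l - int N" "idx (int l - int N) z" "L - l"] by simp
qed

lemma integral_root:
  assumes "G \<in> borel_measurable lebesgue"
  shows "(\<integral>\<^sup>+x\<in>dyadic_cube (- int N) m0. G x \<partial>lebesgue) = (\<Sum>m\<in>X. \<integral>\<^sup>+x\<in>dyadic_cube M m. G x \<partial>lebesgue)"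
proof -
  have e: "- int N + int L = M" by simp
  show ?thesis using nn_integral_dyadic_split[OF assms, of "- int N" m0 L] unfolding e X_def .
qed

definition \<mu> :: "int^'n \<Rightarrow> real" where "\<mu> m = vol TYPE('n) M"

lemma \<mu>_gt0 [simp]: "0 < \<mu> m"
  by (simp add: \<mu>_def)

lemma sum_\<mu>:
  assumes l: "l \<le> L" shows "sum \<mu> (c l m) = vol TYPE('n) (int l - int N)"
proof -
  let ?z = "corner M m"
  have "ennreal (vol TYPE('n) (int l - int N)) = (\<integral>\<^sup>+x\<in>cube_at (int l - int N) ?z. 1 \<partial>lebesgue)"
    by (simp add: emeasure_dyadic_cube)
  also have "\<dots> = (\<Sum>m\<in>c l (idx M ?z). \<integral>\<^sup>+x\<in>dyadic_cube M m. 1 \<partial>lebesgue)"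
    by (rule integral_cell) (use l in auto)
  also have "\<dots> = ennreal (sum \<mu> (c l m))"
    by (simp add: emeasure_dyadic_cube \<mu>_def less_imp_le ennreal_mult ennreal_of_nat_eq_real_of_nat)
  finally show ?thesis by (simp add: less_imp_le sum_nonneg)
qed

lemma doubling: "x \<in> X \<Longrightarrow> sum \<mu> (c l x) \<le> 2 ^ CARD('n) * sum \<mu> (c (Suc l) x)"
proof (cases "l < L")
  case True
  have e: "int (Suc l) - int N = int l - int N + 1" by simp
  show ?thesis
    using True vol_Suc[of "int l - int N", where 'n='n] by (simp only: sum_\<mu> e mult.commute Suc_leI less_imp_le order_refl)
next
  case False
  assume x: "x \<in> X"
  have "c l x = {x}" "c (Suc l) x = {x}" using c_beyond[OF x] False by auto
  moreover have "1 * \<mu> x \<le> 2 ^ CARD('n) * \<mu> x" by (intro mult_right_mono) (auto simp: less_imp_le)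
  ultimately show ?thesis by simp
qed

text \<open>
  For levels beyond \<open>2 * N\<close>, the generations finer than \<open>N\<close>, the functions need not be constant on
  atoms; there the shift is cut off.
\<close>

definition h_atom :: "'n cube_family \<Rightarrow> nat \<Rightarrow> int^'n \<Rightarrow> real" where
  "h_atom h l m = (if l \<le> 2 * N then h (cube_at (int l - int N) (corner M m)) (corner M m) else 0)"

definition k_atom :: "'n cube_family \<Rightarrow> nat \<Rightarrow> int^'n \<Rightarrow> real" where
  "k_atom k l m = k (cube_at (int l - int N) (corner M m)) (corner M m)"

lemma cube_corner: "l \<le> L \<Longrightarrow> m' \<in> c l m \<Longrightarrow> cube_at (int l - int N) (corner M m') = cube_at (int l - int N) (corner M m)"
  using mem_c[of l "corner M m'" "corner M m"] by simp

lemma discrete_shift: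
  fixes h k :: "nat \<Rightarrow> 'n cube_family"
  assumes hk: "\<And>j. haar \<kappa> (h j) (k j)" and r: "1 < r"
  shows "shift_tree X c L \<mu> (2 ^ CARD('n)) \<kappa> r (\<lambda>j. h_atom (h j)) (\<lambda>j. k_atom (k j))"
proof
  show "\<bar>h_atom (h j) l x * k_atom (k j) l y\<bar> \<le> 1 / sum \<mu> (c l x)" if x: "x \<in> X" and y: "y \<in> c l x" for x y j l
  proof (cases "l \<le> 2 * N")
    case True
    then have l: "l \<le> L" by simp
    interpret haar \<kappa> "h j" "k j" by (rule hk)
    show ?thesis
      using product_bound[of "int l - int N" "corner M x" "corner M x" "corner M y"]
      unfolding h_atom_def k_atom_def cube_corner[OF l y] sum_\<mu>[OF l] using True by simp
  next
    case False
    then show ?thesis by (simp add: h_atom_def sum_nonneg less_imp_le)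
  qed
  have same: "y = x" if "x \<in> X" "y \<in> c (l + \<kappa>) x" "\<not> l \<le> 2 * N" for x y l
    using c_beyond[OF that(1), of "l + \<kappa>"] that by simp
  show "h_atom (h j) l y = h_atom (h j) l x" "k_atom (k j) l y = k_atom (k j) l x" if x: "x \<in> X" and y: "y \<in> c (l + \<kappa>) x" for x y j l
  proof -
    interpret haar \<kappa> "h j" "k j" by (rule hk)
    have "h_atom (h j) l y = h_atom (h j) l x \<and> k_atom (k j) l y = k_atom (k j) l x"
    proof (cases "l \<le> 2 * N")
      case True
      then have l: "l \<le> L" "l + \<kappa> \<le> L" by auto
      have "y \<in> c l x" using y c_antimono[OF x, of l "l + \<kappa>"] by auto
      note cc = cube_corner[OF l(1) this]
      have "idx (int l - int N + int \<kappa>) (corner M y) = idx (int l - int N + int \<kappa>) (corner M x)"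
        using mem_c[OF l(2), of "corner M y" "corner M x"] y by (simp add: algebra_simps)
      from const[OF this, of "corner M x"] show ?thesis unfolding h_atom_def k_atom_def cc by simp
    next
      case False
      then show ?thesis using same[OF x y] by simp
    qed
    then show "h_atom (h j) l y = h_atom (h j) l x" "k_atom (k j) l y = k_atom (k j) l x" by auto
  qed
qed (use doubling \<kappa> r in \<open>auto simp: h_atom_def\<close>)

definition mean_atom :: "(real^'n \<Rightarrow> real) \<Rightarrow> int^'n \<Rightarrow> real" where
  "mean_atom f m = (\<integral>x. indicator (dyadic_cube M m) x * f x \<partial>lebesgue) / vol TYPE('n) M"

lemma pairing:
  fixes f :: "real^'n \<Rightarrow> real"
  assumes hk: "haar \<kappa> h k" and l: "l \<le> 2 * N"
    and f: "\<And>m. integrable lebesgue (\<lambda>x. indicator (dyadic_cube M m) x * f x)"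
  shows "(\<integral>y. f y * k (cube_at (int l - int N) x) y \<partial>lebesgue) = (\<Sum>m\<in>c l (idx M x). k_atom k l m * mean_atom f m * \<mu> m)"
proof -
  interpret haar \<kappa> h k by (rule hk)
  let ?i = "int l - int N" and ?m = "idx M x"
  have lL: "l \<le> L" using l by simp
  have fc: "finite (c l ?m)"
    using finite_descendants[of "L - l" "\<chi> s. ?m $ s div 2 ^ (L - l)"] by (simp add: c_def)
  have pt: "f y * k (cube_at ?i x) y = (\<Sum>m\<in>c l ?m. k_atom k l m * (indicator (dyadic_cube M m) y * f y))" for y
  proof -
    have "(\<Sum>m\<in>c l ?m. k_atom k l m * (indicator (dyadic_cube M m) y * f y)) =
       (\<Sum>m\<in>c l ?m. if m = idx M y then k_atom k l m * f y else 0)"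
      by (intro sum.cong refl) (auto simp: dyadic_cube_eq indicator_def)
    also have "\<dots> = (if idx M y \<in> c l ?m then k_atom k l (idx M y) * f y else 0)" by (rule sum.delta[OF fc])
    also have "\<dots> = f y * k (cube_at ?i x) y"
    proof (cases "idx M y \<in> c l ?m")
      case True
      have "cube_at ?i (corner M (idx M y)) = cube_at ?i x"
        using mem_c[OF lL, of "corner M (idx M y)" x] True by simp
      moreover have "k (cube_at ?i x) (corner M (idx M y)) = k (cube_at ?i x) y"
        by (rule const(2), rule idx_mono[of M]) (use l in auto)
      ultimately show ?thesis using True by (simp add: k_atom_def)
    next
      case False
      then have "y \<notin> cube_at ?i x" using mem_c[OF lL, of y x] by (simp add: mem_cube_at)
      then show ?thesis using False by (simp add: supp)
    qed
    finally show ?thesis by simp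
  qed
  have "(\<integral>y. f y * k (cube_at ?i x) y \<partial>lebesgue) =
      (\<Sum>m\<in>c l ?m. k_atom k l m * (\<integral>y. indicator (dyadic_cube M m) y * f y \<partial>lebesgue))"
    unfolding pt using f by (subst Bochner_Integration.integral_sum) auto
  then show ?thesis by (simp add: mean_atom_def \<mu>_def less_imp_neq[symmetric] mult.assoc)
qed

text \<open>
  A partial sum depends on \<open>f\<close> only through its averages over atoms.
\<close>

lemma gen_sum_discrete:
  fixes f :: "real^'n \<Rightarrow> real"
  assumes hk: "haar \<kappa> h k"
    and f: "\<And>m. integrable lebesgue (\<lambda>x. indicator (dyadic_cube M m) x * f x)"
  shows "gen_sum h k (int a - int N) (int N) f x =
    (\<Sum>l\<in>{a..<L}. h_atom h l (idx M x) * (\<Sum>m\<in>c l (idx M x). k_atom k l m * mean_atom f m * \<mu> m))"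
proof -
  interpret haar \<kappa> h k by (rule hk)
  let ?g = "\<lambda>i. (\<integral>y. f y * k (cube_at i x) y \<partial>lebesgue) * h (cube_at i x) x"
  have "(\<Sum>l\<in>{a..<L}. h_atom h l (idx M x) * (\<Sum>m\<in>c l (idx M x). k_atom k l m * mean_atom f m * \<mu> m)) =
     (\<Sum>l\<in>{a..2 * N}. ?g (int l - int N))"
  proof (rule sum.mono_neutral_cong_right)
    show "{a..2 * N} \<subseteq> {a..<L}" using \<kappa> by auto
    show "\<forall>i\<in>{a..<L} - {a..2 * N}. h_atom h i (idx M x) * (\<Sum>m\<in>c i (idx M x). k_atom k i m * mean_atom f m * \<mu> m) = 0"
      by (auto simp: h_atom_def)
    fix l assume "l \<in> {a..2 * N}"
    then have l: "l \<le> 2 * N" by simp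
    have "idx (int l - int N) (corner M (idx M x)) = idx (int l - int N) x"
      by (rule idx_mono[of M]) (use l in auto)
    moreover have "h (cube_at (int l - int N) x) (corner M (idx M x)) = h (cube_at (int l - int N) x) x"
      by (rule const(1), rule idx_mono[of M]) (use l in auto)
    ultimately have "h_atom h l (idx M x) = h (cube_at (int l - int N) x) x" using l by (simp add: h_atom_def)
    then show "h_atom h l (idx M x) * (\<Sum>m\<in>c l (idx M x). k_atom k l m * mean_atom f m * \<mu> m) = ?g (int l - int N)"
      by (simp add: pairing[OF hk l f])
  qed simp
  also have "\<dots> = (\<Sum>i\<in>{int a - int N..int N}. ?g i)"
  proof (rule sum.reindex_bij_witness[of _ "\<lambda>i. nat (i + int N)" "\<lambda>l. int l - int N"])
  qed auto
  finally show ?thesis by (simp add: gen_sum_def)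
qed

text \<open>
  The \<open>L^2\<close> bound on the tree is the continuous one for step functions; \<open>24 \<le> 5^2\<close>.
\<close>

lemma discrete_L2:
  fixes u :: "int^'n \<Rightarrow> real"
  assumes hk: "haar \<kappa> h k"
  shows "(\<Sum>x\<in>X. (\<Sum>l\<in>{a..<L}. h_atom h l x * (\<Sum>y\<in>c l x. k_atom k l y * u y * \<mu> y))\<^sup>2 * \<mu> x)
      \<le> 5\<^sup>2 * (\<Sum>x\<in>X. (u x)\<^sup>2 * \<mu> x)"
proof -
  interpret haar \<kappa> h k by (rule hk)
  let ?Q = "dyadic_cube (- int N) m0" and ?v = "vol TYPE('n) M"
  define f where "f x = (\<Sum>m\<in>X. u m * indicator (dyadic_cube M m) x)" for x :: "real^'n"
  define V where "V x = (\<Sum>l\<in>{a..<L}. h_atom h l x * (\<Sum>y\<in>c l x. k_atom k l y * u y * \<mu> y))" for x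
  have f_eq: "f x = (if idx M x \<in> X then u (idx M x) else 0)" for x
  proof -
    have "f x = (\<Sum>m\<in>X. if m = idx M x then u m else 0)"
      unfolding f_def by (intro sum.cong refl) (auto simp: dyadic_cube_eq indicator_def)
    then show ?thesis using fin by simp
  qed
  have int_ind: "integrable lebesgue (\<lambda>x. indicator (dyadic_cube M m) x :: real)" for m :: "int^'n"
    by (subst integrable_indicator_iff) (auto simp: emeasure_dyadic_cube)
  have f: "integrable lebesgue f"
    unfolding f_def using int_ind by (intro Bochner_Integration.integrable_sum integrable_mult_right) auto
  have [measurable]: "f \<in> borel_measurable lebesgue" using f by auto
  have off: "f x = 0" if "x \<notin> ?Q" for x
    using that idx_level[of 0 x] by (auto simp: f_eq X_def dyadic_cube_eq vec_eq_iff)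
  have fm: "integrable lebesgue (\<lambda>x. indicator (dyadic_cube M m) x * f x)" for m
    using f integrable_real_mult_indicator[of "dyadic_cube M m" lebesgue f] by (simp add: mult.commute)
  have fdu: "mean_atom f m = u m" if "m \<in> X" for m
  proof -
    have pt: "indicator (dyadic_cube M m) x * f x = u m * indicator (dyadic_cube M m) x" for x
      using that by (auto simp: indicator_def f_eq dyadic_cube_eq)
    have "(\<integral>x. indicator (dyadic_cube M m) x * f x \<partial>lebesgue) = u m * ?v"
      unfolding pt by (simp add: measure_dyadic_cube)
    then show ?thesis by (simp add: mean_atom_def less_imp_neq[symmetric])
  qed
  have VG: "gen_sum h k (int a - int N) (int N) f x = V (idx M x)" if "idx M x \<in> X" for x
  proof -
    have "(\<Sum>y\<in>c l (idx M x). k_atom k l y * mean_atom f y * \<mu> y) = (\<Sum>y\<in>c l (idx M x). k_atom k l y * u y * \<mu> y)" for l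
      using c_sub[OF that, of l] by (intro sum.cong refl) (auto simp: fdu subset_iff)
    then show ?thesis unfolding gen_sum_discrete[OF hk fm] V_def by simp
  qed
  have step: "(\<Sum>m\<in>X. \<integral>\<^sup>+x\<in>dyadic_cube M m. ennreal ((g x)\<^sup>2) \<partial>lebesgue) = ennreal (\<Sum>m\<in>X. (v m)\<^sup>2 * \<mu> m)"
    if "\<And>x. idx M x \<in> X \<Longrightarrow> g x = v (idx M x)" for g and v :: "int^'n \<Rightarrow> real"
  proof -
    have "(\<integral>\<^sup>+x\<in>dyadic_cube M m. ennreal ((g x)\<^sup>2) \<partial>lebesgue) = ennreal ((v m)\<^sup>2 * \<mu> m)" if m: "m \<in> X" for m
    proof -
      have "(\<integral>\<^sup>+x\<in>dyadic_cube M m. ennreal ((g x)\<^sup>2) \<partial>lebesgue) = (\<integral>\<^sup>+x\<in>dyadic_cube M m. ennreal ((v m)\<^sup>2) \<partial>lebesgue)"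
        using m \<open>\<And>x. idx M x \<in> X \<Longrightarrow> g x = v (idx M x)\<close>
        by (intro nn_integral_cong) (auto simp: indicator_def dyadic_cube_eq)
      also have "\<dots> = ennreal ((v m)\<^sup>2) * ennreal ?v" by (simp add: nn_integral_cmult_indicator emeasure_dyadic_cube)
      finally show ?thesis by (simp add: \<mu>_def ennreal_mult less_imp_le)
    qed
    then show ?thesis by (simp add: sum_ennreal less_imp_le)
  qed
  have F: "(\<integral>\<^sup>+x. ennreal ((f x)\<^sup>2) \<partial>lebesgue) = ennreal (\<Sum>m\<in>X. (u m)\<^sup>2 * \<mu> m)"
  proof -
    have "(\<integral>\<^sup>+x. ennreal ((f x)\<^sup>2) \<partial>lebesgue) = (\<integral>\<^sup>+x\<in>?Q. ennreal ((f x)\<^sup>2) \<partial>lebesgue)"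
      using off by (intro nn_integral_cong) (auto simp: indicator_def)
    also have "\<dots> = (\<Sum>m\<in>X. \<integral>\<^sup>+x\<in>dyadic_cube M m. ennreal ((f x)\<^sup>2) \<partial>lebesgue)"
      by (rule integral_root) measurable
    also have "\<dots> = ennreal (\<Sum>m\<in>X. (u m)\<^sup>2 * \<mu> m)" by (rule step) (simp add: f_eq)
    finally show ?thesis .
  qed
  have "ennreal (\<Sum>m\<in>X. (V m)\<^sup>2 * \<mu> m) = (\<integral>\<^sup>+x\<in>?Q. ennreal ((gen_sum h k (int a - int N) (int N) f x)\<^sup>2) \<partial>lebesgue)"
  proof -
    have "(\<integral>\<^sup>+x\<in>?Q. ennreal ((gen_sum h k (int a - int N) (int N) f x)\<^sup>2) \<partial>lebesgue) =
      (\<Sum>m\<in>X. \<integral>\<^sup>+x\<in>dyadic_cube M m. ennreal ((gen_sum h k (int a - int N) (int N) f x)\<^sup>2) \<partial>lebesgue)"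
      by (rule integral_root) measurable
    then show ?thesis using step[of "gen_sum h k (int a - int N) (int N) f" V, OF VG] by simp
  qed
  also have "\<dots> \<le> 24 * (\<integral>\<^sup>+x. ennreal ((f x)\<^sup>2) \<partial>lebesgue)"
    by (rule gen_sum_L2[OF f]) (auto simp: F)
  also have "\<dots> = ennreal (24 * (\<Sum>m\<in>X. (u m)\<^sup>2 * \<mu> m))"
    unfolding F by (simp add: ennreal_mult sum_nonneg less_imp_le)
  finally have "(\<Sum>m\<in>X. (V m)\<^sup>2 * \<mu> m) \<le> 24 * (\<Sum>m\<in>X. (u m)\<^sup>2 * \<mu> m)"
    by (simp add: sum_nonneg less_imp_le)
  also have "\<dots> \<le> 5\<^sup>2 * (\<Sum>m\<in>X. (u m)\<^sup>2 * \<mu> m)"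
    by (intro mult_right_mono sum_nonneg) (auto simp: less_imp_le)
  finally show ?thesis by (simp add: V_def)
qed

end

section \<open>Weights on the tree\<close>

locale Ap_weight =
  fixes p :: real and w :: "real^'n::finite \<Rightarrow> real"
  assumes p: "1 < p" and w: "w \<in> Ap p"
begin

definition \<sigma> :: "real^'n \<Rightarrow> real" where "\<sigma> x = w x powr (- 1 / (p - 1))"

definition K :: real where "K = enn2real (Ap_const p w)"

lemma K: "Ap_const p w = ennreal K" "0 \<le> K"
  using w by (auto simp: K_def Ap_def ennreal_enn2real)

lemma w_integrable: "compact A \<Longrightarrow> set_integrable lebesgue A w"
  using w by (auto simp: Ap_def weight_def locally_integrable_def)

lemma w_measurable [measurable]: "w \<in> borel_measurable lebesgue"
proof -
  have "(\<lambda>x. indicator (cball 0 (real n)) x * w x) \<in> borel_measurable lebesgue" for n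
    using w_integrable[of "cball 0 (real n)"] by (auto simp: set_integrable_def)
  then show ?thesis
  proof (rule borel_measurable_LIMSEQ_real[rotated])
    fix x :: "real^'n"
    obtain n0 where n0: "norm x \<le> real n0" using real_arch_simple by blast
    have "eventually (\<lambda>n. indicator (cball 0 (real n)) x * w x = w x) sequentially"
      using eventually_ge_at_top[of n0] by eventually_elim (use n0 in \<open>auto simp: indicator_def\<close>)
    then show "(\<lambda>n. indicator (cball 0 (real n)) x * w x) \<longlonglongrightarrow> w x" by (rule tendsto_eventually)
  qed
qed

lemma \<sigma>_measurable [measurable]: "\<sigma> \<in> borel_measurable lebesgue"
  unfolding \<sigma>_def by measurable

lemma w_pos: "AE x in lebesgue. 0 < w x"
  using w by (auto simp: Ap_def weight_def)

lemma w\<sigma>: "AE x in lebesgue. 0 < w x \<and> \<sigma> x = w x powr (- 1 / (p - 1))"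
  using w_pos by eventually_elim (simp add: \<sigma>_def)

lemma positive_mass:
  assumes [measurable]: "u \<in> borel_measurable lebesgue" and u: "AE x in lebesgue. 0 < u x"
  shows "0 < (\<integral>\<^sup>+x\<in>dyadic_cube i (m :: int^'n). ennreal (u x) \<partial>lebesgue)"
proof (rule ccontr)
  assume "\<not> 0 < (\<integral>\<^sup>+x\<in>dyadic_cube i m. ennreal (u x) \<partial>lebesgue)"
  then have "(\<integral>\<^sup>+x. ennreal (u x) * indicator (dyadic_cube i m) x \<partial>lebesgue) = 0" by simp
  then have "AE x in lebesgue. ennreal (u x) * indicator (dyadic_cube i m) x = 0"
    by (subst (asm) nn_integral_0_iff_AE) auto
  then have "AE x in lebesgue. x \<notin> dyadic_cube i m"
    using u by eventually_elim (auto simp: indicator_def ennreal_eq_0_iff split: if_splits)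
  then have "emeasure lebesgue (dyadic_cube i m) = 0"
    by (subst (asm) AE_iff_measurable[OF _ refl]) auto
  then show False using vol_pos[of i, where 'n='n] by (simp add: emeasure_dyadic_cube)
qed

definition w_mass :: "int \<Rightarrow> int^'n \<Rightarrow> real" where
  "w_mass i m = enn2real (\<integral>\<^sup>+x\<in>dyadic_cube i m. ennreal (w x) \<partial>lebesgue)"

definition dual_mass :: "int \<Rightarrow> int^'n \<Rightarrow> real" where
  "dual_mass i m = enn2real (\<integral>\<^sup>+x\<in>dyadic_cube i m. ennreal (\<sigma> x) \<partial>lebesgue)"

text \<open>
  The \<open>A_p\<close> condition is stated for closed cubes. A dyadic cube is contained in its closure, which
  has the same measure, so the averages only become smaller. Finiteness of the mass of the dual
  weight follows from the condition itself, because the mass of the weight is positive.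
\<close>

lemma masses:
  fixes m :: "int^'n"
  shows "(\<integral>\<^sup>+x\<in>dyadic_cube i m. ennreal (w x) \<partial>lebesgue) = ennreal (w_mass i m)" "0 < w_mass i m"
    "(\<integral>\<^sup>+x\<in>dyadic_cube i m. ennreal (\<sigma> x) \<partial>lebesgue) = ennreal (dual_mass i m)" "0 < dual_mass i m"
    "w_mass i m * dual_mass i m powr (p - 1) \<le> K * vol TYPE('n) i powr p"
proof -
  let ?Q = "dyadic_cube i m" and ?v = "vol TYPE('n) i"
  let ?W = "\<integral>\<^sup>+x\<in>?Q. ennreal (w x) \<partial>lebesgue" and ?S = "\<integral>\<^sup>+x\<in>?Q. ennreal (\<sigma> x) \<partial>lebesgue"
  define l :: real where "l = 2 powi (- i)"
  define B where "B = cbox (corner i m) (\<chi> s. corner i m $ s + l)"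
  have l: "0 < l" by (simp add: l_def)
  have QB: "?Q \<subseteq> B" using cube_closure(2)[of i m] by (simp add: B_def l_def)
  have B: "B \<in> cubes" unfolding cubes_def B_def using l by blast
  have [measurable]: "B \<in> sets lebesgue" by (simp add: B_def)
  have vB: "emeasure lebesgue B = ennreal ?v" using cube_closure(4)[of i m] by (simp add: B_def l_def)
  have W0: "0 < ?W" using w_pos by (intro positive_mass) auto
  have "AE x in lebesgue. 0 < \<sigma> x" using w_pos by eventually_elim (simp add: \<sigma>_def)
  then have S0: "0 < ?S" by (intro positive_mass) auto
  have "set_integrable lebesgue B w" unfolding B_def by (intro w_integrable compact_cbox)
  then have "(\<integral>\<^sup>+x. ennreal (norm (indicator B x *\<^sub>R w x)) \<partial>lebesgue) < \<infinity>"
    unfolding set_integrable_def integrable_iff_bounded by auto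
  moreover have "?W \<le> (\<integral>\<^sup>+x. ennreal (norm (indicator B x *\<^sub>R w x)) \<partial>lebesgue)"
    using QB by (intro nn_integral_mono) (auto simp: indicator_def intro!: ennreal_leI)
  ultimately have Wf: "?W < \<infinity>" by (rule le_less_trans[rotated])
  then show W: "?W = ennreal (w_mass i m)" by (simp add: w_mass_def)
  then show wm0: "0 < w_mass i m" using W0 by simp
  have "average B w * average B \<sigma> epowr (p - 1) \<le> ennreal K"
    unfolding K(1)[symmetric] Ap_const_def \<sigma>_def[abs_def] by (rule SUP_upper[OF B])
  moreover have "?W / ennreal ?v * (?S / ennreal ?v) epowr (p - 1) \<le> average B w * average B \<sigma> epowr (p - 1)"
  proof -
    have le: "(\<integral>\<^sup>+x\<in>?Q. ennreal (u x) \<partial>lebesgue) / ennreal ?v \<le> average B u" for u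
      unfolding average_def vB
      by (intro divide_right_mono_ennreal nn_integral_mono) (use QB in \<open>auto simp: indicator_def\<close>)
    show ?thesis using p by (intro mult_mono epowr_mono le) auto
  qed
  ultimately have main: "?W / ennreal ?v * (?S / ennreal ?v) epowr (p - 1) \<le> ennreal K" by (rule order_trans[rotated])
  have "?S < \<infinity>"
  proof (rule ccontr)
    assume "\<not> ?S < \<infinity>"
    then have "?S = top" by (simp add: not_less top_unique)
    then have "(?S / ennreal ?v) epowr (p - 1) = top" by (simp add: ennreal_top_divide)
    moreover have "0 < ?W / ennreal ?v" using W0 by (simp add: W divide_ennreal)
    ultimately show False using main W0 by (auto simp: ennreal_mult_top top_unique split: if_splits)
  qed
  then show S: "?S = ennreal (dual_mass i m)" by (simp add: dual_mass_def)
  then show sm0: "0 < dual_mass i m" using S0 by simp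
  have "ennreal (w_mass i m / ?v) * ennreal ((dual_mass i m / ?v) powr (p - 1)) \<le> ennreal K"
    using main wm0 sm0 unfolding W S by (simp add: divide_ennreal epowr_ennreal less_imp_le)
  then have "w_mass i m / ?v * (dual_mass i m / ?v) powr (p - 1) \<le> K"
    using K(2) wm0 by (subst (asm) ennreal_mult[symmetric]) (auto simp: less_imp_le)
  moreover have "w_mass i m / ?v * (dual_mass i m / ?v) powr (p - 1) = w_mass i m * dual_mass i m powr (p - 1) / ?v powr p"
  proof -
    have "?v powr p = ?v * ?v powr (p - 1)" by (simp add: powr_mult_base less_imp_le)
    then show ?thesis using sm0 by (simp add: powr_divide less_imp_le)
  qed
  ultimately have "w_mass i m * dual_mass i m powr (p - 1) / ?v powr p \<le> K" by simp
  then show "w_mass i m * dual_mass i m powr (p - 1) \<le> K * ?v powr p"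
    by (subst (asm) pos_divide_le_eq) (auto simp: less_imp_neq[symmetric])
qed

end

locale weighted_grid = grid N \<kappa> m0 + Ap_weight p w
  for N \<kappa> :: nat and m0 :: "int^'n::finite" and p and w :: "real^'n \<Rightarrow> real"
begin

lemma sum_cell_mass:
  assumes "l \<le> L" shows "sum (w_mass M) (c l m) = w_mass (int l - int N) (idx (int l - int N) (corner M m))"
    "sum (dual_mass M) (c l m) = dual_mass (int l - int N) (idx (int l - int N) (corner M m))"
proof -
  let ?z = "corner M m"
  have "ennreal (sum (w_mass M) (c l m)) = (\<Sum>m\<in>c l (idx M ?z). \<integral>\<^sup>+x\<in>dyadic_cube M m. ennreal (w x) \<partial>lebesgue)"
    by (simp add: masses(1) sum_ennreal masses(2) less_imp_le)
  also have "\<dots> = ennreal (w_mass (int l - int N) (idx (int l - int N) ?z))"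
    by (subst integral_cell[symmetric]) (use assms in \<open>auto simp: masses(1)\<close>)
  finally show "sum (w_mass M) (c l m) = w_mass (int l - int N) (idx (int l - int N) ?z)"
    by (simp add: masses(2) sum_nonneg less_imp_le)
  have "ennreal (sum (dual_mass M) (c l m)) = (\<Sum>m\<in>c l (idx M ?z). \<integral>\<^sup>+x\<in>dyadic_cube M m. ennreal (\<sigma> x) \<partial>lebesgue)"
    by (simp add: masses(3) sum_ennreal masses(4) less_imp_le)
  also have "\<dots> = ennreal (dual_mass (int l - int N) (idx (int l - int N) ?z))"
    by (subst integral_cell[symmetric]) (use assms in \<open>auto simp: masses(3)\<close>)
  finally show "sum (dual_mass M) (c l m) = dual_mass (int l - int N) (idx (int l - int N) ?z)"
    by (simp add: masses(4) sum_nonneg less_imp_le)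
qed

sublocale weighted_tree X c L \<mu> "w_mass M" "dual_mass M" p K
proof
  show "\<mu> m powr p \<le> w_mass M m * dual_mass M m powr (p - 1)" if "m \<in> X" for m
  proof -
    have "(\<integral>\<^sup>+x\<in>dyadic_cube M m. ennreal 1 \<partial>lebesgue) \<le> ennreal (w_mass M m powr (1 / p) * dual_mass M m powr (1 - 1 / p))"
      by (rule Holder_nn_integral[OF _ _ w_measurable \<sigma>_measurable _ p w\<sigma>])
        (auto simp: masses(1,3) masses(2,4) less_imp_le)
    then have "\<mu> m \<le> w_mass M m powr (1 / p) * dual_mass M m powr (1 - 1 / p)"
      by (simp add: emeasure_dyadic_cube \<mu>_def)
    then have "\<mu> m powr p \<le> (w_mass M m powr (1 / p) * dual_mass M m powr (1 - 1 / p)) powr p"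
      using p by (intro powr_mono2) (auto simp: less_imp_le)
    also have "\<dots> = w_mass M m * dual_mass M m powr (p - 1)"
    proof -
      have "(1 - 1 / p) * p = p - 1" using p by (simp add: field_simps)
      then show ?thesis using p masses(2,4)[of M m] by (simp add: powr_mult powr_powr)
    qed
    finally show ?thesis .
  qed
  show "sum (w_mass M) Q * sum (dual_mass M) Q powr (p - 1) \<le> K * sum \<mu> Q powr p" if Q: "Q \<in> cells" for Q
  proof -
    obtain x where "x \<in> Q" using cells_nonempty[OF Q] by auto
    then obtain l where l: "l \<le> L" "Q = c l x" by (rule cells_cases[OF Q])
    show ?thesis unfolding l(2) sum_cell_mass[OF l(1)] sum_\<mu>[OF l(1)] by (rule masses(5))
  qed
qed (use p masses in auto)

end

section \<open>Weighted bounds for the truncated vector-valued shift\<close>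

lemma (in weighted_tree) sparse_weak_all:
  assumes S: "sparse \<mu> S" and F: "\<forall>x\<in>X. 0 \<le> F x" and \<alpha>: "0 < \<alpha>" and K0: "0 \<le> K"
  shows "\<alpha> powr p * sum w {x \<in> X. \<alpha> < sparse_op \<mu> S F x} \<le>
    ((sparse_const p + weak_const p) * K) powr p * (\<Sum>x\<in>X. (F x * \<mu> x) powr p * \<sigma> x powr (1 - p))"
proof -
  have wc: "0 \<le> weak_const p" using testing_const_pos[OF p] by (simp add: weak_const_def)
  have nn: "0 \<le> (\<Sum>x\<in>X. (F x * \<mu> x) powr p * \<sigma> x powr (1 - p))" by (intro sum_nonneg) auto
  have mono: "(a * K) powr p * T \<le> ((sparse_const p + weak_const p) * K) powr p * T"
    if "0 \<le> a" "a \<le> sparse_const p + weak_const p" "0 \<le> T" for a T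
    using that K0 p by (intro mult_right_mono powr_mono2) auto
  show ?thesis
  proof (cases "p < 2")
    case True
    then show ?thesis
      using sparse_weak[OF True S F \<alpha>] mono[OF wc _ nn] sparse_const_pos[OF p] by simp
  next
    case False
    then have m: "max 1 (1 / (p - 1)) = 1" by simp
    have "\<alpha> powr p * sum w {x \<in> X. \<alpha> < sparse_op \<mu> S F x} = (\<Sum>x | x \<in> X \<and> \<alpha> < sparse_op \<mu> S F x. \<alpha> powr p * w x)"
      by (simp add: sum_distrib_left)
    also have "\<dots> \<le> (\<Sum>x | x \<in> X \<and> \<alpha> < sparse_op \<mu> S F x. sparse_op \<mu> S F x powr p * w x)"
      using \<alpha> p w_pos by (intro sum_mono mult_right_mono powr_mono2) (auto intro: less_imp_le)
    also have "\<dots> \<le> (\<Sum>x\<in>X. sparse_op \<mu> S F x powr p * w x)"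
      using fin w_pos by (intro sum_mono2) (auto intro: less_imp_le)
    also have "\<dots> \<le> (sparse_const p * K) powr p * (\<Sum>x\<in>X. (F x * \<mu> x) powr p * \<sigma> x powr (1 - p))"
      using sparse_strong[OF S F] K0 unfolding m by simp
    finally show ?thesis using mono[of "sparse_const p", OF _ _ nn] wc sparse_const_pos[OF p] by simp
  qed
qed

lemma locally_integrable_cube:
  fixes f :: "real^'n \<Rightarrow> real"
  assumes f: "locally_integrable f"
  shows "integrable lebesgue (\<lambda>x. indicator (dyadic_cube i m) x * f x)"
proof -
  have "set_integrable lebesgue (cbox (corner i m) (\<chi> s. corner i m $ s + 2 powi (- i))) f"
    using f compact_cbox unfolding locally_integrable_def by blast
  then have "set_integrable lebesgue (dyadic_cube i m) f"
    by (rule set_integrable_subset) (use cube_closure(2)[of i m] in auto)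
  then show ?thesis by (simp add: set_integrable_def)
qed

text \<open>
  Minkowski's integral inequality for the \<open>l^r\<close> norm, by pairing with the extremal dual vector \<open>u\<close>.
\<close>

lemma lr_integral_le:
  fixes f :: "nat \<Rightarrow> 'a \<Rightarrow> real"
  assumes r: "1 < r" and f: "\<And>j. integrable M (\<lambda>x. indicator E x * f j x)"
    and [measurable]: "E \<in> sets M" "\<And>j. f j \<in> borel_measurable M"
    and A: "(\<integral>\<^sup>+x\<in>E. ennreal (lr J r (\<lambda>j. f j x)) \<partial>M) \<le> ennreal A" "0 \<le> A"
  shows "lr J r (\<lambda>j. \<integral>x. indicator E x * f j x \<partial>M) \<le> A"
proof -
  define v where "v j = (\<integral>x. indicator E x * f j x \<partial>M)" for j
  define u where "u j = sgn (v j) * \<bar>v j\<bar> powr (r - 1)" for j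
  let ?R = "lr J r v"
  have au: "\<bar>u j\<bar> = \<bar>v j\<bar> powr (r - 1)" if "v j \<noteq> 0" for j using that by (simp add: u_def abs_mult abs_sgn_eq)
  have au': "\<bar>u j\<bar> \<le> \<bar>v j\<bar> powr (r - 1)" for j by (cases "v j = 0") (simp add: u_def, simp add: au)
  have [measurable]: "(\<lambda>x. lr J r (\<lambda>j. f j x)) \<in> borel_measurable M" unfolding lr_def by measurable
  have nn: "(\<integral>\<^sup>+x. ennreal (indicator E x * lr J r (\<lambda>j. f j x)) \<partial>M) \<le> ennreal A"
    using A(1) by (simp add: indicator_mult_ennreal mult.commute)
  have int: "integrable M (\<lambda>x. indicator E x * lr J r (\<lambda>j. f j x))"
    using nn by (intro integrableI_bounded) (auto simp: abs_mult le_less_trans[OF _ ennreal_less_top])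
  have Ile: "(\<integral>x. indicator E x * lr J r (\<lambda>j. f j x) \<partial>M) \<le> A"
    using nn A(2) nn_integral_eq_integral[OF int] by simp
  have "?R powr r = (\<Sum>j<J. v j * u j)"
    using r by (simp add: lr_powr u_def powr_mult_base sgn_mult_abs mult.assoc[symmetric] abs_sgn[symmetric])
  also have "\<dots> = (\<integral>x. (\<Sum>j<J. indicator E x * f j x * u j) \<partial>M)"
    using f by (subst Bochner_Integration.integral_sum) (auto simp: v_def)
  also have "\<dots> \<le> (\<integral>x. indicator E x * lr J r (\<lambda>j. f j x) * ?R powr (r - 1) \<partial>M)"
  proof (rule integral_mono)
    show "integrable M (\<lambda>x. \<Sum>j<J. indicator E x * f j x * u j)"
      using f by (intro Bochner_Integration.integrable_sum integrable_mult_left) auto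
    show "integrable M (\<lambda>x. indicator E x * lr J r (\<lambda>j. f j x) * ?R powr (r - 1))"
      using int by (intro integrable_mult_left) auto
    fix x
    have "(\<Sum>j<J. indicator E x * f j x * u j) = indicator E x * (\<Sum>j<J. f j x * u j)"
      by (simp add: sum_distrib_left mult.assoc)
    also have "\<dots> \<le> indicator E x * (\<Sum>j<J. \<bar>f j x\<bar> * \<bar>v j\<bar> powr (r - 1))"
    proof (intro mult_left_mono sum_mono)
      fix j
      have "f j x * u j \<le> \<bar>f j x\<bar> * \<bar>u j\<bar>" by (metis abs_ge_self abs_mult)
      also have "\<dots> \<le> \<bar>f j x\<bar> * \<bar>v j\<bar> powr (r - 1)" by (intro mult_left_mono au') auto
      finally show "f j x * u j \<le> \<bar>f j x\<bar> * \<bar>v j\<bar> powr (r - 1)" .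
    qed simp
    also have "\<dots> \<le> indicator E x * (lr J r (\<lambda>j. f j x) * ?R powr (r - 1))"
      by (intro mult_left_mono lr_Holder r) simp
    finally show "(\<Sum>j<J. indicator E x * f j x * u j) \<le> indicator E x * lr J r (\<lambda>j. f j x) * ?R powr (r - 1)"
      by (simp add: mult.assoc)
  qed
  also have "\<dots> = (\<integral>x. indicator E x * lr J r (\<lambda>j. f j x) \<partial>M) * ?R powr (r - 1)" by simp
  also have "\<dots> \<le> A * ?R powr (r - 1)" by (intro mult_right_mono Ile) simp
  finally have le: "?R powr r \<le> A * ?R powr (r - 1)" .
  show ?thesis
  proof (cases "?R = 0")
    case False
    then have "0 < ?R" by (simp add: less_le)
    moreover have "?R powr r = ?R * ?R powr (r - 1)" by (simp add: powr_mult_base)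
    ultimately show ?thesis using le by (simp add: v_def[abs_def])
  qed (use A in \<open>simp add: v_def[abs_def]\<close>)
qed

lemma (in Ap_weight) K_gt0: "0 < K"
proof -
  have "0 < w_mass 0 0 * dual_mass 0 0 powr (p - 1)" using masses(2,4)[of 0 0] by simp
  then have "0 < K * vol TYPE('n) 0 powr p" using masses(5)[of 0 0] by linarith
  then show ?thesis by (simp add: zero_less_mult_iff)
qed

text \<open>
  The inner constant is the one of scalar sparse domination, started with the \<open>L^2\<close> norm \<open>5\<close> and the
  doubling constant \<open>2^n\<close> of the dyadic grid.
\<close>

definition haar_const :: "'n::finite itself \<Rightarrow> real \<Rightarrow> real" where
  "haar_const _ r = dom_const (2 ^ CARD('n)) (sparse_const r * dom_const (2 ^ CARD('n)) 5)"

lemma pos_mult_top: "0 < t \<Longrightarrow> ennreal t * top = top"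
  by (simp add: ennreal_mult_top)

lemma haar_const_pos: "1 < r \<Longrightarrow> 0 < haar_const TYPE('n::finite) r"
  using sparse_const_pos[of r] by (simp add: haar_const_def dom_const_def add_pos_nonneg)

context weighted_grid
begin

text \<open>
  Sparse domination for a partial sum on one cube of the coarsest generation, together with the
  comparison of the discrete norm with the weighted integral of \<open>f\<close>.
\<close>

lemma root_domination:
  fixes h k :: "nat \<Rightarrow> 'n cube_family" and f :: "nat \<Rightarrow> real^'n \<Rightarrow> real"
  assumes hk: "\<And>j. haar \<kappa> (h j) (k j)" and r: "1 < r" and f: "\<And>j. locally_integrable (f j)"
    and fm: "\<And>j. f j \<in> borel_measurable lebesgue"
    and I: "(\<integral>\<^sup>+x\<in>dyadic_cube (- int N) m0. ennreal (lr J r (\<lambda>j. f j x) powr p * w x) \<partial>lebesgue) = ennreal I" "0 \<le> I"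
  shows "\<exists>T S G. (\<forall>x. idx M x \<in> X \<longrightarrow> lr J r (\<lambda>j. shift_partial_sum (h j) (k j) N (f j) x) = T (idx M x)) \<and>
     sparse \<mu> S \<and> (\<forall>m\<in>X. 0 \<le> G m) \<and>
     (\<forall>m\<in>X. 0 \<le> T m \<and> T m \<le> haar_const TYPE('n) r * real \<kappa> * sparse_op \<mu> S G m) \<and>
     (\<Sum>m\<in>X. (G m * \<mu> m) powr p * dual_mass M m powr (1 - p)) \<le> I"
proof -
  interpret S: shift_tree X c L \<mu> "2 ^ CARD('n)" \<kappa> J r "\<lambda>j. h_atom (h j)" "\<lambda>j. k_atom (k j)"
    by (rule discrete_shift[OF hk r])
  note fi = locally_integrable_cube[OF f]
  note [measurable] = fm
  define F where "F j m = mean_atom (f j) m" for j m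
  define T where "T m = lr J r (S.tail 0 F m)" for m
  have T: "lr J r (\<lambda>j. shift_partial_sum (h j) (k j) N (f j) x) = T (idx M x)" for x
  proof -
    have "shift_partial_sum (h j) (k j) N (f j) x = S.tail 0 F (idx M x) j" for j
    proof -
      interpret H: haar \<kappa> "h j" "k j" by (rule hk)
      show ?thesis
        using gen_sum_discrete[OF hk[of j] locally_integrable_cube[OF f[of j]], where a = 0 and x = x] by (simp add: H.partial_sum_eq S.tail_def S.piece_def F_def)
    qed
    then show ?thesis by (simp add: T_def)
  qed
  obtain SS where SS: "sparse \<mu> SS" "\<forall>x\<in>X. S.nm (S.tail 0 F x) \<le>
      haar_const TYPE('n) r * real \<kappa> * sparse_op \<mu> SS (S.size_of F) x"
    using S.vector_sparse_domination[OF discrete_L2[OF hk] zero_le_numeral root, of F,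
        folded haar_const_def[of "TYPE('n)"]]
    by (elim exE conjE) (rule that)
  have meas: "(\<lambda>x. lr J r (\<lambda>j. f j x)) \<in> borel_measurable lebesgue" unfolding lr_def by measurable
  define a where "a m = enn2real (\<integral>\<^sup>+x\<in>dyadic_cube M m. ennreal (lr J r (\<lambda>j. f j x) powr p * w x) \<partial>lebesgue)" for m
  have sumI: "(\<Sum>m\<in>X. \<integral>\<^sup>+x\<in>dyadic_cube M m. ennreal (lr J r (\<lambda>j. f j x) powr p * w x) \<partial>lebesgue) = ennreal I"
    unfolding I(1)[symmetric] by (rule integral_root[symmetric]) (use meas in measurable)
  have a: "(\<integral>\<^sup>+x\<in>dyadic_cube M m. ennreal (lr J r (\<lambda>j. f j x) powr p * w x) \<partial>lebesgue) = ennreal (a m)" if "m \<in> X" for m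
  proof -
    have "(\<integral>\<^sup>+x\<in>dyadic_cube M m. ennreal (lr J r (\<lambda>j. f j x) powr p * w x) \<partial>lebesgue) \<le> ennreal I"
      unfolding sumI[symmetric] using that fin by (intro member_le_sum) auto
    then show ?thesis by (simp add: a_def le_less_trans[OF _ ennreal_less_top])
  qed
  have a0: "0 \<le> a m" for m by (simp add: a_def)
  have "ennreal (\<Sum>m\<in>X. a m) = ennreal I" using sumI a by (simp add: sum_ennreal a0)
  then have sum_a: "(\<Sum>m\<in>X. a m) = I" using I(2) by (simp add: sum_nonneg a0)
  have "(S.size_of F m * \<mu> m) powr p * dual_mass M m powr (1 - p) \<le> a m" if m: "m \<in> X" for m
  proof -
    let ?v = "vol TYPE('n) M"
    define A where "A = a m powr (1 / p) * dual_mass M m powr (1 - 1 / p)"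
    have A0: "0 \<le> A" by (simp add: A_def)
    have "(\<integral>\<^sup>+x\<in>dyadic_cube M m. ennreal (lr J r (\<lambda>j. f j x)) \<partial>lebesgue) \<le> ennreal A"
      unfolding A_def
      by (rule Holder_nn_integral[OF _ meas w_measurable \<sigma>_measurable _ p w\<sigma>])
        (auto simp: a[OF m] a0 masses(3) masses(4))
    then have le: "lr J r (\<lambda>j. \<integral>x. indicator (dyadic_cube M m) x * f j x \<partial>lebesgue) \<le> A"
      by (intro lr_integral_le r fi A0) auto
    have "S.size_of F m * \<mu> m = lr J r (\<lambda>j. \<integral>x. indicator (dyadic_cube M m) x * f j x \<partial>lebesgue)"
    proof -
      have "S.size_of F m = lr J r (\<lambda>j. (1 / ?v) * (\<integral>x. indicator (dyadic_cube M m) x * f j x \<partial>lebesgue))"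
        by (simp add: S.size_of_def F_def mean_atom_def)
      also have "\<dots> = 1 / ?v * lr J r (\<lambda>j. \<integral>x. indicator (dyadic_cube M m) x * f j x \<partial>lebesgue)"
        by (subst lr_scale[OF r]) (simp add: less_imp_le)
      finally show ?thesis by (simp add: \<mu>_def less_imp_neq[symmetric])
    qed
    then have "S.size_of F m * \<mu> m \<le> A" using le by simp
    then have "(S.size_of F m * \<mu> m) powr p * dual_mass M m powr (1 - p) \<le> A powr p * dual_mass M m powr (1 - p)"
      using p by (intro mult_right_mono powr_mono2) (auto simp: less_imp_le)
    also have "\<dots> = a m"
    proof -
      have "(1 - 1 / p) * p = p - 1" using p by (simp add: field_simps)
      then have "A powr p * dual_mass M m powr (1 - p) = a m * (dual_mass M m powr (p - 1) * dual_mass M m powr (1 - p))"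
        using p a0 masses(4)[of M m] by (simp add: A_def powr_mult powr_powr)
      also have "dual_mass M m powr (p - 1) * dual_mass M m powr (1 - p) = 1"
        using masses(4)[of M m] by (simp flip: powr_add)
      finally show ?thesis by simp
    qed
    finally show ?thesis .
  qed
  then have "(\<Sum>m\<in>X. (S.size_of F m * \<mu> m) powr p * dual_mass M m powr (1 - p)) \<le> I"
    unfolding sum_a[symmetric] by (rule sum_mono)
  then show ?thesis
    using T SS by (intro exI[of _ T] exI[of _ SS] exI[of _ "S.size_of F"]) (auto simp: T_def)
qed

lemma integral_of_step:
  assumes "\<And>x. idx M x \<in> X \<Longrightarrow> g x = v (idx M x)" and g: "g \<in> borel_measurable lebesgue" and v: "\<And>m. 0 \<le> v m"
  shows "(\<integral>\<^sup>+x\<in>dyadic_cube (- int N) m0. ennreal (g x) * ennreal (w x) \<partial>lebesgue) = ennreal (\<Sum>m\<in>X. v m * w_mass M m)"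
proof -
  note [measurable] = g
  have "(\<integral>\<^sup>+x\<in>dyadic_cube (- int N) m0. ennreal (g x) * ennreal (w x) \<partial>lebesgue) =
      (\<Sum>m\<in>X. \<integral>\<^sup>+x\<in>dyadic_cube M m. ennreal (g x) * ennreal (w x) \<partial>lebesgue)"
    by (rule integral_root) measurable
  also have "\<dots> = (\<Sum>m\<in>X. ennreal (v m * w_mass M m))"
  proof (intro sum.cong refl)
    fix m assume m: "m \<in> X"
    have "(\<integral>\<^sup>+x\<in>dyadic_cube M m. ennreal (g x) * ennreal (w x) \<partial>lebesgue) =
        (\<integral>\<^sup>+x. ennreal (v m) * (ennreal (w x) * indicator (dyadic_cube M m) x) \<partial>lebesgue)"
      using assms(1) m by (intro nn_integral_cong) (auto simp: indicator_def dyadic_cube_eq)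
    also have "\<dots> = ennreal (v m) * ennreal (w_mass M m)" by (simp add: nn_integral_cmult masses(1))
    finally show "(\<integral>\<^sup>+x\<in>dyadic_cube M m. ennreal (g x) * ennreal (w x) \<partial>lebesgue) = ennreal (v m * w_mass M m)"
      using v by (simp add: ennreal_mult masses(2) less_imp_le)
  qed
  also have "\<dots> = ennreal (\<Sum>m\<in>X. v m * w_mass M m)"
    using v by (intro sum_ennreal) (simp add: masses(2) less_imp_le)
  finally show ?thesis .
qed

lemma root_bounds:
  fixes h k :: "nat \<Rightarrow> 'n cube_family" and f :: "nat \<Rightarrow> real^'n \<Rightarrow> real" and J :: nat
  assumes hk: "\<And>j. haar \<kappa> (h j) (k j)" and r: "1 < r" and f: "\<And>j. locally_integrable (f j)"
    and fm: "\<And>j. f j \<in> borel_measurable lebesgue"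
  defines "Q \<equiv> dyadic_cube (- int N) m0" and "F \<equiv> \<lambda>x. lr J r (\<lambda>j. shift_partial_sum (h j) (k j) N (f j) x)"
    and "I \<equiv> \<integral>\<^sup>+x\<in>dyadic_cube (- int N) m0. ennreal (lr J r (\<lambda>j. f j x) powr p * w x) \<partial>lebesgue"
    and "C \<equiv> haar_const TYPE('n) r * real \<kappa>"
  shows "(\<integral>\<^sup>+x\<in>Q. ennreal (F x powr p) * ennreal (w x) \<partial>lebesgue) \<le>
      ennreal ((C * (sparse_const p * K powr max 1 (1 / (p - 1)))) powr p) * I"
    and "0 < \<alpha> \<Longrightarrow> ennreal (\<alpha> powr p) * (\<integral>\<^sup>+x\<in>Q. ennreal (indicator {x. \<alpha> < F x} x) * ennreal (w x) \<partial>lebesgue) \<le>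
      ennreal ((C * ((sparse_const p + weak_const p) * K)) powr p) * I"
proof -
  let ?A = "sparse_const p * K powr max 1 (1 / (p - 1))" and ?B = "(sparse_const p + weak_const p) * K"
  have wc: "0 \<le> weak_const p" using testing_const_pos[OF p] by (simp add: weak_const_def)
  have C: "0 < C" using haar_const_pos[OF r, where 'n='n] \<kappa> by (simp add: C_def)
  have A: "0 < ?A" "0 < ?B" using sparse_const_pos[OF p] K_gt0 wc by auto
  have Fm [measurable]: "F \<in> borel_measurable lebesgue"
  proof -
    have [measurable]: "shift_partial_sum (h j) (k j) N (f j) \<in> borel_measurable lebesgue" for j
    proof -
      interpret H: haar \<kappa> "h j" "k j" by (rule hk)
      show ?thesis unfolding H.partial_sum_eq[abs_def] by measurable
    qed
    show ?thesis unfolding F_def lr_def by measurable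
  qed
  have both: "(\<integral>\<^sup>+x\<in>Q. ennreal (F x powr p) * ennreal (w x) \<partial>lebesgue) \<le> ennreal ((C * ?A) powr p) * I \<and>
    (0 < \<alpha> \<longrightarrow> ennreal (\<alpha> powr p) * (\<integral>\<^sup>+x\<in>Q. ennreal (indicator {x. \<alpha> < F x} x) * ennreal (w x) \<partial>lebesgue) \<le>
      ennreal ((C * ?B) powr p) * I)"
  proof (cases I)
    case top
    have "ennreal ((C * ?A) powr p) * top = top" "ennreal ((C * ?B) powr p) * top = top"
      using mult_pos_pos[OF C A(1)] mult_pos_pos[OF C A(2)]
      by (metis less_irrefl pos_mult_top powr_gt_zero)+
    then show ?thesis unfolding top by simp
  next
    case (real i)
    have "\<exists>T S G. (\<forall>x. idx M x \<in> X \<longrightarrow> F x = T (idx M x)) \<and> sparse \<mu> S \<and> (\<forall>m\<in>X. 0 \<le> G m) \<and>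
       (\<forall>m\<in>X. 0 \<le> T m \<and> T m \<le> C * sparse_op \<mu> S G m) \<and>
       (\<Sum>m\<in>X. (G m * \<mu> m) powr p * dual_mass M m powr (1 - p)) \<le> i"
      unfolding F_def C_def
      by (rule root_domination[where h = h and k = k, OF hk r f fm real(2)[unfolded I_def] real(1)])
    then obtain T S G where T: "\<forall>x. idx M x \<in> X \<longrightarrow> F x = T (idx M x)"
      and S: "sparse \<mu> S" and G: "\<forall>m\<in>X. 0 \<le> G m"
      and TS: "\<forall>m\<in>X. 0 \<le> T m \<and> T m \<le> C * sparse_op \<mu> S G m"
      and Gi: "(\<Sum>m\<in>X. (G m * \<mu> m) powr p * dual_mass M m powr (1 - p)) \<le> i"
      by (elim exE conjE) (rule that)
    have op: "0 \<le> sparse_op \<mu> S G m" for m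
      using S by (intro sparse_op_nonneg \<mu>_pos G) (auto simp: sparse_def)
    have "(\<integral>\<^sup>+x\<in>Q. ennreal (F x powr p) * ennreal (w x) \<partial>lebesgue) = ennreal (\<Sum>m\<in>X. T m powr p * w_mass M m)"
      unfolding Q_def using T by (intro integral_of_step) auto
    also have "\<dots> \<le> ennreal ((C * ?A) powr p * i)"
    proof (rule ennreal_leI)
      have "(\<Sum>m\<in>X. T m powr p * w_mass M m) \<le> (\<Sum>m\<in>X. (C * sparse_op \<mu> S G m) powr p * w_mass M m)"
        using TS p by (intro sum_mono mult_right_mono powr_mono2) (auto simp: masses(2) less_imp_le)
      also have "\<dots> = C powr p * (\<Sum>m\<in>X. sparse_op \<mu> S G m powr p * w_mass M m)"
        using C op by (simp add: powr_mult sum_distrib_left mult.assoc)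
      also have "\<dots> \<le> C powr p * (?A powr p * i)"
      proof (intro mult_left_mono)
        show "(\<Sum>m\<in>X. sparse_op \<mu> S G m powr p * w_mass M m) \<le> ?A powr p * i"
          by (rule order_trans[OF sparse_strong[OF S G]]) (intro mult_left_mono Gi, simp)
      qed simp
      also have "\<dots> = (C * ?A) powr p * i" using C A by (simp add: powr_mult)
      finally show "(\<Sum>m\<in>X. T m powr p * w_mass M m) \<le> (C * ?A) powr p * i" .
    qed
    finally have 1: "(\<integral>\<^sup>+x\<in>Q. ennreal (F x powr p) * ennreal (w x) \<partial>lebesgue) \<le> ennreal ((C * ?A) powr p) * I"
      using real by (simp add: ennreal_mult)
    have 2: "ennreal (\<alpha> powr p) * (\<integral>\<^sup>+x\<in>Q. ennreal (indicator {x. \<alpha> < F x} x) * ennreal (w x) \<partial>lebesgue) \<le>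
      ennreal ((C * ?B) powr p) * I" if \<alpha>: "0 < \<alpha>"
    proof -
      have "(\<integral>\<^sup>+x\<in>Q. ennreal (indicator {x. \<alpha> < F x} x) * ennreal (w x) \<partial>lebesgue) =
          ennreal (\<Sum>m\<in>X. indicator {m. \<alpha> < T m} m * w_mass M m)"
        unfolding Q_def using T by (intro integral_of_step) (auto simp: indicator_def)
      also have "(\<Sum>m\<in>X. indicator {m. \<alpha> < T m} m * w_mass M m) = sum (w_mass M) {m \<in> X. \<alpha> < T m}"
      proof -
        have "(\<Sum>m\<in>X. indicator {m. \<alpha> < T m} m * w_mass M m) = (\<Sum>m\<in>X. if \<alpha> < T m then w_mass M m else 0)"
          by (intro sum.cong) (auto simp: indicator_def)
        then show ?thesis unfolding sum.inter_filter[OF fin] .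
      qed
      finally have e: "ennreal (\<alpha> powr p) * (\<integral>\<^sup>+x\<in>Q. ennreal (indicator {x. \<alpha> < F x} x) * ennreal (w x) \<partial>lebesgue) =
          ennreal (\<alpha> powr p * sum (w_mass M) {m \<in> X. \<alpha> < T m})"
        by (simp add: ennreal_mult sum_nonneg masses(2) less_imp_le)
      have "sum (w_mass M) {m \<in> X. \<alpha> < T m} \<le> sum (w_mass M) {m \<in> X. \<alpha> / C < sparse_op \<mu> S G m}"
        using TS C fin by (intro sum_mono2) (auto simp: masses(2) less_imp_le field_simps intro: less_le_trans)
      then have "\<alpha> powr p * sum (w_mass M) {m \<in> X. \<alpha> < T m} \<le>
          \<alpha> powr p * sum (w_mass M) {m \<in> X. \<alpha> / C < sparse_op \<mu> S G m}" by (intro mult_left_mono) auto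
      also have "\<dots> = C powr p * ((\<alpha> / C) powr p * sum (w_mass M) {m \<in> X. \<alpha> / C < sparse_op \<mu> S G m})"
        using C \<alpha> by (simp add: powr_divide)
      also have "\<dots> \<le> C powr p * (?B powr p * i)"
      proof (intro mult_left_mono)
        show "(\<alpha> / C) powr p * sum (w_mass M) {m \<in> X. \<alpha> / C < sparse_op \<mu> S G m} \<le> ?B powr p * i"
          by (rule order_trans[OF sparse_weak_all[OF S G]])
            (use C \<alpha> K_gt0 in \<open>auto intro!: mult_left_mono Gi\<close>)
      qed simp
      also have "\<dots> = (C * ?B) powr p * i" using C A by (simp add: powr_mult)
      finally show ?thesis unfolding e using real by (simp add: ennreal_mult[symmetric] ennreal_leI)
    qed
    show ?thesis using 1 2 by blast
  qed
  then show "(\<integral>\<^sup>+x\<in>Q. ennreal (F x powr p) * ennreal (w x) \<partial>lebesgue) \<le> ennreal ((C * ?A) powr p) * I"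
    "0 < \<alpha> \<Longrightarrow> ennreal (\<alpha> powr p) * (\<integral>\<^sup>+x\<in>Q. ennreal (indicator {x. \<alpha> < F x} x) * ennreal (w x) \<partial>lebesgue) \<le>
      ennreal ((C * ?B) powr p) * I" by blast+
qed

end

lemma nn_integral_dyadic_UNIV:
  fixes G :: "real^'n \<Rightarrow> ennreal"
  assumes [measurable]: "G \<in> borel_measurable lebesgue"
  shows "(\<integral>\<^sup>+x. G x \<partial>lebesgue) = (\<integral>\<^sup>+m. (\<integral>\<^sup>+x\<in>dyadic_cube i m. G x \<partial>lebesgue) \<partial>count_space UNIV)"
proof -
  have "(\<integral>\<^sup>+m. G x * indicator (dyadic_cube i m) x \<partial>count_space UNIV) = G x" for x
  proof -
    have "(\<integral>\<^sup>+m. G x * indicator (dyadic_cube i m) x \<partial>count_space UNIV) =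
        (\<integral>\<^sup>+m. G x * indicator {idx i x} m \<partial>count_space UNIV)"
      by (intro nn_integral_cong) (auto simp: indicator_def dyadic_cube_eq)
    also have "\<dots> = G x" by (simp add: nn_integral_cmult)
    finally show ?thesis .
  qed
  then have "(\<integral>\<^sup>+x. G x \<partial>lebesgue) = (\<integral>\<^sup>+x. (\<integral>\<^sup>+m. G x * indicator (dyadic_cube i m) x \<partial>count_space UNIV) \<partial>lebesgue)"
    by simp
  also have "\<dots> = (\<integral>\<^sup>+m. (\<integral>\<^sup>+x\<in>dyadic_cube i m. G x \<partial>lebesgue) \<partial>count_space UNIV)"
    by (rule nn_integral_count_space_nn_integral) auto
  finally show ?thesis .
qed

text \<open>
  The estimates on the single cubes of generation \<open>- N\<close> add up, since a partial sum acts on each of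
  them separately.
\<close>

lemma (in Ap_weight) truncated_bounds:
  fixes h k :: "nat \<Rightarrow> 'n cube_family" and f :: "nat \<Rightarrow> real^'n \<Rightarrow> real" and J N \<kappa> :: nat
  assumes hk: "\<And>j. haar \<kappa> (h j) (k j)" and r: "1 < r" and f: "\<And>j. locally_integrable (f j)"
    and fm: "\<And>j. f j \<in> borel_measurable lebesgue"
  defines "F \<equiv> \<lambda>x. lr J r (\<lambda>j. shift_partial_sum (h j) (k j) N (f j) x)"
    and "I \<equiv> \<integral>\<^sup>+x. ennreal (lr J r (\<lambda>j. f j x) powr p * w x) \<partial>lebesgue"
    and "C \<equiv> haar_const TYPE('n) r * real \<kappa>"
  shows "F \<in> borel_measurable lebesgue"
    and "(\<integral>\<^sup>+x. ennreal (F x powr p) * ennreal (w x) \<partial>lebesgue) \<le>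
      ennreal ((C * (sparse_const p * K powr max 1 (1 / (p - 1)))) powr p) * I"
    and "0 < \<alpha> \<Longrightarrow> ennreal (\<alpha> powr p) * (\<integral>\<^sup>+x. ennreal (indicator {x. \<alpha> < F x} x) * ennreal (w x) \<partial>lebesgue) \<le>
      ennreal ((C * ((sparse_const p + weak_const p) * K)) powr p) * I"
proof -
  note [measurable] = fm
  have [measurable]: "shift_partial_sum (h j) (k j) N (f j) \<in> borel_measurable lebesgue" for j
  proof -
    interpret H: haar \<kappa> "h j" "k j" by (rule hk)
    show ?thesis unfolding H.partial_sum_eq[abs_def] by measurable
  qed
  show Fm [measurable]: "F \<in> borel_measurable lebesgue" unfolding F_def lr_def by measurable
  have [measurable]: "(\<lambda>x. lr J r (\<lambda>j. f j x)) \<in> borel_measurable lebesgue" unfolding lr_def by measurable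
  interpret H0: haar \<kappa> "h 0" "k 0" by (rule hk)
  have wg: "weighted_grid \<kappa> p w" by unfold_locales (rule H0.\<kappa>)
  define I' where "I' m0 = (\<integral>\<^sup>+x\<in>dyadic_cube (- int N) m0. ennreal (lr J r (\<lambda>j. f j x) powr p * w x) \<partial>lebesgue)" for m0
  have I: "I = (\<integral>\<^sup>+m. I' m \<partial>count_space UNIV)" unfolding I_def I'_def by (rule nn_integral_dyadic_UNIV) measurable
  have "(\<integral>\<^sup>+x. ennreal (F x powr p) * ennreal (w x) \<partial>lebesgue) =
     (\<integral>\<^sup>+m. (\<integral>\<^sup>+x\<in>dyadic_cube (- int N) m. ennreal (F x powr p) * ennreal (w x) \<partial>lebesgue) \<partial>count_space UNIV)"
    by (rule nn_integral_dyadic_UNIV) measurable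
  also have "\<dots> \<le> (\<integral>\<^sup>+m. ennreal ((C * (sparse_const p * K powr max 1 (1 / (p - 1)))) powr p) * I' m \<partial>count_space UNIV)"
    unfolding F_def C_def I'_def by (intro nn_integral_mono weighted_grid.root_bounds(1)[OF wg hk r f fm])
  also have "\<dots> = ennreal ((C * (sparse_const p * K powr max 1 (1 / (p - 1)))) powr p) * I"
    unfolding I by (simp add: nn_integral_cmult)
  finally show "(\<integral>\<^sup>+x. ennreal (F x powr p) * ennreal (w x) \<partial>lebesgue) \<le>
      ennreal ((C * (sparse_const p * K powr max 1 (1 / (p - 1)))) powr p) * I" .
  assume \<alpha>: "0 < \<alpha>"
  have [measurable]: "(\<lambda>x. ennreal (indicator {x. \<alpha> < F x} x)) \<in> borel_measurable lebesgue" by measurable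
  have "ennreal (\<alpha> powr p) * (\<integral>\<^sup>+x. ennreal (indicator {x. \<alpha> < F x} x) * ennreal (w x) \<partial>lebesgue) =
     (\<integral>\<^sup>+m. ennreal (\<alpha> powr p) * (\<integral>\<^sup>+x\<in>dyadic_cube (- int N) m. ennreal (indicator {x. \<alpha> < F x} x) * ennreal (w x) \<partial>lebesgue) \<partial>count_space UNIV)"
    by (subst nn_integral_dyadic_UNIV[of _ "- int N"], measurable) (simp add: nn_integral_cmult)
  also have "\<dots> \<le> (\<integral>\<^sup>+m. ennreal ((C * ((sparse_const p + weak_const p) * K)) powr p) * I' m \<partial>count_space UNIV)"
    unfolding F_def C_def I'_def by (intro nn_integral_mono weighted_grid.root_bounds(2)[OF wg hk r f fm \<alpha>])
  also have "\<dots> = ennreal ((C * ((sparse_const p + weak_const p) * K)) powr p) * I"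
    unfolding I by (simp add: nn_integral_cmult)
  finally show "ennreal (\<alpha> powr p) * (\<integral>\<^sup>+x. ennreal (indicator {x. \<alpha> < F x} x) * ennreal (w x) \<partial>lebesgue) \<le>
      ennreal ((C * ((sparse_const p + weak_const p) * K)) powr p) * I" .
qed

section \<open>From the truncations to the shift\<close>

lemma lr_norm_ge: "1 < r \<Longrightarrow> ennreal (lr J r a) \<le> lr_norm r a"
proof -
  assume r: "1 < r"
  have "ennreal (lr J r a) = (\<Sum>j<J. ennreal (\<bar>a j\<bar> powr r)) epowr (1 / r)"
    by (simp add: lr_def sum_ennreal epowr_ennreal sum_nonneg)
  also have "\<dots> \<le> lr_norm r a"
    unfolding lr_norm_def using r by (intro epowr_mono sum_le_suminf) auto
  finally show ?thesis .
qed

lemma lr_norm_less: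
  assumes r: "1 < r" and y: "0 \<le> y" "ennreal y < lr_norm r a"
  shows "\<exists>J. y powr r < (\<Sum>j<J. \<bar>a j\<bar> powr r)"
proof -
  have "ennreal (y powr r) < (\<Sum>j. ennreal (\<bar>a j\<bar> powr r))"
  proof (rule ccontr)
    assume "\<not> ?thesis"
    then have "lr_norm r a \<le> ennreal (y powr r) epowr (1 / r)"
      unfolding lr_norm_def using r by (intro epowr_mono) (auto simp: not_less)
    also have "\<dots> = ennreal y" using r y by (simp add: epowr_ennreal powr_powr)
    finally show False using y by simp
  qed
  then obtain J where "ennreal (y powr r) < (\<Sum>j<J. ennreal (\<bar>a j\<bar> powr r))"
    unfolding suminf_eq_SUP by (auto simp: less_SUP_iff)
  then show ?thesis by (auto simp: sum_ennreal ennreal_less_iff)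
qed

text \<open>
  Lower semicontinuity of the \<open>l^r\<close> norm under pointwise convergence, with the number of coordinates
  growing along the sequence.
\<close>

lemma lr_norm_lower_limit:
  assumes r: "1 < r" and conv: "\<And>j. (\<lambda>t. a t j) \<longlonglongrightarrow> b j" and y: "0 \<le> y" "ennreal y < lr_norm r b"
  shows "\<forall>\<^sub>F t in sequentially. y < lr t r (a t)"
proof -
  obtain J where J: "y powr r < (\<Sum>j<J. \<bar>b j\<bar> powr r)" using lr_norm_less[OF r y] by blast
  have "(\<lambda>t. \<Sum>j<J. \<bar>a t j\<bar> powr r) \<longlonglongrightarrow> (\<Sum>j<J. \<bar>b j\<bar> powr r)"
    using r by (intro tendsto_sum tendsto_powr' tendsto_rabs conv tendsto_const) auto
  then have "\<forall>\<^sub>F t in sequentially. y powr r < (\<Sum>j<J. \<bar>a t j\<bar> powr r)" by (rule order_tendstoD(1)[OF _ J])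
  then show ?thesis using eventually_ge_at_top[of J]
  proof eventually_elim
    case (elim t)
    have "(\<Sum>j<J. \<bar>a t j\<bar> powr r) \<le> (\<Sum>j<t. \<bar>a t j\<bar> powr r)" using elim(2) by (intro sum_mono2) auto
    then have "(y powr r) powr (1 / r) < lr t r (a t)"
      unfolding lr_def using elim(1) r by (intro powr_less_mono2) auto
    then show ?case using r y by (simp add: powr_powr)
  qed
qed

text \<open>
  Choose \<open>n t\<close> so that the first \<open>t\<close> components are within \<open>2^(-t)\<close> of their limits in the ball of
  radius \<open>t\<close>, up to a set of measure \<open>2^(-t)\<close>, and apply the Borel-Cantelli lemma.
\<close>

lemma diagonal_convergence:
  fixes S :: "nat \<Rightarrow> nat \<Rightarrow> real^'n::finite \<Rightarrow> real"
  assumes S [measurable]: "\<And>N j. S N j \<in> borel_measurable lebesgue" and g [measurable]: "\<And>j. g j \<in> borel_measurable lebesgue"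
    and conv: "\<And>j B \<epsilon>. B \<in> sets lebesgue \<Longrightarrow> bounded B \<Longrightarrow> 0 < \<epsilon> \<Longrightarrow>
      (\<lambda>N. emeasure lebesgue {x\<in>B. \<bar>S N j x - g j x\<bar> > \<epsilon>}) \<longlonglongrightarrow> 0"
  shows "\<exists>n. AE x in lebesgue. \<forall>j. (\<lambda>t. S (n t) j x) \<longlonglongrightarrow> g j x"
proof -
  define B where "B t = ball (0 :: real^'n) (real t)" for t
  define E where "E N j t = {x \<in> B t. \<bar>S N j x - g j x\<bar> > (1/2)^t}" for N j t
  have [measurable]: "B t \<in> sets lebesgue" for t by (simp add: B_def)
  have Em [measurable]: "E N j t \<in> sets lebesgue" for N j t
  proof -
    have "E N j t = B t \<inter> {x \<in> space lebesgue. \<bar>S N j x - g j x\<bar> > (1/2)^t}" by (auto simp: E_def)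
    also have "\<dots> \<in> sets lebesgue" by measurable
    finally show ?thesis .
  qed
  have "\<exists>N. \<forall>j<t. emeasure lebesgue (E N j t) \<le> ennreal ((1/2)^t / (real t + 1))" for t
  proof -
    have "\<forall>\<^sub>F N in sequentially. \<forall>j\<in>{..<t}. emeasure lebesgue (E N j t) < ennreal ((1/2)^t / (real t + 1))"
    proof (intro eventually_ball_finite ballI)
      fix j
      show "\<forall>\<^sub>F N in sequentially. emeasure lebesgue (E N j t) < ennreal ((1/2)^t / (real t + 1))"
        unfolding E_def by (rule order_tendstoD(2)[OF conv]) (auto simp: B_def)
    qed simp
    then show ?thesis by (auto simp: eventually_sequentially intro: less_imp_le)
  qed
  then obtain n where n: "\<And>t j. j < t \<Longrightarrow> emeasure lebesgue (E (n t) j t) \<le> ennreal ((1/2)^t / (real t + 1))"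
    by metis
  define A where "A t = (\<Union>j<t. E (n t) j t)" for t
  have Am: "A t \<in> sets lebesgue" for t unfolding A_def by measurable
  have A: "emeasure lebesgue (A t) \<le> ennreal ((1/2)^t)" for t
  proof -
    have "emeasure lebesgue (A t) \<le> (\<Sum>j<t. emeasure lebesgue (E (n t) j t))"
      unfolding A_def by (intro emeasure_subadditive_finite) auto
    also have "\<dots> \<le> (\<Sum>j<t. ennreal ((1/2)^t / (real t + 1)))" by (intro sum_mono n) auto
    also have "\<dots> = ennreal (real t * ((1/2)^t / (real t + 1)))" by (subst sum_ennreal) auto
    also have "\<dots> \<le> ennreal ((1/2)^t)"
      using mult_right_mono[of "real t / (real t + 1)" 1 "(1/2)^t"] by (intro ennreal_leI) simp
    finally show ?thesis .
  qed
  have "AE x in lebesgue. eventually (\<lambda>t. x \<in> space lebesgue - A t) sequentially"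
  proof (rule borel_cantelli_AE1[OF Am])
    show "emeasure lebesgue (A t) < \<infinity>" for t using A[of t] by (simp add: le_less_trans[OF _ ennreal_less_top])
    show "summable (\<lambda>t. measure lebesgue (A t))"
    proof (rule summable_comparison_test'[of "\<lambda>t. (1/2::real)^t"])
      show "norm (measure lebesgue (A t)) \<le> (1/2)^t" for t
        using A[of t] by (simp add: measure_def enn2real_leI)
    qed (simp add: summable_geometric)
  qed
  then have "AE x in lebesgue. \<forall>j. (\<lambda>t. S (n t) j x) \<longlonglongrightarrow> g j x"
  proof eventually_elim
    case (elim x)
    show ?case
    proof
      fix j
      obtain t0 where t0: "norm x < real t0" using reals_Archimedean2 by blast
      have "\<forall>\<^sub>F t in sequentially. norm (S (n t) j x - g j x) \<le> (1/2)^t"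
        using elim eventually_gt_at_top[of j] eventually_ge_at_top[of t0]
      proof eventually_elim
        case (elim t)
        then have "x \<notin> E (n t) j t" "x \<in> B t" using t0 by (auto simp: A_def B_def)
        then show ?case by (auto simp: E_def)
      qed
      then have "(\<lambda>t. S (n t) j x - g j x) \<longlonglongrightarrow> 0"
        by (rule Lim_null_comparison) (simp add: LIMSEQ_realpow_zero)
      then show "(\<lambda>t. S (n t) j x) \<longlonglongrightarrow> g j x" by (simp add: LIM_zero_iff)
    qed
  qed
  then show ?thesis by blast
qed

context Ap_weight
begin

text \<open>
  Fatou's lemma for the measure \<open>\<nu>\<close> with density \<open>w\<close> along the diagonal sequence of partial sums. In
  the weak case it is applied to the indicator functions of the level sets.
\<close>

lemma shift_bounds:
  fixes h k :: "nat \<Rightarrow> 'n cube_family" and f :: "nat \<Rightarrow> real^'n \<Rightarrow> real" and \<kappa> :: nat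
  assumes hk: "\<And>j. haar \<kappa> (h j) (k j)" and r: "1 < r"
    and f: "f \<in> Lp_lr_space p r w" "f \<in> vector_haar_shift_domain h k"
  defines "C \<equiv> haar_const TYPE('n) r * real \<kappa>"
  shows "Lp_norm p w (vector_haar_shift r h k f) \<le>
      ennreal (C * (sparse_const p * K powr max 1 (1 / (p - 1)))) * Lp_lr_norm p r w f"
    and "weak_Lp_norm p w (vector_haar_shift r h k f) \<le>
      ennreal (C * ((sparse_const p + weak_const p) * K)) * Lp_lr_norm p r w f"
proof -
  let ?A = "C * (sparse_const p * K powr max 1 (1 / (p - 1)))" and ?B = "C * ((sparse_const p + weak_const p) * K)"
  have wc: "0 \<le> weak_const p" using testing_const_pos[OF p] by (simp add: weak_const_def)
  have AB: "0 \<le> ?A" "0 \<le> ?B"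
    using haar_const_pos[OF r, where 'n='n] sparse_const_pos[OF p] wc K_gt0 by (auto simp: C_def)
  define g where "g j = haar_shift (h j) (k j) (f j)" for j
  have has: "has_haar_shift (h j) (k j) (f j) (g j)" for j
  proof -
    have "\<exists>g. has_haar_shift (h j) (k j) (f j) g"
      using f(2) by (simp add: vector_haar_shift_domain_def haar_shift_defined_def)
    then show ?thesis unfolding g_def haar_shift_def by (rule someI_ex)
  qed
  have fm: "f j \<in> borel_measurable lebesgue" for j using f(1) by (auto simp: Lp_lr_space_def)
  have fl: "locally_integrable (f j)" and gm: "g j \<in> borel_measurable lebesgue" for j
    using has[of j] by (auto simp: has_haar_shift_def)
  note [measurable] = fm gm
  define S where "S N j = shift_partial_sum (h j) (k j) N (f j)" for N j
  have Sm [measurable]: "S N j \<in> borel_measurable lebesgue" for N j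
  proof -
    interpret H: haar \<kappa> "h j" "k j" by (rule hk)
    show ?thesis unfolding S_def H.partial_sum_eq[abs_def] by measurable
  qed
  have "\<exists>n. AE x in lebesgue. \<forall>j. (\<lambda>t. S (n t) j x) \<longlonglongrightarrow> g j x"
  proof (rule diagonal_convergence[OF Sm gm])
    fix j and B :: "(real^'n) set" and \<epsilon> :: real assume "B \<in> sets lebesgue" "bounded B" "0 < \<epsilon>"
    then show "(\<lambda>N. emeasure lebesgue {x \<in> B. \<epsilon> < \<bar>S N j x - g j x\<bar>}) \<longlonglongrightarrow> 0"
      using has[of j] unfolding has_haar_shift_def S_def by blast
  qed
  then obtain n where n: "AE x in lebesgue. \<forall>j. (\<lambda>t. S (n t) j x) \<longlonglongrightarrow> g j x" by blast
  define F where "F t x = lr t r (\<lambda>j. S (n t) j x)" for t x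
  define G where "G x = lr_norm r (\<lambda>j. g j x)" for x
  have Fm [measurable]: "F t \<in> borel_measurable lebesgue" for t unfolding F_def lr_def by measurable
  have Gm [measurable]: "G \<in> borel_measurable lebesgue" unfolding G_def lr_norm_def by measurable
  have G: "vector_haar_shift r h k f = G" by (simp add: vector_haar_shift_def G_def g_def fun_eq_iff)
  have lim: "AE x in lebesgue. \<forall>y\<ge>0. ennreal y < G x \<longrightarrow> (\<forall>\<^sub>F t in sequentially. y < F t x)"
    using n
  proof eventually_elim
    case (elim x)
    then show ?case unfolding G_def F_def using lr_norm_lower_limit[OF r, of "\<lambda>t j. S (n t) j x" "\<lambda>j. g j x"] by blast
  qed
  define I where "I = (\<integral>\<^sup>+x. lr_norm r (\<lambda>j. f j x) epowr p * ennreal (w x) \<partial>lebesgue)"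
  have I: "Lp_lr_norm p r w f = I epowr (1 / p)" by (simp add: Lp_lr_norm_def Lp_norm_def I_def)
  have It: "(\<integral>\<^sup>+x. ennreal (lr t r (\<lambda>j. f j x) powr p * w x) \<partial>lebesgue) \<le> I" for t
    unfolding I_def
  proof (intro nn_integral_mono)
    fix x
    have "ennreal (lr t r (\<lambda>j. f j x) powr p * w x) = ennreal (lr t r (\<lambda>j. f j x)) epowr p * ennreal (w x)"
      by (simp add: ennreal_mult' epowr_ennreal)
    also have "\<dots> \<le> lr_norm r (\<lambda>j. f j x) epowr p * ennreal (w x)"
      using p by (intro mult_right_mono epowr_mono lr_norm_ge r) auto
    finally show "ennreal (lr t r (\<lambda>j. f j x) powr p * w x) \<le> lr_norm r (\<lambda>j. f j x) epowr p * ennreal (w x)" .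
  qed
  note tb = truncated_bounds[where h = h and k = k and f = f and \<kappa> = \<kappa>, OF hk r fl fm]
  define \<nu> where "\<nu> = density lebesgue (\<lambda>x. ennreal (w x))"
  have sets\<nu> [measurable_cong]: "sets \<nu> = sets lebesgue" by (simp add: \<nu>_def)
  have int\<nu>: "(\<integral>\<^sup>+x. u x \<partial>\<nu>) = (\<integral>\<^sup>+x. u x * ennreal (w x) \<partial>lebesgue)"
    if "u \<in> borel_measurable lebesgue" for u
    unfolding \<nu>_def using that by (subst nn_integral_density) (auto simp: mult.commute)
  have AE\<nu>: "AE x in \<nu>. P x" if "AE x in lebesgue. P x" for P
    unfolding \<nu>_def using that by (subst AE_density) (auto elim: eventually_mono)
  have strong: "(\<integral>\<^sup>+x. G x epowr p * ennreal (w x) \<partial>lebesgue) \<le> ennreal (?A powr p) * I"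
  proof -
    have "(\<integral>\<^sup>+x. G x epowr p * ennreal (w x) \<partial>lebesgue) = (\<integral>\<^sup>+x. G x epowr p \<partial>\<nu>)"
      by (subst int\<nu>) auto
    also have "\<dots> \<le> (\<integral>\<^sup>+x. liminf (\<lambda>t. ennreal (F t x powr p)) \<partial>\<nu>)"
    proof (rule nn_integral_mono_AE, use AE\<nu>[OF lim] in eventually_elim)
      case (elim x)
      show ?case
        unfolding le_Liminf_iff
      proof (intro allI impI)
        fix y assume y: "y < G x epowr p"
        then obtain z where z: "y = ennreal z" "0 \<le> z" by (cases y) auto
        have "ennreal (z powr (1 / p)) < G x"
        proof (rule ccontr)
          assume "\<not> ?thesis"
          then have "G x epowr p \<le> ennreal (z powr (1 / p)) epowr p"
            using p by (intro epowr_mono) (auto simp: not_less)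
          also have "\<dots> = y" using z p by (simp add: epowr_ennreal powr_powr)
          finally show False using y by simp
        qed
        then have "\<forall>\<^sub>F t in sequentially. z powr (1 / p) < F t x" using elim by simp
        then show "\<forall>\<^sub>F t in sequentially. y < ennreal (F t x powr p)"
        proof eventually_elim
          case (elim t)
          then have "(z powr (1 / p)) powr p < F t x powr p" using p by (intro powr_less_mono2) auto
          then show ?case using z p by (simp add: powr_powr ennreal_less_iff)
        qed
      qed
    qed
    also have "\<dots> \<le> liminf (\<lambda>t. \<integral>\<^sup>+x. ennreal (F t x powr p) \<partial>\<nu>)"
      by (rule nn_integral_liminf) measurable
    also have "\<dots> \<le> ennreal (?A powr p) * I"
    proof (rule order_trans[OF Liminf_le_Limsup], simp, rule Limsup_bounded, intro always_eventually allI)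
      fix t
      have "(\<integral>\<^sup>+x. ennreal (F t x powr p) \<partial>\<nu>) = (\<integral>\<^sup>+x. ennreal (F t x powr p) * ennreal (w x) \<partial>lebesgue)"
        by (rule int\<nu>) measurable
      also have "\<dots> \<le> ennreal (?A powr p) * (\<integral>\<^sup>+x. ennreal (lr t r (\<lambda>j. f j x) powr p * w x) \<partial>lebesgue)"
        unfolding F_def S_def C_def by (rule tb(2))
      also have "\<dots> \<le> ennreal (?A powr p) * I" by (intro mult_left_mono It) simp
      finally show "(\<integral>\<^sup>+x. ennreal (F t x powr p) \<partial>\<nu>) \<le> ennreal (?A powr p) * I" .
    qed
    finally show ?thesis .
  qed
  have root: "(ennreal (t powr p) * I) epowr (1 / p) = ennreal t * Lp_lr_norm p r w f" if "0 \<le> t" for t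
    using that p by (simp add: I epowr_mult_ennreal powr_powr)
  have "Lp_norm p w G \<le> (ennreal (?A powr p) * I) epowr (1 / p)"
    unfolding Lp_norm_def using p by (intro epowr_mono strong) auto
  then show "Lp_norm p w (vector_haar_shift r h k f) \<le> ennreal ?A * Lp_lr_norm p r w f"
    unfolding G root[OF AB(1)] .
  show "weak_Lp_norm p w (vector_haar_shift r h k f) \<le> ennreal ?B * Lp_lr_norm p r w f"
    unfolding G weak_Lp_norm_def
  proof (rule SUP_least)
    fix \<alpha> :: real assume "\<alpha> \<in> {0<..}"
    then have \<alpha>: "0 < \<alpha>" by simp
    let ?W = "weighted_measure w {x. ennreal \<alpha> < G x}"
    have "?W = (\<integral>\<^sup>+x. indicator {x. ennreal \<alpha> < G x} x * ennreal (w x) \<partial>lebesgue)"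
      unfolding weighted_measure_def by (simp add: mult.commute)
    also have "\<dots> = (\<integral>\<^sup>+x. indicator {x. ennreal \<alpha> < G x} x \<partial>\<nu>)"
      by (rule int\<nu>[symmetric]) measurable
    also have "\<dots> \<le> (\<integral>\<^sup>+x. liminf (\<lambda>t. ennreal (indicator {x. \<alpha> < F t x} x)) \<partial>\<nu>)"
    proof (rule nn_integral_mono_AE, use AE\<nu>[OF lim] in eventually_elim)
      case (elim x)
      show ?case
      proof (cases "ennreal \<alpha> < G x")
        case True
        then have "\<forall>\<^sub>F t in sequentially. \<alpha> < F t x" using elim \<alpha> by simp
        then have "1 \<le> liminf (\<lambda>t. ennreal (indicator {x. \<alpha> < F t x} x))"
          by (intro Liminf_bounded) (auto elim!: eventually_mono simp: indicator_def)
        then show ?thesis using True by simp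
      qed simp
    qed
    also have "\<dots> \<le> liminf (\<lambda>t. \<integral>\<^sup>+x. ennreal (indicator {x. \<alpha> < F t x} x) \<partial>\<nu>)"
      by (rule nn_integral_liminf) measurable
    finally have W: "?W \<le> liminf (\<lambda>t. \<integral>\<^sup>+x. ennreal (indicator {x. \<alpha> < F t x} x) \<partial>\<nu>)" .
    have bound: "(\<integral>\<^sup>+x. ennreal (indicator {x. \<alpha> < F t x} x) \<partial>\<nu>) \<le> ennreal ((?B / \<alpha>) powr p) * I" for t
    proof -
      have "(\<integral>\<^sup>+x. ennreal (indicator {x. \<alpha> < F t x} x) \<partial>\<nu>) =
          (\<integral>\<^sup>+x. ennreal (indicator {x. \<alpha> < F t x} x) * ennreal (w x) \<partial>lebesgue)"
        by (rule int\<nu>) measurable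
      also have "\<dots> = ennreal ((1 / \<alpha>) powr p) * (ennreal (\<alpha> powr p) *
          (\<integral>\<^sup>+x. ennreal (indicator {x. \<alpha> < F t x} x) * ennreal (w x) \<partial>lebesgue))"
      proof -
        have "ennreal ((1 / \<alpha>) powr p) * ennreal (\<alpha> powr p) = 1"
          using \<alpha> by (simp add: powr_divide flip: ennreal_mult)
        then show ?thesis by (simp flip: mult.assoc)
      qed
      also have "\<dots> \<le> ennreal ((1 / \<alpha>) powr p) * (ennreal (?B powr p) * (\<integral>\<^sup>+x. ennreal (lr t r (\<lambda>j. f j x) powr p * w x) \<partial>lebesgue))"
        unfolding F_def S_def C_def by (intro mult_left_mono tb(3) \<alpha>) simp
      also have "\<dots> \<le> ennreal ((1 / \<alpha>) powr p) * (ennreal (?B powr p) * I)" by (intro mult_left_mono It) auto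
      also have "\<dots> = ennreal ((?B / \<alpha>) powr p) * I"
      proof -
        have "(?B / \<alpha>) powr p = (1 / \<alpha>) powr p * ?B powr p"
          using \<alpha> AB(2) by (simp add: powr_divide)
        then show ?thesis by (simp add: ennreal_mult mult.assoc)
      qed
      finally show ?thesis .
    qed
    have "liminf (\<lambda>t. \<integral>\<^sup>+x. ennreal (indicator {x. \<alpha> < F t x} x) \<partial>\<nu>) \<le> ennreal ((?B / \<alpha>) powr p) * I"
      by (rule order_trans[OF Liminf_le_Limsup], simp, rule Limsup_bounded, intro always_eventually allI bound)
    with W have "?W \<le> ennreal ((?B / \<alpha>) powr p) * I" by (rule order_trans)
    then have "?W epowr (1 / p) \<le> (ennreal ((?B / \<alpha>) powr p) * I) epowr (1 / p)"
      using p by (intro epowr_mono) auto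
    also have "\<dots> = ennreal (?B / \<alpha>) * Lp_lr_norm p r w f" using AB(2) \<alpha> by (intro root) simp
    finally have "ennreal \<alpha> * ?W epowr (1 / p) \<le> ennreal \<alpha> * (ennreal (?B / \<alpha>) * Lp_lr_norm p r w f)"
      by (intro mult_left_mono) auto
    also have "\<dots> = ennreal ?B * Lp_lr_norm p r w f"
    proof -
      have "ennreal \<alpha> * ennreal (?B / \<alpha>) = ennreal (\<alpha> * (?B / \<alpha>))"
        using \<alpha> AB(2) by (intro ennreal_mult[symmetric]) auto
      also have "\<alpha> * (?B / \<alpha>) = ?B" using \<alpha> by simp
      finally show ?thesis by (simp only: mult.assoc[symmetric])
    qed
    finally show "ennreal \<alpha> * ?W epowr (1 / p) \<le> ennreal ?B * Lp_lr_norm p r w f" .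
  qed
qed

end

theorem theorem1p14:
  fixes p r :: real
  assumes "1 < p" and "1 < r"
  shows "\<exists>C>0. \<forall>\<kappa>\<ge>1. \<forall>(h :: nat \<Rightarrow> 'n::finite cube_family) (k :: nat \<Rightarrow> 'n cube_family).
           (\<forall>j. generalized_haar_shift \<kappa> (h j) (k j)) \<longrightarrow>
           (\<forall>w\<in>Ap p.
              vector_haar_shift_norm p r w (weak_Lp_norm p w) h k
                \<le> ennreal (C * 2 ^ \<kappa>) * Ap_const p w \<and>
              vector_haar_shift_norm p r w (Lp_norm p w) h k
                \<le> ennreal (C * real \<kappa> ^ 4) * Ap_const p w epowr max 1 (1 / (p - 1)))"
proof -
  define H where "H = haar_const TYPE('n) r"
  define C where "C = H * (sparse_const p + weak_const p)"
  have H: "0 < H" using haar_const_pos[OF assms(2)] by (simp add: H_def)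
  have sc: "0 < sparse_const p" by (rule sparse_const_pos[OF assms(1)])
  have wc: "0 \<le> weak_const p" using testing_const_pos[OF assms(1)] by (simp add: weak_const_def)
  have C: "0 < C" using H sc wc by (simp add: C_def)
  show ?thesis
  proof (rule exI[of _ C], intro conjI C allI impI ballI)
    fix \<kappa> :: nat and h k :: "nat \<Rightarrow> 'n cube_family" and w :: "real^'n \<Rightarrow> real"
    assume \<kappa>: "1 \<le> \<kappa>" and gs: "\<forall>j. generalized_haar_shift \<kappa> (h j) (k j)" and w: "w \<in> Ap p"
    have hk: "haar \<kappa> (h j) (k j)" for j using gs \<kappa> by unfold_locales auto
    interpret Ap_weight p w using assms(1) w by unfold_locales
    have le: "vector_haar_shift_norm p r w normX h k \<le> A"
      if "\<And>f. f \<in> Lp_lr_space p r w \<Longrightarrow> f \<in> vector_haar_shift_domain h k \<Longrightarrow>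
        normX (vector_haar_shift r h k f) \<le> A * Lp_lr_norm p r w f" for normX A
      unfolding vector_haar_shift_norm_def using that by (intro Inf_lower) auto
    have \<kappa>2: "real \<kappa> \<le> 2 ^ \<kappa>" by (simp add: less_imp_le)
    have \<kappa>4: "real \<kappa> \<le> real \<kappa> ^ 4" using power_increasing[of 1 4 "real \<kappa>"] \<kappa> by simp
    have "vector_haar_shift_norm p r w (weak_Lp_norm p w) h k \<le>
        ennreal (H * real \<kappa> * ((sparse_const p + weak_const p) * K))"
      unfolding H_def by (rule le) (rule shift_bounds(2)[OF hk assms(2)])
    also have "\<dots> \<le> ennreal (C * 2 ^ \<kappa> * K)"
    proof (rule ennreal_leI)
      have "H * real \<kappa> * ((sparse_const p + weak_const p) * K) = (C * K) * real \<kappa>" by (simp add: C_def)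
      also have "\<dots> \<le> (C * K) * 2 ^ \<kappa>" using C K(2) \<kappa>2 by (intro mult_left_mono) auto
      finally show "H * real \<kappa> * ((sparse_const p + weak_const p) * K) \<le> C * 2 ^ \<kappa> * K" by (simp add: ac_simps)
    qed
    also have "\<dots> = ennreal (C * 2 ^ \<kappa>) * Ap_const p w" using C K by (simp add: ennreal_mult)
    finally show "vector_haar_shift_norm p r w (weak_Lp_norm p w) h k \<le> ennreal (C * 2 ^ \<kappa>) * Ap_const p w" .
    let ?e = "max 1 (1 / (p - 1))"
    have "vector_haar_shift_norm p r w (Lp_norm p w) h k \<le> ennreal (H * real \<kappa> * (sparse_const p * K powr ?e))"
      unfolding H_def by (rule le) (rule shift_bounds(1)[OF hk assms(2)])
    also have "\<dots> \<le> ennreal (C * real \<kappa> ^ 4 * K powr ?e)"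
    proof (rule ennreal_leI)
      have "H * real \<kappa> * (sparse_const p * K powr ?e) = (H * sparse_const p) * real \<kappa> * K powr ?e" by simp
      also have "\<dots> \<le> C * real \<kappa> ^ 4 * K powr ?e"
        using H sc wc \<kappa>4 by (intro mult_right_mono mult_mono) (auto simp: C_def)
      finally show "H * real \<kappa> * (sparse_const p * K powr ?e) \<le> C * real \<kappa> ^ 4 * K powr ?e" .
    qed
    also have "\<dots> = ennreal (C * real \<kappa> ^ 4) * Ap_const p w epowr ?e"
      using C K by (simp add: ennreal_mult epowr_ennreal)
    finally show "vector_haar_shift_norm p r w (Lp_norm p w) h k \<le>
        ennreal (C * real \<kappa> ^ 4) * Ap_const p w epowr ?e" .
  qed
qed

end
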